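(* Let $\mathcal{M}$ be a $\mathrm{JBW}^*$-algebra equipped with a normal faithful tracial state $\varphi$. Suppose that $1\leq p,q,r\leq\infty$ are such that $\frac1r=\frac1p+\frac1q$. The product $(x,y)\mapsto x\circ y$ on $\mathcal{M}$ induces a contractive bilinear map $\mathrm{L}^p(\mathcal{M})\times\mathrm{L}^q(\mathcal{M})\to\mathrm{L}^r(\mathcal{M})$, $(h,k)\mapsto h\circ k$, i.e. $$\|h\circ k\|_{\mathrm{L}^r(\mathcal{M})}\leq\|h\|_{\mathrm{L}^p(\mathcal{M})}\|k\|_{\mathrm{L}^q(\mathcal{M})},\quad h\in\mathrm{L}^p(\mathcal{M}),\ k\in\mathrm{L}^q(\mathcal{M}).$$
   Context: A $\mathrm{JBW}^*$-algebra is a complex Jordan algebra $(\mathcal{M},\circ)$ with involution $*$ which is a dual Banach space satisfying $\|x\circ y\|\le\|x\|\|y\|$, $\|x^*\|=\|x\|$, $\|\{x,x^*,x\}\|=\|x\|^3$, where $\{x,y,z\}=(x\circ y)\circ z+(y\circ z)\circ x-(x\circ z)\circ y$; it is unital with unique predual $\mathcal{M}_*$. Positive elements are squares of selfadjoint elements. A normal faithful tracial state is a weak* continuous positive linear functional $\varphi$ with $\varphi(1)=1$, $\varphi(x)>0$ for every nonzero positive $x$, and $\varphi(x\circ(y\circ z))=\varphi((x\circ y)\circ z)$ for all $x,y,z\in\mathcal{M}$. Nonassociative $\mathrm{L}^p$-space: for $x\in\mathcal{M}$ let $\varphi_x\in\mathcal{M}_*$, $\varphi_x(y)=\varphi(x\circ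 y)$. The injective map $i\colon\mathcal{M}\to\mathcal{M}_*$, $x\mapsto\varphi_x$ makes $(\mathcal{M},\mathcal{M}_* )$ an interpolation couple. For $1<p<\infty$, $\mathrm{L}^p(\mathcal{M})=\mathrm{L}^p(\mathcal{M},\varphi)=(\mathcal{M},\mathcal{M}_* )_{1/p}$ (Calderón complex interpolation); $\mathrm{L}^\infty(\mathcal{M})=\mathcal{M}$, $\mathrm{L}^1(\mathcal{M})=\mathcal{M}_*$. Via $i$, $\mathcal{M}$ is a subspace of each $\mathrm{L}^p(\mathcal{M})$, dense for $p<\infty$. "Induces" means that the bilinear map on the $\mathrm{L}^p$-spaces extends the product of $\mathcal{M}$. *)

theory Defs
  imports "HOL-Analysis.Analysis"
begin

section \<open>Complex Banach spaces\<close>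

class complex_banach = banach +
  fixes scaleC :: "complex \<Rightarrow> 'a \<Rightarrow> 'a" (infixr "*\<^sub>C" 75)
  assumes scaleC_add_right: "c *\<^sub>C (x + y) = c *\<^sub>C x + c *\<^sub>C y"
    and scaleC_add_left: "(c + d) *\<^sub>C x = c *\<^sub>C x + d *\<^sub>C x"
    and scaleC_scaleC: "c *\<^sub>C (d *\<^sub>C x) = (c * d) *\<^sub>C x"
    and scaleC_of_real: "complex_of_real t *\<^sub>C x = t *\<^sub>R x"
    and norm_scaleC: "norm (c *\<^sub>C x) = cmod c * norm x"

lemma bounded_linear_scaleC: "bounded_linear (scaleC c :: 'a::complex_banach \<Rightarrow> 'a)"
proof (rule bounded_linear_intro[where K = "cmod c"])
  fix x y :: 'a and t :: real
  show "c *\<^sub>C (x + y) = c *\<^sub>C x + c *\<^sub>C y"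
    by (rule scaleC_add_right)
  show "c *\<^sub>C (t *\<^sub>R x) = t *\<^sub>R (c *\<^sub>C x)"
    by (simp flip: scaleC_of_real add: scaleC_scaleC mult.commute)
  show "norm (c *\<^sub>C x) \<le> norm x * cmod c"
    by (simp add: norm_scaleC mult.commute)
qed

instantiation complex :: complex_banach
begin
definition scaleC_complex :: "complex \<Rightarrow> complex \<Rightarrow> complex"
  where "scaleC_complex c z = c * z"
instance
  by standard (simp_all add: scaleC_complex_def algebra_simps norm_mult scaleR_conv_of_real)
end

instantiation blinfun :: (real_normed_vector, complex_banach) complex_banach
begin

definition scaleC_blinfun :: "complex \<Rightarrow> ('a \<Rightarrow>\<^sub>L 'b) \<Rightarrow> ('a \<Rightarrow>\<^sub>L 'b)"
  where "scaleC_blinfun c f = Blinfun (\<lambda>x. c *\<^sub>C blinfun_apply f x)"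

lemma scaleC_blinfun_apply:
  "blinfun_apply (c *\<^sub>C (f :: 'a \<Rightarrow>\<^sub>L 'b)) x = c *\<^sub>C blinfun_apply f x"
  unfolding scaleC_blinfun_def
  by (subst bounded_linear_Blinfun_apply)
    (auto intro: bounded_linear_compose[OF bounded_linear_scaleC] blinfun.bounded_linear_right)

instance
proof
  fix c d :: complex and t :: real and f g :: "'a \<Rightarrow>\<^sub>L 'b"
  show "c *\<^sub>C (f + g) = c *\<^sub>C f + c *\<^sub>C g"
    by (rule blinfun_eqI) (simp add: scaleC_blinfun_apply blinfun.add_left scaleC_add_right)
  show "(c + d) *\<^sub>C f = c *\<^sub>C f + d *\<^sub>C f"
    by (rule blinfun_eqI) (simp add: scaleC_blinfun_apply blinfun.add_left scaleC_add_left)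
  show "c *\<^sub>C (d *\<^sub>C f) = (c * d) *\<^sub>C f"
    by (rule blinfun_eqI) (simp add: scaleC_blinfun_apply scaleC_scaleC)
  show "complex_of_real t *\<^sub>C f = t *\<^sub>R f"
    by (rule blinfun_eqI) (simp add: scaleC_blinfun_apply scaleC_of_real blinfun.scaleR_left)
  have le: "norm (c *\<^sub>C f) \<le> cmod c * norm f" for c :: complex and f :: "'a \<Rightarrow>\<^sub>L 'b"
  proof (rule norm_blinfun_bound)
    fix x
    show "norm (blinfun_apply (c *\<^sub>C f) x) \<le> cmod c * norm f * norm x"
      using mult_left_mono[OF norm_blinfun[of f x], of "cmod c"]
      by (simp add: scaleC_blinfun_apply norm_scaleC mult.assoc)
  qed simp
  show "norm (c *\<^sub>C f) = cmod c * norm f"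
  proof (cases "c = 0")
    case True
    then show ?thesis using le[of c f] by simp
  next
    case False
    have "inverse c *\<^sub>C (c *\<^sub>C f) = f"
      using False scaleC_of_real[of 1]
      by (intro blinfun_eqI) (simp add: scaleC_blinfun_apply scaleC_scaleC)
    then have "norm f \<le> inverse (cmod c) * norm (c *\<^sub>C f)"
      using le[of "inverse c" "c *\<^sub>C f"] by (simp add: norm_inverse)
    then have "cmod c * norm f \<le> norm (c *\<^sub>C f)"
      using False by (simp add: field_simps)
    with le[of c f] show ?thesis by simp
  qed
qed

end

section \<open>JBW*-algebras\<close>

class jordan_star_algebra = complex_banach + one +
  fixes jordan_prod :: "'a \<Rightarrow> 'a \<Rightarrow> 'a" (infixl "\<circ>\<^sub>J" 70)
    and star :: "'a \<Rightarrow> 'a"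
  assumes jordan_add: "(x + y) \<circ>\<^sub>J z = x \<circ>\<^sub>J z + y \<circ>\<^sub>J z"
    and jordan_scaleC: "(c *\<^sub>C x) \<circ>\<^sub>J y = c *\<^sub>C (x \<circ>\<^sub>J y)"
    and jordan_commute: "x \<circ>\<^sub>J y = y \<circ>\<^sub>J x"
    and jordan_identity: "(x \<circ>\<^sub>J y) \<circ>\<^sub>J (x \<circ>\<^sub>J x) = x \<circ>\<^sub>J (y \<circ>\<^sub>J (x \<circ>\<^sub>J x))"
    and jordan_one: "1 \<circ>\<^sub>J x = x"
    and star_add: "star (x + y) = star x + star y"
    and star_scaleC: "star (c *\<^sub>C x) = cnj c *\<^sub>C star x"
    and star_star: "star (star x) = x"
    and star_jordan: "star (x \<circ>\<^sub>J y) = star y \<circ>\<^sub>J star x"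
begin

definition jordan_triple :: "'a \<Rightarrow> 'a \<Rightarrow> 'a \<Rightarrow> 'a"
  where "jordan_triple x y z =
    (x \<circ>\<^sub>J y) \<circ>\<^sub>J z + (y \<circ>\<^sub>J z) \<circ>\<^sub>J x - (x \<circ>\<^sub>J z) \<circ>\<^sub>J y"

definition selfadjoint :: "'a \<Rightarrow> bool"
  where "selfadjoint x \<longleftrightarrow> star x = x"

definition positive :: "'a \<Rightarrow> bool"
  where "positive x \<longleftrightarrow> (\<exists>a. selfadjoint a \<and> x = a \<circ>\<^sub>J a)"

end

class jb_star_algebra = jordan_star_algebra +
  assumes norm_jordan: "norm (x \<circ>\<^sub>J y) \<le> norm x * norm y"
    and norm_star: "norm (star x) = norm x"
    and norm_triple: "norm (jordan_triple x (star x) x) = norm x ^ 3"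

text \<open>
  The library has no complex duals, so functionals live in the real space of bounded real-linear
  maps into the complex numbers, and complex linearity is imposed separately. The operator
  norms over the reals and over the complex numbers agree.
\<close>

definition dual_space :: "('a::complex_banach \<Rightarrow>\<^sub>L complex) set"
  where "dual_space =
    {\<psi>. \<forall>c x. blinfun_apply \<psi> (c *\<^sub>C x) = c * blinfun_apply \<psi> x}"

text \<open>
  A predual is represented by its canonical image in the dual: a closed complex subspace \<open>P\<close>
  of the dual for which evaluation is an isometric isomorphism from the whole space
  onto the dual of \<open>P\<close>. The last clause is surjectivity, the one before it isometry.
\<close>

definition is_predual :: "('a::complex_banach \<Rightarrow>\<^sub>L complex) set \<Rightarrow> bool"
  where "is_predual P \<longleftrightarrow>
    P \<subseteq> dual_space \<and> closed P \<and> 0 \<in> P \<and>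
    (\<forall>\<psi>\<in>P. \<forall>\<rho>\<in>P. \<psi> + \<rho> \<in> P) \<and> (\<forall>c. \<forall>\<psi>\<in>P. c *\<^sub>C \<psi> \<in> P) \<and>
    (\<forall>x. norm x = (SUP \<psi>\<in>{\<psi>\<in>P. norm \<psi> \<le> 1}. cmod (blinfun_apply \<psi> x))) \<and>
    (\<forall>F :: ('a \<Rightarrow>\<^sub>L complex) \<Rightarrow> complex.
       (\<forall>\<psi>\<in>P. \<forall>\<rho>\<in>P. F (\<psi> + \<rho>) = F \<psi> + F \<rho>) \<and>
       (\<forall>c. \<forall>\<psi>\<in>P. F (c *\<^sub>C \<psi>) = c * F \<psi>) \<and>
       (\<exists>C. \<forall>\<psi>\<in>P. cmod (F \<psi>) \<le> C * norm \<psi>)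
       \<longrightarrow> (\<exists>x. \<forall>\<psi>\<in>P. F \<psi> = blinfun_apply \<psi> x))"

text \<open>The algebraic and norm axioms are carried by the type class; \<open>P\<close> plays the role of the predual.\<close>

definition jbw_star_algebra :: "('a::jb_star_algebra \<Rightarrow>\<^sub>L complex) set \<Rightarrow> bool"
  where "jbw_star_algebra P \<longleftrightarrow> is_predual P"

definition weak_star_topology :: "('a::complex_banach \<Rightarrow>\<^sub>L complex) set \<Rightarrow> 'a topology"
  where "weak_star_topology P =
    topology_generated_by {blinfun_apply \<psi> -` U | \<psi> U. \<psi> \<in> P \<and> open U}"

definition normal_faithful_tracial_state ::
    "('a::jb_star_algebra \<Rightarrow>\<^sub>L complex) set \<Rightarrow> ('a \<Rightarrow> complex) \<Rightarrow> bool"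
  where "normal_faithful_tracial_state P \<phi> \<longleftrightarrow>
    (\<forall>x y. \<phi> (x + y) = \<phi> x + \<phi> y) \<and> (\<forall>c x. \<phi> (c *\<^sub>C x) = c * \<phi> x) \<and>
    continuous_map (weak_star_topology P) euclidean \<phi> \<and>
    (\<forall>x. positive x \<longrightarrow> \<phi> x \<in> \<real> \<and> 0 \<le> Re (\<phi> x)) \<and>
    \<phi> 1 = 1 \<and>
    (\<forall>x. positive x \<and> x \<noteq> 0 \<longrightarrow> \<phi> x \<in> \<real> \<and> 0 < Re (\<phi> x)) \<and>
    (\<forall>x y z. \<phi> (x \<circ>\<^sub>J (y \<circ>\<^sub>J z)) = \<phi> ((x \<circ>\<^sub>J y) \<circ>\<^sub>J z))"

section \<open>Complex interpolation\<close>

text \<open>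
  The members of an interpolation couple are subspaces of an ambient complex space, each carrying
  a norm of its own, which need not be the restriction of the ambient one.
\<close>

record 'v normed_subspace =
  elems :: "'v set"
  nrm :: "'v \<Rightarrow> real"

definition sum_space ::
    "'v::complex_banach normed_subspace \<Rightarrow> 'v normed_subspace \<Rightarrow> 'v normed_subspace"
  where "sum_space X Y =
    \<lparr>elems = {a + b | a b. a \<in> elems X \<and> b \<in> elems Y},
     nrm = (\<lambda>v. Inf {nrm X a + nrm Y b | a b. a \<in> elems X \<and> b \<in> elems Y \<and> v = a + b})\<rparr>"

definition maps_continuously ::
    "'v::complex_banach normed_subspace \<Rightarrow> 'c::topological_space set \<Rightarrow> ('c \<Rightarrow> 'v) \<Rightarrow> bool"
  where "maps_continuously X S f \<longleftrightarrow>
    (\<forall>s\<in>S. f s \<in> elems X) \<and>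
    (\<forall>s\<in>S. ((\<lambda>t. nrm X (f t - f s)) \<longlongrightarrow> 0) (at s within S))"

text \<open>
  Calderon's space of admissible functions on the closed unit strip, with values in the sum
  of the couple. Values outside the strip are irrelevant.
\<close>

definition calderon_space ::
    "'v::complex_banach normed_subspace \<Rightarrow> 'v normed_subspace \<Rightarrow> (complex \<Rightarrow> 'v) set"
  where "calderon_space X\<^sub>0 X\<^sub>1 = {F.
    maps_continuously (sum_space X\<^sub>0 X\<^sub>1) {z. 0 \<le> Re z \<and> Re z \<le> 1} F \<and>
    (\<exists>C. \<forall>z. 0 \<le> Re z \<and> Re z \<le> 1 \<longrightarrow> nrm (sum_space X\<^sub>0 X\<^sub>1) (F z) \<le> C) \<and>
    (\<forall>z. 0 < Re z \<and> Re z < 1 \<longrightarrow>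
      (\<exists>D\<in>elems (sum_space X\<^sub>0 X\<^sub>1).
        ((\<lambda>w. nrm (sum_space X\<^sub>0 X\<^sub>1) (inverse (w - z) *\<^sub>C (F w - F z) - D)) \<longlongrightarrow> 0) (at z))) \<and>
    maps_continuously X\<^sub>0 UNIV (\<lambda>t::real. F (Complex 0 t)) \<and>
    ((\<lambda>t::real. nrm X\<^sub>0 (F (Complex 0 t))) \<longlongrightarrow> 0) at_infinity \<and>
    maps_continuously X\<^sub>1 UNIV (\<lambda>t::real. F (Complex 1 t)) \<and>
    ((\<lambda>t::real. nrm X\<^sub>1 (F (Complex 1 t))) \<longlongrightarrow> 0) at_infinity}"

definition calderon_norm ::
    "'v normed_subspace \<Rightarrow> 'v normed_subspace \<Rightarrow> (complex \<Rightarrow> 'v) \<Rightarrow> real"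
  where "calderon_norm X\<^sub>0 X\<^sub>1 F =
    max (SUP t. nrm X\<^sub>0 (F (Complex 0 t))) (SUP t. nrm X\<^sub>1 (F (Complex 1 t)))"

definition complex_interpolation ::
    "real \<Rightarrow> 'v::complex_banach normed_subspace \<Rightarrow> 'v normed_subspace \<Rightarrow> 'v normed_subspace"
  where "complex_interpolation \<theta> X\<^sub>0 X\<^sub>1 =
    \<lparr>elems = {F (complex_of_real \<theta>) | F. F \<in> calderon_space X\<^sub>0 X\<^sub>1},
     nrm = (\<lambda>v. Inf {calderon_norm X\<^sub>0 X\<^sub>1 F | F.
                     F \<in> calderon_space X\<^sub>0 X\<^sub>1 \<and> F (complex_of_real \<theta>) = v})\<rparr>"

section \<open>Nonassociative Lp-spaces\<close>

definition trace_embed :: "('a::jb_star_algebra \<Rightarrow> complex) \<Rightarrow> 'a \<Rightarrow> ('a \<Rightarrow>\<^sub>L complex)"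
  where "trace_embed \<phi> x = Blinfun (\<lambda>y. \<phi> (x \<circ>\<^sub>J y))"

text \<open>
  Every Lp-space is realised inside the dual of the algebra. In particular the algebra itself, as
  the case of exponent infinity, is identified with its image under the injective map
  \<open>trace_embed \<phi>\<close> and carries the norm transported from the algebra.
\<close>

definition Linfty_space :: "('a::jb_star_algebra \<Rightarrow> complex) \<Rightarrow> ('a \<Rightarrow>\<^sub>L complex) normed_subspace"
  where "Linfty_space \<phi> =
    \<lparr>elems = range (trace_embed \<phi>), nrm = (\<lambda>\<xi>. norm (inv (trace_embed \<phi>) \<xi>))\<rparr>"

definition L1_space :: "('a::jb_star_algebra \<Rightarrow>\<^sub>L complex) set \<Rightarrow> ('a \<Rightarrow>\<^sub>L complex) normed_subspace"
  where "L1_space P = \<lparr>elems = P, nrm = norm\<rparr>"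

text \<open>Only exponents at least 1 are meaningful.\<close>

definition Lp_space :: "('a::jb_star_algebra \<Rightarrow>\<^sub>L complex) set \<Rightarrow> ('a \<Rightarrow> complex) \<Rightarrow> ennreal
    \<Rightarrow> ('a \<Rightarrow>\<^sub>L complex) normed_subspace"
  where "Lp_space P \<phi> p =
    (if p = \<infinity> then Linfty_space \<phi>
     else if p = 1 then L1_space P
     else complex_interpolation (1 / enn2real p) (Linfty_space \<phi>) (L1_space P))"

definition complex_bilinear_on :: "'v::complex_banach set \<Rightarrow> 'w::complex_banach set
    \<Rightarrow> ('v \<Rightarrow> 'w \<Rightarrow> 'u::complex_banach) \<Rightarrow> bool"
  where "complex_bilinear_on X Y B \<longleftrightarrow>
    (\<forall>h\<in>X. \<forall>h'\<in>X. \<forall>k\<in>Y. B (h + h') k = B h k + B h' k) \<and>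
    (\<forall>h\<in>X. \<forall>k\<in>Y. \<forall>k'\<in>Y. B h (k + k') = B h k + B h k') \<and>
    (\<forall>c. \<forall>h\<in>X. \<forall>k\<in>Y. B (c *\<^sub>C h) k = c *\<^sub>C B h k \<and> B h (c *\<^sub>C k) = c *\<^sub>C B h k)"

end

theory Submission
  imports Defs "HOL-Probability.Probability" "HOL-Complex_Analysis.Complex_Analysis"
begin

text \<open>
  On the algebra itself the product is contractive, so everything rests on two things: that the
  spaces behave as the statement presupposes, and an interpolation argument.

  \<^emph>\<open>The predual is a module over the algebra.\<close> The embedding of the algebra takes its values in
  the predual, and more generally \<open>\<psi> \<in> P\<close> implies \<open>\<psi> (x \<circ>\<^sub>J _) \<in> P\<close>. This is the separate weak*
  continuity of the product (lemma \<open>predual_act\<close>). It usually comes from the structure theory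
  of JBW*-algebras; the faithful trace allows a direct route. The trace gives an inner product
  \<open>ip x y = Re (\<phi> (x \<circ>\<^sub>J star y))\<close>. The identity \<open>norm {z, z*, z} = norm z ^ 3\<close>, applied to
  \<open>z = 1 + i r a - r\<^sup>2 a\<^sup>2 / 2\<close>, shows \<open>norm z \<le> 1 + O(r\<^sup>4)\<close>. So selfadjointness, and positivity
  as far as the trace sees it, are described by norm inequalities, and norm inequalities pass to
  weak* limits. Since \<open>w = ((w + e)\<^sup>2 - (w - e)\<^sup>2) / (4 e)\<close> is a difference of two squares whose
  traces are at most \<open>e\<close> if \<open>ip w w \<le> e\<^sup>2\<close>, weak* limits of bounded elements that are small for
  \<open>ip\<close> are again small for \<open>ip\<close>. Together with weak* compactness this makes the unit ball complete for
  \<open>ip\<close> and every element of the predual continuous for \<open>ip\<close> on it. Conversely a functional with this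
  continuity lies in the predual (\<open>normality_criterion\<close>): otherwise a downward directed family of
  nonempty convex sets, closed for \<open>ip\<close>, would have a common point, nonzero and yet annihilated by the
  predual. The module action preserves this continuity.

  \<^emph>\<open>Interpolation.\<close> Since the algebra embeds contractively into \<open>P\<close>, the sum of the couple is \<open>P\<close>, and
  an element of Calderon's space is a bounded function on the strip that is continuous, weakly
  holomorphic inside, and has boundary values in the algebra on the left (\<open>admissible\<close>). Gaussian
  averages of the left boundary values are entire functions with values in the algebra, and they
  approximate the given function on both boundary lines (\<open>entire_decaying_approximation\<close>); for such
  functions products make sense. If \<open>a + b \<le> 1\<close>, the function
  \<open>z \<mapsto> f z \<circ> n (b (1 - z) / (1 - a))\<close> has on the left a factor \<open>f\<close> in the algebra and a factor \<open>n\<close>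
  in \<open>P\<close>, on the right the opposite; the maximum principle bounds the product
  \<open>f a \<circ> n b\<close> in \<open>P\<close> (\<open>pairing_bound\<close>). This defines the product of elements of the spaces with
  parameters \<open>a = 1/p\<close> and \<open>b = 1/q\<close> as a limit in \<open>P\<close>, and settles \<open>a + b = 1\<close>. If \<open>c = a + b < 1\<close>, the function
  \<open>z \<mapsto> m (a z / c) \<circ> n (b z / c)\<close> has its value at \<open>c\<close> equal to \<open>m a \<circ> n b\<close>, lies in the algebra
  on the left, and on the right is covered by the case of parameters with sum \<open>1\<close>; so it is
  admissible with the product of the two bounds (\<open>lp_product_interp\<close>). If one exponent is
  infinite, the product is the module action.
\<close>

section \<open>The Jordan product as a bounded bilinear map\<close>

lemma scaleC_scaleR_left: "(r *\<^sub>R c) *\<^sub>C x = r *\<^sub>R (c *\<^sub>C (x::'a::complex_banach))"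
  by (simp add: scaleR_conv_of_real flip: scaleC_scaleC scaleC_of_real)

lemma bounded_bilinear_scaleC: "bounded_bilinear (scaleC :: complex \<Rightarrow> 'a::complex_banach \<Rightarrow> 'a)"
proof (rule bounded_bilinear.intro)
  fix r :: real and a :: complex and b :: 'a
  show "a *\<^sub>C r *\<^sub>R b = r *\<^sub>R a *\<^sub>C b"
    by (rule linear_cmul[OF bounded_linear.linear[OF bounded_linear_scaleC]])
qed (auto simp: scaleC_add_left scaleC_add_right scaleC_scaleR_left norm_scaleC intro: exI[of _ 1])

interpretation scaleC: bounded_bilinear "scaleC :: complex \<Rightarrow> 'a::complex_banach \<Rightarrow> 'a"
  by (rule bounded_bilinear_scaleC)

lemma scaleC_one [simp]: "1 *\<^sub>C x = (x::'a::complex_banach)"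
  using scaleC_of_real[of 1 x] by simp

lemma scaleC_ii_ii: "\<i> *\<^sub>C \<i> *\<^sub>C x = - (x::'a::complex_banach)"
  by (simp add: scaleC_scaleC scaleC.minus_left)

interpretation jordan: bounded_bilinear "(\<circ>\<^sub>J) :: 'a::jb_star_algebra \<Rightarrow> 'a \<Rightarrow> 'a"
proof (rule bounded_bilinear.intro)
  fix r :: real and a a' b b' :: 'a
  show "(a + a') \<circ>\<^sub>J b = a \<circ>\<^sub>J b + a' \<circ>\<^sub>J b" by (rule jordan_add)
  show "a \<circ>\<^sub>J (b + b') = a \<circ>\<^sub>J b + a \<circ>\<^sub>J b'" by (metis jordan_add jordan_commute)
  show "(r *\<^sub>R a) \<circ>\<^sub>J b = r *\<^sub>R (a \<circ>\<^sub>J b)" by (metis jordan_scaleC scaleC_of_real)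
  show "a \<circ>\<^sub>J (r *\<^sub>R b) = r *\<^sub>R (a \<circ>\<^sub>J b)" by (metis jordan_scaleC scaleC_of_real jordan_commute)
  show "\<exists>K. \<forall>a b::'a. norm (a \<circ>\<^sub>J b) \<le> norm a * norm b * K"
    using norm_jordan by (intro exI[of _ 1]) auto
qed

lemma jordan_scaleC_right: "x \<circ>\<^sub>J (c *\<^sub>C y) = c *\<^sub>C (x \<circ>\<^sub>J (y::'a::jb_star_algebra))"
  by (metis jordan_commute jordan_scaleC)

lemma jordan_one_right [simp]: "x \<circ>\<^sub>J 1 = (x::'a::jb_star_algebra)"
  by (metis jordan_commute jordan_one)

lemma star_scaleR: "star (r *\<^sub>R x) = r *\<^sub>R star (x::'a::jb_star_algebra)"
  using star_scaleC[of "of_real r" x] by (simp add: scaleC_of_real)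

lemma bounded_linear_star: "bounded_linear (star :: 'a::jb_star_algebra \<Rightarrow> 'a)"
  by (rule bounded_linear_intro[where K = 1]) (auto simp: star_add norm_star star_scaleR)

lemmas star_zero = linear_0[OF bounded_linear.linear[OF bounded_linear_star]]
  and star_minus = linear_neg[OF bounded_linear.linear[OF bounded_linear_star]]
  and star_diff = linear_diff[OF bounded_linear.linear[OF bounded_linear_star]]

lemma star_one [simp]: "star (1::'a::jb_star_algebra) = 1"
  by (metis jordan_one jordan_one_right star_jordan star_star)

declare jordan_one [simp]

lemma
  fixes a b :: "'a::jb_star_algebra"
  shows selfadjoint_one: "selfadjoint (1::'a)"
    and selfadjoint_zero: "selfadjoint (0::'a)"
    and selfadjoint_add: "selfadjoint a \<Longrightarrow> selfadjoint b \<Longrightarrow> selfadjoint (a + b)"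
    and selfadjoint_diff: "selfadjoint a \<Longrightarrow> selfadjoint b \<Longrightarrow> selfadjoint (a - b)"
    and selfadjoint_scaleR: "selfadjoint a \<Longrightarrow> selfadjoint (r *\<^sub>R a)"
    and selfadjoint_jordan: "selfadjoint a \<Longrightarrow> selfadjoint b \<Longrightarrow> selfadjoint (a \<circ>\<^sub>J b)"
  by (auto simp: selfadjoint_def star_zero star_add star_diff star_scaleR star_jordan jordan_commute)

lemmas selfadjoint_intros = selfadjoint_one selfadjoint_zero selfadjoint_add selfadjoint_diff
  selfadjoint_scaleR selfadjoint_jordan

definition real_part :: "'a::jb_star_algebra \<Rightarrow> 'a"
  where "real_part x = (1/2) *\<^sub>R (x + star x)"

definition imag_part :: "'a::jb_star_algebra \<Rightarrow> 'a"
  where "imag_part x = (1/2) *\<^sub>R \<i> *\<^sub>C (star x - x)"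

lemma star_ii: "star (\<i> *\<^sub>C x) = - (\<i> *\<^sub>C star (x::'a::jb_star_algebra))"
  by (simp add: star_scaleC scaleC.minus_left)

lemma selfadjoint_real_part: "selfadjoint (real_part x)"
  by (simp add: selfadjoint_def real_part_def star_scaleR star_add star_star add.commute)

lemma selfadjoint_imag_part: "selfadjoint (imag_part x)"
proof -
  have "star (\<i> *\<^sub>C (star x - x)) = \<i> *\<^sub>C (star x - x)"
    by (simp add: star_ii star_diff star_star flip: scaleC.minus_right)
  then show ?thesis by (simp add: selfadjoint_def imag_part_def star_scaleR)
qed

lemma real_imag_parts: "x = real_part x + \<i> *\<^sub>C imag_part x"
proof -
  have "\<i> *\<^sub>C imag_part x = (1/2) *\<^sub>R (- (star x - x))"
    unfolding imag_part_def scaleC.scaleR_right scaleC_ii_ii ..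
  then show ?thesis
    by (simp add: real_part_def scaleR_add_right scaleR_diff_right flip: scaleR_left_distrib)
qed

lemma norm_real_part: "norm (real_part x) \<le> norm x"
  using norm_triangle_ineq[of x "star x"] by (simp add: real_part_def norm_star)

lemma norm_imag_part: "norm (imag_part x) \<le> norm x"
  using norm_triangle_ineq4[of "star x" x] by (simp add: imag_part_def norm_scaleC norm_star)

section \<open>Approximate unitaries\<close>

text \<open>
  Because the norm of \<open>{z, z*, z}\<close> is \<open>norm z ^ 3\<close>, an element with
  \<open>{z, z*, z}\<close> close to \<open>z\<close> satisfies \<open>norm z ^ 3 \<le> norm z + e\<close>, and a number \<open>t > 1\<close> has
  \<open>t - 1 \<le> t ^ 3 - t\<close>.
\<close>

lemma norm_le_of_triple:
  fixes z :: "'a::jb_star_algebra"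
  assumes "norm (jordan_triple z (star z) z - z) \<le> e"
  shows "norm z \<le> 1 + e"
proof (cases "norm z \<le> 1")
  case True
  then show ?thesis using assms norm_ge_zero[of "jordan_triple z (star z) z - z"] by linarith
next
  case False
  let ?n = "norm z"
  have le: "?n ^ 3 \<le> ?n + e"
    using norm_triangle_ineq[of z "jordan_triple z (star z) z - z"] assms by (simp add: norm_triple)
  have "?n - 1 \<le> ?n ^ 3 - ?n"
  proof -
  have "?n ^ 3 - ?n = (?n - 1) * (?n * (?n + 1))"
    by (simp add: power3_eq_cube algebra_simps)
  moreover have "(?n - 1) * 1 \<le> (?n - 1) * (?n * (?n + 1))"
  proof (rule mult_left_mono)
    have "1 * 1 \<le> ?n * (?n + 1)" using False by (intro mult_mono) auto
    then show "1 \<le> ?n * (?n + 1)" by simp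
  qed (use False in auto)
  ultimately show ?thesis by simp
  qed
  then show ?thesis using le by linarith
qed

text \<open>
  The element \<open>z\<close> is the exponential of \<open>i r a\<close> up to terms of third order, so it is
  nearly unitary and \<open>{z, z*, z}\<close> nearly equals \<open>z\<close>. The error is of fourth order in \<open>r\<close>, that is, of second order
  in \<open>s = r\<^sup>2 / 2\<close>. The terms of order \<open>s\<^sup>2\<close> are kept as they come; only their size matters.
\<close>

lemma triple_approx_unitary:
  fixes a :: "'a::jb_star_algebra"
  assumes a: "selfadjoint a" and s: "r^2 = 2 * s"
  defines "c \<equiv> a \<circ>\<^sub>J a"
  defines "z \<equiv> 1 + r *\<^sub>R \<i> *\<^sub>C a - s *\<^sub>R c"
  shows "star z = 1 - r *\<^sub>R \<i> *\<^sub>C a - s *\<^sub>R c"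
    and "jordan_triple z (star z) z - z =
      s^2 *\<^sub>R (2 *\<^sub>R ((c \<circ>\<^sub>J c) \<circ>\<^sub>J z) - 5 *\<^sub>R (c \<circ>\<^sub>J c) + 4 *\<^sub>R ((a \<circ>\<^sub>J c) \<circ>\<^sub>J a)
        + s *\<^sub>R ((c \<circ>\<^sub>J c) \<circ>\<^sub>J c) + r *\<^sub>R \<i> *\<^sub>C ((c \<circ>\<^sub>J c) \<circ>\<^sub>J a) - (2 * r) *\<^sub>R \<i> *\<^sub>C ((a \<circ>\<^sub>J c) \<circ>\<^sub>J c))"
proof -
  show star: "star z = 1 - r *\<^sub>R \<i> *\<^sub>C a - s *\<^sub>R c"
    using a by (simp add: z_def c_def selfadjoint_def star_diff star_add star_scaleR star_ii star_jordan)
  have rr: "(r * r) *\<^sub>R x = (2 * s) *\<^sub>R x" "(r * (r * t)) *\<^sub>R x = (2 * s * t) *\<^sub>R x" for t and x :: 'a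
    using s by (simp_all add: power2_eq_square mult.assoc[symmetric])
  \<comment> \<open>Integer multiples are unfolded, so that both sides become sums of the same monomials.\<close>
  have two: "2 *\<^sub>R x = x + x" "(2 * t) *\<^sub>R x = t *\<^sub>R x + t *\<^sub>R x"
    "4 *\<^sub>R x = x + x + x + x" "(4 * t) *\<^sub>R x = t *\<^sub>R x + t *\<^sub>R x + t *\<^sub>R x + t *\<^sub>R x"
    "5 *\<^sub>R x = x + x + x + x + x" "(5 * t) *\<^sub>R x = t *\<^sub>R x + t *\<^sub>R x + t *\<^sub>R x + t *\<^sub>R x + t *\<^sub>R x"
    "(t * 2) *\<^sub>R x = t *\<^sub>R x + t *\<^sub>R x" "(t * 4) *\<^sub>R x = t *\<^sub>R x + t *\<^sub>R x + t *\<^sub>R x + t *\<^sub>R x"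
    "(u * (t * 2)) *\<^sub>R x = (u * t) *\<^sub>R x + (u * t) *\<^sub>R x"
    "(u * (t * 4)) *\<^sub>R x = (u * t) *\<^sub>R x + (u * t) *\<^sub>R x + (u * t) *\<^sub>R x + (u * t) *\<^sub>R x"
    "(u * (t * 5)) *\<^sub>R x = (u * t) *\<^sub>R x + (u * t) *\<^sub>R x + (u * t) *\<^sub>R x + (u * t) *\<^sub>R x + (u * t) *\<^sub>R x"
    "(v * (u * (t * 2))) *\<^sub>R x = (v * (u * t)) *\<^sub>R x + (v * (u * t)) *\<^sub>R x"
    for t u v and x :: 'a
    using scaleR_add_left[of 2 2 x] scaleR_add_left[of 2 3 x] scaleR_add_left[of 1 2 x]
    by (simp_all add: scaleR_2 algebra_simps flip: scaleR_left_distrib)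
  have ca: "c \<circ>\<^sub>J a = a \<circ>\<^sub>J c" "c \<circ>\<^sub>J (a \<circ>\<^sub>J c) = (a \<circ>\<^sub>J c) \<circ>\<^sub>J c"
    "a \<circ>\<^sub>J (a \<circ>\<^sub>J c) = (a \<circ>\<^sub>J c) \<circ>\<^sub>J a" "a \<circ>\<^sub>J (c \<circ>\<^sub>J c) = (c \<circ>\<^sub>J c) \<circ>\<^sub>J a"
    "c \<circ>\<^sub>J (c \<circ>\<^sub>J c) = (c \<circ>\<^sub>J c) \<circ>\<^sub>J c"
    by (simp_all add: jordan_commute)
  note expand = jordan.add_left jordan.add_right jordan.diff_left jordan.diff_right
        jordan.scaleR_left jordan.scaleR_right jordan.minus_left jordan.minus_right
        jordan_scaleC jordan_scaleC_right scaleC_ii_ii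
        scaleC.scaleR_right scaleC.minus_right scaleC.diff_right scaleC.add_right
        scaleR_add_right scaleR_diff_right
  have 1: "z \<circ>\<^sub>J star z = 1 + s^2 *\<^sub>R (c \<circ>\<^sub>J c)"
    unfolding star unfolding z_def
    by (simp add: expand ca power2_eq_square c_def[symmetric]) (simp add: algebra_simps rr two)
  have 2: "z \<circ>\<^sub>J z = 1 - (4 * s) *\<^sub>R c + s^2 *\<^sub>R (c \<circ>\<^sub>J c) + (2 * r) *\<^sub>R \<i> *\<^sub>C (a - s *\<^sub>R (a \<circ>\<^sub>J c))"
    unfolding z_def
    by (simp add: expand ca power2_eq_square c_def[symmetric]) (simp add: algebra_simps rr two)
  show "jordan_triple z (star z) z - z = s^2 *\<^sub>R (2 *\<^sub>R ((c \<circ>\<^sub>J c) \<circ>\<^sub>J z) - 5 *\<^sub>R (c \<circ>\<^sub>J c) + 4 *\<^sub>R ((a \<circ>\<^sub>J c) \<circ>\<^sub>J a)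
        + s *\<^sub>R ((c \<circ>\<^sub>J c) \<circ>\<^sub>J c) + r *\<^sub>R \<i> *\<^sub>C ((c \<circ>\<^sub>J c) \<circ>\<^sub>J a) - (2 * r) *\<^sub>R \<i> *\<^sub>C ((a \<circ>\<^sub>J c) \<circ>\<^sub>J c))"
    unfolding jordan_triple_def 1 2 jordan_commute[of "star z" z] unfolding star unfolding z_def
    by (simp add: expand ca power2_eq_square c_def[symmetric]) (simp add: algebra_simps rr two)
qed

text \<open>
  The real part of the approximate unitary is \<open>1 - s a\<^sup>2\<close>, and without the term of second order
  it is \<open>1 + i r a\<close>. These are the norm inequalities that characterise squares and selfadjoint elements.
  The constants \<open>19\<close> and \<open>6\<close> come from the triangle inequality; only the orders of
  the errors matter.
\<close>

lemma norm_approx_unitary: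
  fixes a :: "'a::jb_star_algebra"
  assumes a: "selfadjoint a" "norm a \<le> 1" and s: "r^2 = 2 * s" "s \<le> 1/2"
  shows "norm (1 - s *\<^sub>R (a \<circ>\<^sub>J a)) \<le> 1 + 19 * s^2"
    and "norm (1 + r *\<^sub>R \<i> *\<^sub>C a) \<le> 1 + 6 * r^2"
proof -
  define c where "c = a \<circ>\<^sub>J a"
  define z where "z = 1 + r *\<^sub>R \<i> *\<^sub>C a - s *\<^sub>R c"
  have nj: "norm (x \<circ>\<^sub>J y) \<le> 1" if "norm x \<le> 1" "norm y \<le> 1" for x y :: 'a
    using norm_jordan[of x y] mult_mono[OF that] by simp
  have s0: "0 \<le> s" using s(1) zero_le_power2[of r] by linarith
  have r1: "\<bar>r\<bar> \<le> 1" using s abs_square_le_1[of r] by simp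
  have n1: "norm (1::'a) \<le> 1"
  proof -
    have "jordan_triple (1::'a) (star 1) 1 = 1" by (simp add: jordan_triple_def)
    then have "norm (1::'a) ^ 3 = norm (1::'a)" using norm_triple[of "1::'a"] by simp
    then have "norm (1::'a) * (norm (1::'a) * norm (1::'a) - 1) = 0"
      by (simp add: power3_eq_cube algebra_simps)
    then have "norm (1::'a) = 0 \<or> norm (1::'a) * norm (1::'a) = 1" by simp
    then show ?thesis using abs_square_le_1[of "norm (1::'a)"] by (auto simp: power2_eq_square)
  qed
  have c: "norm c \<le> 1" unfolding c_def by (intro nj a)
  have sc: "norm (t *\<^sub>R x) \<le> u" if "norm x \<le> 1" "\<bar>t\<bar> \<le> u" for t u and x :: 'a
    using mult_mono[OF that(2,1)] that by simp
  have ic: "norm (\<i> *\<^sub>C x) \<le> 1" if "norm x \<le> 1" for x :: 'a using that by (simp add: norm_scaleC)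
  have z: "norm z \<le> 3"
    unfolding z_def
    by (rule order_trans[OF norm_triangle_ineq4] order_trans[OF add_mono[OF norm_triangle_ineq order_refl]])+
       (use sc[OF ic[OF a(2)] r1] sc[OF c, of s "1/2"] s s0 n1 in linarith)
  have cc: "norm (c \<circ>\<^sub>J c) \<le> 1" "norm ((a \<circ>\<^sub>J c) \<circ>\<^sub>J a) \<le> 1" "norm ((c \<circ>\<^sub>J c) \<circ>\<^sub>J c) \<le> 1"
    "norm ((c \<circ>\<^sub>J c) \<circ>\<^sub>J a) \<le> 1" "norm ((a \<circ>\<^sub>J c) \<circ>\<^sub>J c) \<le> 1"
    by (intro nj a c)+
  have ccz: "norm ((c \<circ>\<^sub>J c) \<circ>\<^sub>J z) \<le> 3"
    using norm_jordan[of "c \<circ>\<^sub>J c" z] mult_mono[OF cc(1) z] by simp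
  define E where "E = 2 *\<^sub>R ((c \<circ>\<^sub>J c) \<circ>\<^sub>J z) - 5 *\<^sub>R (c \<circ>\<^sub>J c) + 4 *\<^sub>R ((a \<circ>\<^sub>J c) \<circ>\<^sub>J a)
        + s *\<^sub>R ((c \<circ>\<^sub>J c) \<circ>\<^sub>J c) + r *\<^sub>R \<i> *\<^sub>C ((c \<circ>\<^sub>J c) \<circ>\<^sub>J a) - (2 * r) *\<^sub>R \<i> *\<^sub>C ((a \<circ>\<^sub>J c) \<circ>\<^sub>J c)"
  have "norm E \<le> norm (2 *\<^sub>R ((c \<circ>\<^sub>J c) \<circ>\<^sub>J z)) + norm (5 *\<^sub>R (c \<circ>\<^sub>J c)) + norm (4 *\<^sub>R ((a \<circ>\<^sub>J c) \<circ>\<^sub>J a))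
        + norm (s *\<^sub>R ((c \<circ>\<^sub>J c) \<circ>\<^sub>J c)) + norm (r *\<^sub>R \<i> *\<^sub>C ((c \<circ>\<^sub>J c) \<circ>\<^sub>J a)) + norm ((2 * r) *\<^sub>R \<i> *\<^sub>C ((a \<circ>\<^sub>J c) \<circ>\<^sub>J c))"
    unfolding E_def by (intro norm_triangle_le norm_triangle_le_diff add_mono order_refl)
  moreover have "norm (2 *\<^sub>R ((c \<circ>\<^sub>J c) \<circ>\<^sub>J z)) \<le> 6" using ccz by simp
  moreover have "norm (5 *\<^sub>R (c \<circ>\<^sub>J c)) + norm (4 *\<^sub>R ((a \<circ>\<^sub>J c) \<circ>\<^sub>J a))
        + norm (s *\<^sub>R ((c \<circ>\<^sub>J c) \<circ>\<^sub>J c)) + norm (r *\<^sub>R \<i> *\<^sub>C ((c \<circ>\<^sub>J c) \<circ>\<^sub>J a)) + norm ((2 * r) *\<^sub>R \<i> *\<^sub>C ((a \<circ>\<^sub>J c) \<circ>\<^sub>J c))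
    \<le> 5 + 4 + 1 + 1 + 2"
    by (intro add_mono sc cc ic) (use r1 s s0 in auto)
  ultimately have E: "norm E \<le> 19" by linarith
  have "jordan_triple z (star z) z - z = s^2 *\<^sub>R E"
    using triple_approx_unitary(2)[OF a(1) s(1)] unfolding E_def z_def c_def by simp
  then have "norm (jordan_triple z (star z) z - z) \<le> 19 * s^2"
    using E mult_right_mono[OF E, of "s^2"] by (simp add: mult.commute)
  then have nz: "norm z \<le> 1 + 19 * s^2" by (rule norm_le_of_triple)
  have "z + star z = (1 - s *\<^sub>R c) + (1 - s *\<^sub>R c)"
    using triple_approx_unitary(1)[OF a(1) s(1)] by (simp add: z_def c_def)
  then have "z + star z = 2 *\<^sub>R (1 - s *\<^sub>R c)" by (simp only: scaleR_2)
  then have "real_part z = 1 - s *\<^sub>R c" by (simp add: real_part_def)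
  then show "norm (1 - s *\<^sub>R (a \<circ>\<^sub>J a)) \<le> 1 + 19 * s^2"
    using norm_real_part[of z] nz by (simp add: c_def)
  have "1 + r *\<^sub>R \<i> *\<^sub>C a = z + s *\<^sub>R c" by (simp add: z_def)
  then have "norm (1 + r *\<^sub>R \<i> *\<^sub>C a) \<le> (1 + 19 * s^2) + s"
    using norm_triangle_ineq[of z "s *\<^sub>R c"] nz sc[OF c, of s s] s0 by simp
  also have "\<dots> \<le> 1 + 6 * r^2"
    using mult_left_mono[OF s(2) s0] s s0 by (simp add: power2_eq_square)
  finally show "norm (1 + r *\<^sub>R \<i> *\<^sub>C a) \<le> 1 + 6 * r^2" .
qed

section \<open>Functionals dominated on a subspace of finite codimension\<close>

text \<open>
  A Hahn-Banach theorem for a subspace of finite codimension, given as the common kernel of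
  finitely many functionals. Restoring one direction at a time needs no choice principle: the
  coefficient for one more functional \<open>\<rho>\<close> is a supremum over the affine hyperplane \<open>\<rho> = 1\<close> of the
  kernel of the others.
\<close>

lemma finite_codimension_domination:
  fixes \<rho> :: "'i \<Rightarrow> 'v::real_normed_vector \<Rightarrow> real"
  assumes "0 \<le> e" "finite I" "linear f" "\<And>i. i \<in> I \<Longrightarrow> linear (\<rho> i)"
    and "\<And>x. (\<And>i. i \<in> I \<Longrightarrow> \<rho> i x = 0) \<Longrightarrow> f x \<le> e * norm x"
  shows "\<exists>c. \<forall>x. f x - (\<Sum>i\<in>I. c i * \<rho> i x) \<le> e * norm x"
  using assms(2-)
proof (induction I arbitrary: f rule: finite_induct)
  case empty
  then show ?case by auto
next
  case (insert j I)
  interpret f: linear f by fact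
  interpret r: linear "\<rho> j" using insert.prems by simp
  have lin: "linear (\<rho> i)" if "i \<in> I" for i using insert.prems that by simp
  define V where "V = {x. \<forall>i\<in>I. \<rho> i x = 0}"
  have Vs: "k *\<^sub>R x \<in> V" if "x \<in> V" for k x
    using that lin by (auto simp: V_def linear_scale)
  have Vd: "x - y \<in> V" if "x \<in> V" "y \<in> V" for x y
    using that lin by (auto simp: V_def linear_diff)
  have ker: "f x \<le> e * norm x" if "x \<in> V" "\<rho> j x = 0" for x
    using that by (intro insert.prems(3)) (auto simp: V_def)
  have "\<exists>t. \<forall>x\<in>V. f x - t * \<rho> j x \<le> e * norm x"
  proof (cases "\<forall>x\<in>V. \<rho> j x = 0")
    case True
    then show ?thesis using ker by (intro exI[of _ 0]) auto
  next
    case False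
    then obtain v where "v \<in> V" "\<rho> j v \<noteq> 0" by auto
    then have "(1 / \<rho> j v) *\<^sub>R v \<in> V" "\<rho> j ((1 / \<rho> j v) *\<^sub>R v) = 1"
      by (auto simp: Vs r.scale)
    then obtain w where w: "w \<in> V" "\<rho> j w = 1" by blast
    let ?U = "{u \<in> V. \<rho> j u = 1}"
    define t where "t = (SUP u\<in>?U. f u - e * norm u)"
    \<comment> \<open>The difference of \<open>u\<close> and \<open>x\<close> lies in the kernel of \<open>\<rho> j\<close>.\<close>
    have cross: "f u - e * norm u \<le> f x + e * norm x" if "u \<in> ?U" "x \<in> ?U" for u x
    proof -
      have "f (u - x) \<le> e * norm (u - x)" using that by (intro ker Vd) (auto simp: r.diff)
      moreover have "e * norm (u - x) \<le> e * (norm u + norm x)"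
        by (intro mult_left_mono norm_triangle_ineq4 \<open>0 \<le> e\<close>) 
      ultimately show ?thesis by (simp add: f.diff algebra_simps)
    qed
    have bdd: "bdd_above ((\<lambda>u. f u - e * norm u) ` ?U)"
      using cross w by (intro bdd_aboveI2[of _ _ "f w + e * norm w"]) auto
    have lo: "f u - e * norm u \<le> t" if "u \<in> ?U" for u
      unfolding t_def using that by (intro cSUP_upper bdd)
    have hi: "t \<le> f u + e * norm u" if "u \<in> ?U" for u
      unfolding t_def using cross that w by (intro cSUP_least) auto
    have "f x - t * \<rho> j x \<le> e * norm x" if x: "x \<in> V" for x
    proof -
      define k where "k = \<rho> j x"
      consider "k = 0" | "k > 0" | "k < 0" by linarith
      then show ?thesis
      proof cases
        case 1
        then show ?thesis using ker[OF x] by (simp add: k_def)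
      next
        case 2
        then have "(1/k) *\<^sub>R x \<in> ?U" using x by (auto simp: Vs r.scale k_def)
        from lo[OF this] 2 have "k * (f x / k - e * (norm x / k)) \<le> k * t"
          by (intro mult_left_mono) (auto simp: f.scale)
        then show ?thesis using 2 by (simp add: k_def[symmetric] algebra_simps)
      next
        case 3
        then have "(1/k) *\<^sub>R x \<in> ?U" using x by (auto simp: Vs r.scale k_def)
        from hi[OF this] 3 have "k * (f x / k - e * (norm x / k)) \<le> k * t"
          by (intro mult_left_mono_neg) (auto simp: f.scale)
        then show ?thesis using 3 by (simp add: k_def[symmetric] algebra_simps)
      qed
    qed
    then show ?thesis by blast
  qed
  then obtain t where t: "\<And>x. x \<in> V \<Longrightarrow> f x - t * \<rho> j x \<le> e * norm x" by blast
  have "\<exists>c. \<forall>x. (f x - t * \<rho> j x) - (\<Sum>i\<in>I. c i * \<rho> i x) \<le> e * norm x"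
  proof (rule insert.IH)
    show "linear (\<lambda>x. f x - t * \<rho> j x)"
      using linear_compose_sub[OF \<open>linear f\<close> linear_compose_scale_right[OF r.linear_axioms, of t]] by simp
  qed (use lin t in \<open>auto simp: V_def\<close>)
  then obtain c where c: "\<And>x. (f x - t * \<rho> j x) - (\<Sum>i\<in>I. c i * \<rho> i x) \<le> e * norm x" by blast
  have "(\<Sum>i\<in>I. (c(j := t)) i * \<rho> i x) = (\<Sum>i\<in>I. c i * \<rho> i x)" for x
    using insert.hyps by (intro sum.cong) auto
  then show ?case
    using c insert.hyps by (intro exI[of _ "c(j := t)"]) (simp add: algebra_simps)
qed

section \<open>The predual and weak* limits\<close>

lemma generate_topology_on_base:
  assumes "generate_topology_on \<S> U" "x \<in> U"
  shows "\<exists>\<F>. finite \<F> \<and> \<F> \<subseteq> \<S> \<and> x \<in> \<Inter>\<F> \<and> \<Inter>\<F> \<subseteq> U"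
  using assms
proof (induction arbitrary: x)
  case Empty
  then show ?case by simp
next
  case (Int a b)
  then obtain \<F> \<G> where "finite \<F>" "\<F> \<subseteq> \<S>" "x \<in> \<Inter>\<F>" "\<Inter>\<F> \<subseteq> a"
    "finite \<G>" "\<G> \<subseteq> \<S>" "x \<in> \<Inter>\<G>" "\<Inter>\<G> \<subseteq> b" by (meson IntD1 IntD2)
  then show ?case by (intro exI[of _ "\<F> \<union> \<G>"]) auto
next
  case (UN K)
  then obtain k where "k \<in> K" "x \<in> k" by auto
  with UN.IH[OF this] show ?case by (meson Union_upper order_trans)
next
  case (Basis s)
  then show ?case by (intro exI[of _ "{s}"]) auto
qed

text \<open>
  Convergence along a filter rather than of a sequence, because weak* compactness supplies cluster
  points only along finer filters.
\<close>

definition weak_star_lim :: "('a::complex_banach \<Rightarrow>\<^sub>L complex) set \<Rightarrow> 'i filter \<Rightarrow> ('i \<Rightarrow> 'a) \<Rightarrow> 'a \<Rightarrow> bool"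
  where "weak_star_lim P G y x \<longleftrightarrow> (\<forall>\<psi>\<in>P. ((\<lambda>i. blinfun_apply \<psi> (y i)) \<longlongrightarrow> blinfun_apply \<psi> x) G)"

lemma weak_star_lim_diff:
  "weak_star_lim P G y x \<Longrightarrow> weak_star_lim P G y' x' \<Longrightarrow> weak_star_lim P G (\<lambda>i. y i - y' i) (x - x')"
  by (auto simp: weak_star_lim_def blinfun.diff_right intro!: tendsto_diff)

lemma weak_star_lim_add:
  "weak_star_lim P G y x \<Longrightarrow> weak_star_lim P G y' x' \<Longrightarrow> weak_star_lim P G (\<lambda>i. y i + y' i) (x + x')"
  by (auto simp: weak_star_lim_def blinfun.add_right intro!: tendsto_add)

lemma weak_star_lim_scaleR:
  "weak_star_lim P G y x \<Longrightarrow> weak_star_lim P G (\<lambda>i. c *\<^sub>R y i) (c *\<^sub>R x)"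
  by (auto simp: weak_star_lim_def blinfun.scaleR_right intro!: tendsto_scaleR)

lemma weak_star_lim_const: "weak_star_lim P G (\<lambda>i. x) x"
  by (simp add: weak_star_lim_def)

lemma weak_star_lim_subfilter:
  "weak_star_lim P G y x \<Longrightarrow> G' \<le> G \<Longrightarrow> weak_star_lim P G' y x"
  by (auto simp: weak_star_lim_def intro: tendsto_mono)

lemma dual_space_scaleC: "\<psi> \<in> dual_space \<Longrightarrow> blinfun_apply \<psi> (c *\<^sub>C x) = c * blinfun_apply \<psi> x"
  by (simp add: dual_space_def)

lemma weak_star_lim_scaleC:
  assumes "P \<subseteq> dual_space" "weak_star_lim P G y x"
  shows "weak_star_lim P G (\<lambda>i. c *\<^sub>C y i) (c *\<^sub>C x)"
  using assms by (auto simp: weak_star_lim_def dual_space_scaleC subset_iff intro!: tendsto_mult)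

locale jbw_trace =
  fixes P :: "('a::jb_star_algebra \<Rightarrow>\<^sub>L complex) set" and \<phi> :: "'a \<Rightarrow> complex"
  assumes jbw: "jbw_star_algebra P" and tracial: "normal_faithful_tracial_state P \<phi>"
begin

lemma predual_sub_dual: "P \<subseteq> dual_space"
  and predual_closed: "closed P"
  and predual_zero: "0 \<in> P"
  and predual_add: "\<psi> \<in> P \<Longrightarrow> \<rho> \<in> P \<Longrightarrow> \<psi> + \<rho> \<in> P"
  and predual_scaleC: "\<psi> \<in> P \<Longrightarrow> c *\<^sub>C \<psi> \<in> P"
  and predual_norm: "norm x = (SUP \<psi>\<in>{\<psi>\<in>P. norm \<psi> \<le> 1}. cmod (blinfun_apply \<psi> x))"
  using jbw by (auto simp: jbw_star_algebra_def is_predual_def)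

lemma predual_surj:
  assumes "\<And>\<psi> \<rho>. \<psi> \<in> P \<Longrightarrow> \<rho> \<in> P \<Longrightarrow> F (\<psi> + \<rho>) = F \<psi> + F \<rho>"
    and "\<And>c \<psi>. \<psi> \<in> P \<Longrightarrow> F (c *\<^sub>C \<psi>) = c * F \<psi>"
    and "\<And>\<psi>. \<psi> \<in> P \<Longrightarrow> cmod (F \<psi>) \<le> C * norm \<psi>"
  shows "\<exists>x. \<forall>\<psi>\<in>P. F \<psi> = blinfun_apply \<psi> x"
proof -
  have "\<forall>F :: ('a \<Rightarrow>\<^sub>L complex) \<Rightarrow> complex.
       (\<forall>\<psi>\<in>P. \<forall>\<rho>\<in>P. F (\<psi> + \<rho>) = F \<psi> + F \<rho>) \<and>
       (\<forall>c. \<forall>\<psi>\<in>P. F (c *\<^sub>C \<psi>) = c * F \<psi>) \<and>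
       (\<exists>C. \<forall>\<psi>\<in>P. cmod (F \<psi>) \<le> C * norm \<psi>)
       \<longrightarrow> (\<exists>x. \<forall>\<psi>\<in>P. F \<psi> = blinfun_apply \<psi> x)"
    using jbw by (simp add: jbw_star_algebra_def is_predual_def)
  then show ?thesis using assms by blast
qed

lemma predual_apply_scaleC: "\<psi> \<in> P \<Longrightarrow> blinfun_apply \<psi> (c *\<^sub>C x) = c * blinfun_apply \<psi> x"
  using predual_sub_dual by (auto simp: dual_space_def)

lemma predual_scaleR: "\<psi> \<in> P \<Longrightarrow> r *\<^sub>R \<psi> \<in> P"
  using predual_scaleC[of \<psi> "of_real r"] by (simp add: scaleC_of_real)

lemma predual_uminus: "\<psi> \<in> P \<Longrightarrow> - \<psi> \<in> P"
  using predual_scaleR[of \<psi> "-1"] by simp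

lemma predual_diff: "\<psi> \<in> P \<Longrightarrow> \<rho> \<in> P \<Longrightarrow> \<psi> - \<rho> \<in> P"
  using predual_add[of \<psi> "- \<rho>"] predual_uminus by simp

lemma predual_sum: "(\<And>i. i \<in> I \<Longrightarrow> f i \<in> P) \<Longrightarrow> sum f I \<in> P"
  by (induction I rule: infinite_finite_induct) (auto simp: predual_zero predual_add)

lemma norm_le_of_predual:
  assumes "\<And>\<psi>. \<psi> \<in> P \<Longrightarrow> norm \<psi> \<le> 1 \<Longrightarrow> cmod (blinfun_apply \<psi> x) \<le> C"
  shows "norm x \<le> C"
  unfolding predual_norm[of x] by (rule cSUP_least) (use assms predual_zero in auto)

lemma predual_separates:
  assumes "\<And>\<psi>. \<psi> \<in> P \<Longrightarrow> blinfun_apply \<psi> x = 0"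
  shows "x = 0"
  using norm_le_of_predual[of x 0] assms by simp

text \<open>
  Balls are weak* closed because the norm is a supremum over the unit ball of \<open>P\<close>.
\<close>

lemma norm_weak_star_lim:
  assumes "weak_star_lim P G y x" "G \<noteq> bot" "\<And>i. norm (y i) \<le> C"
  shows "norm x \<le> C"
proof (rule norm_le_of_predual)
  fix \<psi> assume \<psi>: "\<psi> \<in> P" "norm \<psi> \<le> 1"
  have "((\<lambda>i. cmod (blinfun_apply \<psi> (y i))) \<longlongrightarrow> cmod (blinfun_apply \<psi> x)) G"
    using assms(1) \<psi> by (auto simp: weak_star_lim_def intro: tendsto_norm)
  moreover have "cmod (blinfun_apply \<psi> (y i)) \<le> C" for i
    using norm_blinfun[of \<psi> "y i"] mult_mono[OF \<psi>(2) assms(3)[of i]] by simp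
  ultimately show "cmod (blinfun_apply \<psi> x) \<le> C"
    using assms(2) by (intro tendsto_upperbound) auto
qed

text \<open>
  If a functional is small on the common kernel of finitely many elements of \<open>P\<close>, it is
  close to a linear combination of these. The real case is
  \<open>finite_codimension_domination\<close>, applied to the real parts of the functionals and of
  their multiples by \<open>i\<close>; rotating the argument turns the estimate of the real part into one of
  the modulus.
\<close>

lemma approximable_mod_finite:
  fixes F :: "'a \<Rightarrow> complex"
  assumes F: "\<And>x y. F (x + y) = F x + F y" "\<And>c x. F (c *\<^sub>C x) = c * F x"
    and S: "finite S" "S \<subseteq> P" and "0 \<le> e"
    and le: "\<And>x. (\<And>\<psi>. \<psi> \<in> S \<Longrightarrow> blinfun_apply \<psi> x = 0) \<Longrightarrow> Re (F x) \<le> e * norm x"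
  shows "\<exists>\<psi>\<in>P. \<forall>x. cmod (F x - blinfun_apply \<psi> x) \<le> e * norm x"
proof -
  \<comment> \<open>The real part of \<open>\<i> *\<^sub>C \<psi>\<close> is minus the imaginary part of \<open>\<psi>\<close>.\<close>
  define T where "T = S \<union> scaleC \<i> ` S"
  have T: "finite T" "T \<subseteq> P" using S predual_scaleC by (auto simp: T_def)
  have FR: "F (r *\<^sub>R x) = r *\<^sub>R F x" for r x
    using F(2)[of "of_real r" x] by (simp add: scaleC_of_real scaleR_conv_of_real)
  have "\<exists>c. \<forall>x. Re (F x) - (\<Sum>\<psi>\<in>T. c \<psi> * Re (blinfun_apply \<psi> x)) \<le> e * norm x"
  proof (rule finite_codimension_domination[OF \<open>0 \<le> e\<close> T(1)])
    show "linear (\<lambda>x. Re (F x))" by (auto simp: linear_iff F FR)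
    show "linear (\<lambda>x. Re (blinfun_apply \<psi> x))" for \<psi> :: "'a \<Rightarrow>\<^sub>L complex"
      by (auto simp: linear_iff blinfun.add_right blinfun.scaleR_right)
    fix x assume x: "\<And>\<psi>. \<psi> \<in> T \<Longrightarrow> Re (blinfun_apply \<psi> x) = 0"
    show "Re (F x) \<le> e * norm x"
    proof (rule le)
      fix \<psi> assume "\<psi> \<in> S"
      then have "Re (blinfun_apply \<psi> x) = 0" "Re (blinfun_apply (\<i> *\<^sub>C \<psi>) x) = 0"
        by (auto intro!: x simp: T_def)
      then show "blinfun_apply \<psi> x = 0"
        by (simp add: complex_eq_iff scaleC_blinfun_apply scaleC_complex_def)
    qed
  qed
  then obtain c where c: "\<And>x. Re (F x) - (\<Sum>\<psi>\<in>T. c \<psi> * Re (blinfun_apply \<psi> x)) \<le> e * norm x"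
    by blast
  define g where "g = (\<Sum>\<psi>\<in>T. c \<psi> *\<^sub>R \<psi>)"
  have gP: "g \<in> P" unfolding g_def using T by (intro predual_sum predual_scaleR) auto
  have g: "Re (blinfun_apply g x) = (\<Sum>\<psi>\<in>T. c \<psi> * Re (blinfun_apply \<psi> x))" for x
    by (simp add: g_def blinfun.sum_left blinfun.scaleR_left)
  have "cmod (F x - blinfun_apply g x) \<le> e * norm x" for x
  proof -
    define w where "w = F x - blinfun_apply g x"
    obtain u where u: "cmod u = 1" "u * w = of_real (cmod w)"
    proof (cases "w = 0")
      case False
      then show ?thesis
        by (intro that[of "cnj w / of_real (cmod w)"])
          (auto simp: norm_divide complex_norm_square[symmetric] power2_eq_square field_simps mult.commute)
    qed (auto intro: that[of 1])
    have "cmod w = Re (u * w)" using u by simp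
    also have "u * w = F (u *\<^sub>C x) - blinfun_apply g (u *\<^sub>C x)"
      by (simp add: w_def F predual_apply_scaleC[OF gP] algebra_simps)
    also have "Re \<dots> \<le> e * norm (u *\<^sub>C x)" using c[of "u *\<^sub>C x"] by (simp add: g)
    finally show ?thesis using u by (simp add: w_def norm_scaleC)
  qed
  with gP show ?thesis by blast
qed

lemma trace_add: "\<phi> (x + y) = \<phi> x + \<phi> y"
  and trace_scaleC: "\<phi> (c *\<^sub>C x) = c * \<phi> x"
  and trace_one: "\<phi> 1 = 1"
  and trace_positive: "positive x \<Longrightarrow> \<phi> x \<in> \<real>" "positive x \<Longrightarrow> 0 \<le> Re (\<phi> x)"
  and trace_faithful: "positive x \<Longrightarrow> x \<noteq> 0 \<Longrightarrow> 0 < Re (\<phi> x)"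
  and trace_assoc: "\<phi> (x \<circ>\<^sub>J (y \<circ>\<^sub>J z)) = \<phi> ((x \<circ>\<^sub>J y) \<circ>\<^sub>J z)"
  using tracial by (auto simp: normal_faithful_tracial_state_def)

text \<open>
  A neighbourhood of zero on which the modulus of \<open>\<phi>\<close> is below \<open>1\<close> contains a
  subspace of finite codimension cut out by elements of \<open>P\<close>. On this subspace \<open>\<phi>\<close> vanishes, since
  it is bounded there.
\<close>

lemma trace_normal: "\<exists>\<psi>\<in>P. \<phi> = blinfun_apply \<psi>"
proof -
  let ?B = "{blinfun_apply \<psi> -` U | \<psi> U. \<psi> \<in> P \<and> open U}"
  have zero: "\<phi> 0 = 0" using trace_add[of 0 0] by simp
  have "continuous_map (weak_star_topology P) euclidean \<phi>"
    using tracial by (auto simp: normal_faithful_tracial_state_def)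
  then have "openin (weak_star_topology P) {x \<in> topspace (weak_star_topology P). \<phi> x \<in> ball 0 1}"
    by (rule openin_continuous_map_preimage) (simp flip: open_openin)
  moreover have "topspace (weak_star_topology P) = UNIV"
    unfolding weak_star_topology_def topology_generated_by_topspace
    using predual_zero by (auto intro!: exI[of _ UNIV])
  ultimately have "openin (weak_star_topology P) (\<phi> -` ball 0 1)"
    by (simp add: vimage_def)
  then have "generate_topology_on ?B (\<phi> -` ball 0 1)"
    unfolding weak_star_topology_def openin_topology_generated_by_iff .
  from generate_topology_on_base[OF this, of 0] zero
  obtain \<F> where \<F>: "finite \<F>" "\<F> \<subseteq> ?B" "0 \<in> \<Inter>\<F>" "\<Inter>\<F> \<subseteq> \<phi> -` ball 0 1" by auto
  have "\<forall>V\<in>\<F>. \<exists>\<psi> U. V = blinfun_apply \<psi> -` U \<and> \<psi> \<in> P" using \<F>(2) by blast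
  then obtain \<Psi> U where \<Psi>: "\<And>V. V \<in> \<F> \<Longrightarrow> V = blinfun_apply (\<Psi> V) -` U V \<and> \<Psi> V \<in> P" by metis
  have small: "cmod (\<phi> x) < 1" if "\<And>\<psi>. \<psi> \<in> \<Psi> ` \<F> \<Longrightarrow> blinfun_apply \<psi> x = 0" for x
  proof -
    have "x \<in> V" if V: "V \<in> \<F>" for V
    proof -
      have "0 \<in> V" using \<F>(3) V by auto
      then have "blinfun_apply (\<Psi> V) 0 \<in> U V" using \<Psi>[OF V] by (metis vimage_eq)
      moreover have "blinfun_apply (\<Psi> V) x = blinfun_apply (\<Psi> V) 0" using that V \<open>\<And>\<psi>. \<psi> \<in> \<Psi> ` \<F> \<Longrightarrow> blinfun_apply \<psi> x = 0\<close> by simp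
      ultimately show ?thesis using \<Psi>[OF V] by (metis vimage_eq)
    qed
    then have "x \<in> \<phi> -` ball 0 1" using \<F>(4) by blast
    then show ?thesis by simp
  qed
  have "\<exists>\<psi>\<in>P. \<forall>x. cmod (\<phi> x - blinfun_apply \<psi> x) \<le> 0 * norm x"
  proof (rule approximable_mod_finite[OF trace_add trace_scaleC])
    show "finite (\<Psi> ` \<F>)" "\<Psi> ` \<F> \<subseteq> P" using \<F> \<Psi> by auto
    fix x assume x: "\<And>\<psi>. \<psi> \<in> \<Psi> ` \<F> \<Longrightarrow> blinfun_apply \<psi> x = 0"
    show "Re (\<phi> x) \<le> 0 * norm x"
    proof (rule ccontr)
      assume "\<not> ?thesis"
      then have pos: "0 < Re (\<phi> x)" by simp
      have "cmod (\<phi> ((1 / of_real (Re (\<phi> x))) *\<^sub>C x)) < 1"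
        using x \<Psi> by (intro small) (auto simp: predual_apply_scaleC)
      then have "cmod (\<phi> x) < Re (\<phi> x)" using pos by (simp add: trace_scaleC norm_divide)
      then show False using complex_Re_le_cmod[of "\<phi> x"] by simp
    qed
  qed simp
  then show ?thesis by (auto simp: fun_eq_iff)
qed

definition trace_functional :: "'a \<Rightarrow>\<^sub>L complex" where "trace_functional = Blinfun \<phi>"

lemma trace_functional: "trace_functional \<in> P" "blinfun_apply trace_functional = \<phi>"
  using trace_normal by (auto simp: trace_functional_def blinfun_apply_inverse)

lemma bounded_linear_trace: "bounded_linear \<phi>"
  using blinfun.bounded_linear_right[of trace_functional] by (simp add: trace_functional)

lemmas trace_linear = bounded_linear.linear[OF bounded_linear_trace]

text \<open>
  Selfadjoint elements are differences of squares, on which \<open>\<phi>\<close> is real.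
\<close>

lemma trace_star: "\<phi> (star x) = cnj (\<phi> x)"
proof -
  have sa: "\<phi> a \<in> \<real>" if a: "selfadjoint a" for a
  proof -
    have sq: "\<phi> ((a + r *\<^sub>R 1) \<circ>\<^sub>J (a + r *\<^sub>R 1)) \<in> \<real>" for r
      using a by (intro trace_positive) (auto simp: positive_def intro!: exI[of _ "a + r *\<^sub>R 1"] selfadjoint_intros)
    have "4 *\<^sub>R a = (a + 1 *\<^sub>R 1) \<circ>\<^sub>J (a + 1 *\<^sub>R 1) - (a + (-1) *\<^sub>R 1) \<circ>\<^sub>J (a + (-1) *\<^sub>R 1)"
      using scaleR_add_left[of 2 2 a]
      by (simp add: jordan.add_left jordan.add_right jordan.diff_left jordan.diff_right scaleR_2)
    then have "\<phi> (4 *\<^sub>R a) \<in> \<real>" using sq[of 1] sq[of "-1"] by (simp add: linear_diff[OF trace_linear])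
    then have "4 * \<phi> a \<in> \<real>" by (simp add: linear_cmul[OF trace_linear] scaleR_conv_of_real)
    then show ?thesis by (simp add: complex_is_Real_iff)
  qed
  let ?a = "real_part x" and ?b = "imag_part x"
  have "\<phi> (star x) = \<phi> (star (?a + \<i> *\<^sub>C ?b))" using real_imag_parts[of x] by simp
  also have "\<dots> = \<phi> (?a + (- \<i>) *\<^sub>C ?b)"
    using selfadjoint_real_part[of x] selfadjoint_imag_part[of x]
    by (simp add: star_add star_scaleC selfadjoint_def)
  also have "\<dots> = cnj (\<phi> (?a + \<i> *\<^sub>C ?b))"
    using sa[OF selfadjoint_real_part[of x]] sa[OF selfadjoint_imag_part[of x]]
    by (simp add: trace_add trace_scaleC Reals_cnj_iff del: scaleC.minus_left)
  finally show ?thesis using real_imag_parts[of x] by simp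
qed

section \<open>The inner product of the trace\<close>

definition ip :: "'a \<Rightarrow> 'a \<Rightarrow> real" where "ip x y = Re (\<phi> (x \<circ>\<^sub>J star y))"

lemma ip_add_left: "ip (x + y) z = ip x z + ip y z"
  and ip_diff_left: "ip (x - y) z = ip x z - ip y z"
  and ip_scaleR_left: "ip (r *\<^sub>R x) z = r * ip x z"
  by (simp_all add: ip_def jordan.add_left jordan.diff_left jordan.scaleR_left trace_add
      linear_diff[OF trace_linear] linear_cmul[OF trace_linear])

lemma ip_commute: "ip x y = ip y x"
  using trace_star[of "x \<circ>\<^sub>J star y"] by (simp add: ip_def star_jordan star_star)

lemma ip_add_right: "ip z (x + y) = ip z x + ip z y"
  and ip_diff_right: "ip z (x - y) = ip z x - ip z y"
  and ip_scaleR_right: "ip z (r *\<^sub>R x) = r * ip z x"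
  by (simp_all add: ip_commute[of z] ip_add_left ip_diff_left ip_scaleR_left)

lemmas ip_simps = ip_add_left ip_diff_left ip_scaleR_left ip_add_right ip_diff_right ip_scaleR_right

lemma ip_selfadjoint: "selfadjoint b \<Longrightarrow> ip a b = Re (\<phi> (a \<circ>\<^sub>J b))"
  by (simp add: ip_def selfadjoint_def)

lemma ip_parts: "ip x x = Re (\<phi> (real_part x \<circ>\<^sub>J real_part x)) + Re (\<phi> (imag_part x \<circ>\<^sub>J imag_part x))"
proof -
  let ?a = "real_part x" and ?b = "imag_part x"
  have "star x = ?a - \<i> *\<^sub>C ?b"
    using selfadjoint_real_part[of x] selfadjoint_imag_part[of x]
    by (subst real_imag_parts[of x]) (simp add: star_add star_ii selfadjoint_def)
  then have "x \<circ>\<^sub>J star x = (?a + \<i> *\<^sub>C ?b) \<circ>\<^sub>J (?a - \<i> *\<^sub>C ?b)" using real_imag_parts[of x] by simp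
  also have "\<dots> = ?a \<circ>\<^sub>J ?a + ?b \<circ>\<^sub>J ?b"
    by (simp add: jordan.add_left jordan.add_right jordan.diff_right jordan_scaleC jordan_scaleC_right
        scaleC_ii_ii scaleC.add_right jordan_commute[of ?b ?a])
  finally show ?thesis by (simp add: ip_def trace_add)
qed

lemma trace_square_nonneg: "selfadjoint a \<Longrightarrow> 0 \<le> Re (\<phi> (a \<circ>\<^sub>J a))"
  by (rule trace_positive) (auto simp: positive_def)

lemma trace_square_eq_0:
  assumes a: "selfadjoint a" and z: "Re (\<phi> (a \<circ>\<^sub>J a)) \<le> 0"
  shows "a = 0"
proof -
  have aa: "a \<circ>\<^sub>J a = 0"
    using trace_faithful[of "a \<circ>\<^sub>J a"] z a by (force simp: positive_def)
  have "jordan_triple a (star a) a = 0" using a aa by (simp add: jordan_triple_def selfadjoint_def jordan.zero_left)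
  then show ?thesis using norm_triple[of a] by simp
qed

lemma ip_nonneg: "0 \<le> ip x x"
  unfolding ip_parts by (intro add_nonneg_nonneg trace_square_nonneg selfadjoint_real_part selfadjoint_imag_part)

lemma ip_eq_0: assumes "ip x x \<le> 0" shows "x = 0"
proof -
  have "real_part x = 0" "imag_part x = 0"
    using assms trace_square_nonneg[OF selfadjoint_real_part[of x]] trace_square_nonneg[OF selfadjoint_imag_part[of x]]
    unfolding ip_parts by (auto intro!: trace_square_eq_0 selfadjoint_real_part selfadjoint_imag_part)
  then show ?thesis by (subst real_imag_parts[of x]) (simp add: scaleC.zero_right)
qed

text \<open>
  This is where the trace property enters: multiplication by a selfadjoint element is symmetric.
\<close>

lemma ip_sym: "selfadjoint t \<Longrightarrow> ip (t \<circ>\<^sub>J x) y = ip x (t \<circ>\<^sub>J y)"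
  by (simp add: ip_def star_jordan selfadjoint_def jordan_commute[of t x] trace_assoc[symmetric])
     (metis jordan_commute)

end

lemma discriminant_le:
  fixes A B C :: real
  assumes "\<And>t. 0 \<le> A - 2 * t * B + t^2 * C"
  shows "B^2 \<le> A * C"
proof (cases "C = 0")
  case True
  have "B = 0"
  proof (rule ccontr)
    assume "B \<noteq> 0"
    then show False using assms[of "(A + 1) / (2 * B)"] True by simp
  qed
  then show ?thesis using True by simp
next
  case False
  have "0 \<le> C"
  proof (rule ccontr)
    assume "\<not> 0 \<le> C"
    then have C: "C < 0" by simp
    \<comment> \<open>For negative \<open>C\<close> the quadratic term dominates at this \<open>t\<close>.\<close>
    define t where "t = (\<bar>A\<bar> + 2 * \<bar>B\<bar>) / (- C) + 1"
    have t: "1 \<le> t" "t * C = - (\<bar>A\<bar> + 2 * \<bar>B\<bar>) + C" using C by (auto simp: t_def field_simps)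
    have "t^2 * C = t * (- (\<bar>A\<bar> + 2 * \<bar>B\<bar>) + C)" using t by (simp add: power2_eq_square)
    moreover have "\<bar>A\<bar> * 1 \<le> \<bar>A\<bar> * t" "C * t < 0"
      using t C mult_left_mono[of 1 t "\<bar>A\<bar>"] by (auto simp: mult_neg_pos)
    moreover have "- (2 * t * B) \<le> 2 * t * \<bar>B\<bar>" using t mult_left_mono[of "- B" "\<bar>B\<bar>" "2 * t"] by simp
    ultimately have "A - 2 * t * B + t^2 * C < 0" by (simp add: algebra_simps)
    then show False using assms[of t] by simp
  qed
  with False have C: "0 < C" by simp
  have "0 \<le> (A - 2 * (B / C) * B + (B / C)^2 * C) * C"
    using assms[of "B / C"] C by (intro mult_nonneg_nonneg) auto
  also have "\<dots> = A * C - B^2" using C by (simp add: field_simps power2_eq_square)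
  finally show ?thesis by simp
qed

text \<open>
  A comparison of growth rates: it suffices to have the inequality for arbitrarily large exponents,
  which allows exponents that run through the powers of \<open>2\<close>.
\<close>

lemma power_domination:
  fixes p q :: real
  assumes dom: "\<And>k. \<exists>N\<ge>k. q ^ N * a \<le> b * p ^ N" and "0 < a" "0 \<le> p"
  shows "q \<le> p"
proof (rule ccontr)
  assume "\<not> q \<le> p"
  then have pq: "p < q" by simp
  show False
  proof (cases "p = 0")
    case True
    from dom[of 1] obtain N where "1 \<le> N" "q ^ N * a \<le> b * p ^ N" by blast
    with True have "q ^ N * a \<le> 0" by (cases N) auto
    moreover have "0 < q ^ N * a" using pq True \<open>0 < a\<close> by simp
    ultimately show False by simp
  next
    case False
    with \<open>0 \<le> p\<close> have p: "0 < p" by simp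
    then have "1 < q / p" using pq by simp
    then obtain k where k: "b / a < (q / p) ^ k" using real_arch_pow by blast
    obtain N where N: "k \<le> N" "q ^ N * a \<le> b * p ^ N" using dom by blast
    have "(q / p) ^ k \<le> (q / p) ^ N" using \<open>1 < q / p\<close> N by (intro power_increasing) auto
    then have "b / a < q ^ N / p ^ N" using k by (simp add: power_divide)
    then have "b * p ^ N < q ^ N * a" using p \<open>0 < a\<close> by (simp add: field_simps)
    with N show False by simp
  qed
qed

context jbw_trace
begin

lemma ip_cauchy_schwarz: "(ip x y)^2 \<le> ip x x * ip y y"
proof (rule discriminant_le)
  fix t
  have "0 \<le> ip (x - t *\<^sub>R y) (x - t *\<^sub>R y)" by (rule ip_nonneg)
  then show "0 \<le> ip x x - 2 * t * ip x y + t^2 * ip y y"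
    by (simp add: ip_simps ip_commute[of y x] power2_eq_square algebra_simps)
qed

lemma ip_le_norm: "ip x x \<le> norm trace_functional * (norm x)^2"
proof -
  have "ip x x \<le> cmod (\<phi> (x \<circ>\<^sub>J star x))" unfolding ip_def by (rule complex_Re_le_cmod)
  also have "\<dots> \<le> norm trace_functional * norm (x \<circ>\<^sub>J star x)"
    using norm_blinfun[of trace_functional "x \<circ>\<^sub>J star x"] by (simp add: trace_functional)
  also have "\<dots> \<le> norm trace_functional * (norm x * norm (star x))"
    by (intro mult_left_mono norm_jordan) auto
  finally show ?thesis by (simp add: norm_star power2_eq_square)
qed

text \<open>
  A symmetric operator that is bounded by \<open>c\<close> for the given norm is bounded by \<open>c\<close> for the weaker
  inner product norm. The numbers \<open>ip (T ^ k x) (T ^ k x)\<close> form a logarithmically convex sequence that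
  grows at most like \<open>c ^ (2 k)\<close>; if the first quotient exceeded \<open>c\<^sup>2\<close>, all later ones
  would.
\<close>

lemma ip_symmetric_operator_bound:
  assumes sym: "\<And>x y. ip (T x) y = ip x (T y)" and bnd: "\<And>x. norm (T x) \<le> c * norm x" and "0 \<le> c"
  shows "ip (T x) (T x) \<le> c^2 * ip x x"
proof (cases "x = 0")
  case True
  then show ?thesis using bnd[of 0] by (simp add: ip_def jordan.zero_left linear_0[OF trace_linear])
next
  case False
  define n where "n k = ip ((T ^^ k) x) ((T ^^ k) x)" for k
  have n0: "0 < n 0" using False ip_eq_0[of x] by (force simp: n_def)
  have nb: "(norm ((T ^^ k) x)) \<le> c ^ k * norm x" for k
  proof (induction k)
    case (Suc k)
    have "norm (T ((T ^^ k) x)) \<le> c * (c ^ k * norm x)"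
      using bnd[of "(T ^^ k) x"] mult_left_mono[OF Suc.IH \<open>0 \<le> c\<close>] by linarith
    then show ?case by (simp add: mult.assoc)
  qed simp
  have upper: "n k \<le> norm trace_functional * (norm x)^2 * (c^2)^k" for k
  proof -
    have "n k \<le> norm trace_functional * (norm ((T ^^ k) x))^2" unfolding n_def by (rule ip_le_norm)
    also have "\<dots> \<le> norm trace_functional * (c ^ k * norm x)^2"
      by (intro mult_left_mono power_mono nb) auto
    finally show ?thesis by (simp add: power_mult_distrib algebra_simps flip: power_mult)
  qed
  have conv: "(n (Suc k))^2 \<le> n k * n (Suc (Suc k))" for k
  proof -
    have "n (Suc k) = ip ((T ^^ k) x) ((T ^^ Suc (Suc k)) x)" by (simp add: n_def sym)
    then show ?thesis using ip_cauchy_schwarz[of "(T ^^ k) x" "(T ^^ Suc (Suc k)) x"] by (simp only: n_def)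
  qed
  define q where "q = n 1 / n 0"
  have "n 1 \<le> c^2 * n 0"
  proof (rule ccontr)
    assume "\<not> n 1 \<le> c^2 * n 0"
    then have q: "c^2 < q" using n0 by (simp add: q_def field_simps)
    then have q0: "0 < q" using zero_le_power2[of c] by linarith
    have step: "0 < n k \<and> q * n k \<le> n (Suc k)" for k
    proof (induction k)
      case 0
      then show ?case using n0 by (simp add: q_def)
    next
      case (Suc k)
      have "0 < q * n k" using Suc q0 by simp
      then have pos: "0 < n (Suc k)" using Suc by linarith
      have "n k * (q * n (Suc k)) = (q * n k) * n (Suc k)" by simp
      also have "\<dots> \<le> n (Suc k) * n (Suc k)" using Suc pos by (intro mult_right_mono) auto
      also have "\<dots> \<le> n k * n (Suc (Suc k))" using conv[of k] by (simp add: power2_eq_square)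
      finally show ?case using Suc pos by simp
    qed
    have low: "q ^ k * n 0 \<le> n k" for k
    proof (induction k)
      case (Suc k)
      have "q ^ Suc k * n 0 = q * (q ^ k * n 0)" by simp
      also have "\<dots> \<le> q * n k" using Suc q0 by (intro mult_left_mono) auto
      finally show ?case using step[of k] by linarith
    qed simp
    have "q \<le> c^2"
    proof (rule power_domination[where a = "n 0" and b = "norm trace_functional * (norm x)^2"])
      show "\<exists>N\<ge>k. q ^ N * n 0 \<le> norm trace_functional * (norm x)^2 * (c^2) ^ N" for k
        using low[of k] upper[of k] by (intro exI[of _ k] conjI) (rule order_refl, linarith)
    qed (use n0 in auto)
    then show False using q by simp
  qed
  then show ?thesis by (simp add: n_def)
qed

lemma ip_jordan_bound:
  assumes "selfadjoint t"
  shows "ip (t \<circ>\<^sub>J x) (t \<circ>\<^sub>J x) \<le> (norm t)^2 * ip x x" "\<bar>ip (t \<circ>\<^sub>J x) x\<bar> \<le> norm t * ip x x"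
proof -
  show 1: "ip (t \<circ>\<^sub>J x) (t \<circ>\<^sub>J x) \<le> (norm t)^2 * ip x x"
    by (rule ip_symmetric_operator_bound[OF ip_sym[OF assms] norm_jordan]) simp
  have "(ip (t \<circ>\<^sub>J x) x)^2 \<le> ((norm t)^2 * ip x x) * ip x x"
    using ip_cauchy_schwarz[of "t \<circ>\<^sub>J x" x] mult_right_mono[OF 1 ip_nonneg[of x]] by linarith
  also have "\<dots> = (norm t * ip x x)^2" by (simp add: power2_eq_square)
  finally show "\<bar>ip (t \<circ>\<^sub>J x) x\<bar> \<le> norm t * ip x x"
    using power2_le_imp_le[of "\<bar>ip (t \<circ>\<^sub>J x) x\<bar>"] ip_nonneg[of x] by simp
qed

text \<open>
  The Banach-Alaoglu theorem: the evaluations lie in a product of discs, which is compact by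
  Tychonoff's theorem, and a cluster point of evaluations is a bounded linear functional on \<open>P\<close>, hence itself
  an evaluation.
\<close>

lemma weak_star_cluster:
  fixes y :: "'i \<Rightarrow> 'a"
  assumes "\<Gamma> \<noteq> bot" "\<And>i. norm (y i) \<le> C"
  shows "\<exists>G x. G \<noteq> bot \<and> G \<le> \<Gamma> \<and> weak_star_lim P G y x"
proof -
  define K where "K = PiE UNIV (\<lambda>\<psi>::'a \<Rightarrow>\<^sub>L complex. cball (0::complex) (norm \<psi> * C))"
  define f :: "'i \<Rightarrow> ('a \<Rightarrow>\<^sub>L complex) \<Rightarrow> complex" where "f i = (\<lambda>\<psi>. blinfun_apply \<psi> (y i))" for i
  have "compactin (product_topology (\<lambda>_. euclidean) UNIV) K"
    unfolding K_def compactin_PiE by simp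
  then have "compact K" by (simp add: euclidean_product_topology)
  have fK: "f i \<in> K" for i
  proof -
    have "cmod (blinfun_apply \<psi> (y i)) \<le> norm \<psi> * C" for \<psi> :: "'a \<Rightarrow>\<^sub>L complex"
      using norm_blinfun[of \<psi> "y i"] mult_left_mono[OF assms(2)[of i] norm_ge_zero[of \<psi>]] by linarith
    then show ?thesis by (auto simp: K_def f_def)
  qed
  have "filtermap f \<Gamma> \<noteq> bot" using assms(1) by (simp add: filtermap_bot_iff)
  moreover have "eventually (\<lambda>v. v \<in> K) (filtermap f \<Gamma>)" using fK by (simp add: eventually_filtermap)
  ultimately obtain \<Lambda> where \<Lambda>: "inf (nhds \<Lambda>) (filtermap f \<Gamma>) \<noteq> bot"
    using \<open>compact K\<close> unfolding compact_filter by blast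
  define G where "G = inf \<Gamma> (filtercomap f (nhds \<Lambda>))"
  have "G \<noteq> bot"
  proof
    assume "G = bot"
    then have "eventually (\<lambda>_. False) G" by simp
    then obtain Q R where Q: "eventually Q \<Gamma>" and R: "eventually R (filtercomap f (nhds \<Lambda>))"
      and QR: "\<And>i. Q i \<Longrightarrow> R i \<Longrightarrow> False"
      unfolding G_def eventually_inf by blast
    obtain S where S: "eventually S (nhds \<Lambda>)" "\<And>i. S (f i) \<Longrightarrow> R i"
      using R unfolding eventually_filtercomap by blast
    have "eventually (\<lambda>v. \<exists>i. Q i \<and> v = f i) (filtermap f \<Gamma>)"
      unfolding eventually_filtermap by (rule eventually_mono[OF Q]) auto
    then have "eventually (\<lambda>_. False) (inf (nhds \<Lambda>) (filtermap f \<Gamma>))"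
      unfolding eventually_inf using S QR by blast
    then show False using \<Lambda> by (simp add: trivial_limit_def)
  qed
  have flim: "filterlim f (nhds \<Lambda>) G"
    unfolding G_def filterlim_iff_le_filtercomap by simp
  have lim: "((\<lambda>i. blinfun_apply \<psi> (y i)) \<longlongrightarrow> \<Lambda> \<psi>) G" for \<psi>
  proof (rule topological_tendstoI)
    fix U :: "complex set" assume U: "open U" "\<Lambda> \<psi> \<in> U"
    have "continuous_on UNIV (\<lambda>v::('a \<Rightarrow>\<^sub>L complex) \<Rightarrow> complex. v \<psi>)"
      using continuous_map_product_projection[of \<psi> UNIV "\<lambda>_. euclidean :: complex topology"]
      by (simp add: euclidean_product_topology)
    then have "open ((\<lambda>v. v \<psi>) -` U)" using U by (intro open_vimage)
    then have "\<forall>\<^sub>F v in nhds \<Lambda>. v \<psi> \<in> U"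
      using U unfolding eventually_nhds by (intro exI[of _ "(\<lambda>v. v \<psi>) -` U"]) auto
    then show "\<forall>\<^sub>F i in G. blinfun_apply \<psi> (y i) \<in> U"
      using flim[unfolded filterlim_iff, rule_format] by (fastforce simp: f_def)
  qed
  have "\<exists>x. \<forall>\<psi>\<in>P. \<Lambda> \<psi> = blinfun_apply \<psi> x"
  proof (rule predual_surj)
    show "\<Lambda> (\<psi> + \<rho>) = \<Lambda> \<psi> + \<Lambda> \<rho>" for \<psi> \<rho>
      using tendsto_unique[OF \<open>G \<noteq> bot\<close> lim[of "\<psi> + \<rho>"]] tendsto_add[OF lim[of \<psi>] lim[of \<rho>]]
      by (simp add: blinfun.add_left)
    show "\<Lambda> (c *\<^sub>C \<psi>) = c * \<Lambda> \<psi>" for \<psi> c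
      using tendsto_unique[OF \<open>G \<noteq> bot\<close> lim[of "c *\<^sub>C \<psi>"]] tendsto_mult[OF tendsto_const[of c] lim[of \<psi>]]
      by (simp add: scaleC_blinfun_apply scaleC_complex_def)
    show "cmod (\<Lambda> \<psi>) \<le> C * norm \<psi>" for \<psi>
    proof (rule tendsto_upperbound[OF tendsto_norm[OF lim[of \<psi>]] _ \<open>G \<noteq> bot\<close>])
      show "\<forall>\<^sub>F i in G. cmod (blinfun_apply \<psi> (y i)) \<le> C * norm \<psi>"
        using fK by (auto simp: K_def f_def PiE_iff mult.commute)
    qed
  qed
  then obtain x where x: "\<And>\<psi>. \<psi> \<in> P \<Longrightarrow> \<Lambda> \<psi> = blinfun_apply \<psi> x" by blast
  show ?thesis
  proof (intro exI[of _ G] exI[of _ x] conjI)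
    show "weak_star_lim P G y x" unfolding weak_star_lim_def using lim x by metis
  qed (use \<open>G \<noteq> bot\<close> in \<open>auto simp: G_def\<close>)
qed

section \<open>Weak* limits of selfadjoint elements and of squares\<close>

lemma weak_star_lim_unique:
  assumes "weak_star_lim P G y x" "weak_star_lim P G y x'" "G \<noteq> bot"
  shows "x = x'"
proof -
  have "x - x' = 0"
  proof (rule predual_separates)
    fix \<psi> assume "\<psi> \<in> P"
    then have "blinfun_apply \<psi> x = blinfun_apply \<psi> x'"
      using assms(1,2) tendsto_unique[OF assms(3)] unfolding weak_star_lim_def by blast
    then show "blinfun_apply \<psi> (x - x') = 0" by (simp add: blinfun.diff_right)
  qed
  then show ?thesis by simp
qed

lemma real_part_one_plus: "real_part (1 + r *\<^sub>R \<i> *\<^sub>C x) = 1 - r *\<^sub>R imag_part x"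
proof -
  have "1 + r *\<^sub>R \<i> *\<^sub>C x + star (1 + r *\<^sub>R \<i> *\<^sub>C x) = 2 *\<^sub>R 1 - r *\<^sub>R (2 *\<^sub>R imag_part x)"
    by (simp add: imag_part_def scaleR_2[of 1] star_add star_scaleR star_ii scaleC.diff_right algebra_simps)
  then show ?thesis by (simp add: real_part_def scaleR_diff_right)
qed

lemma trace_module_assoc: "selfadjoint b \<Longrightarrow> ip (u \<circ>\<^sub>J b) b = Re (\<phi> (u \<circ>\<^sub>J (b \<circ>\<^sub>J b)))"
  by (simp add: ip_selfadjoint trace_assoc)

text \<open>
  For selfadjoint \<open>y\<close> the norm of \<open>1 + i r y\<close> is \<open>1 + O(r\<^sup>2)\<close>, and this bound passes to the limit
  \<open>x\<close>. The real part of \<open>1 + i r x\<close> is \<open>1 - r b\<close>, where \<open>b\<close> is the imaginary part of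
  \<open>x\<close>. Testing against \<open>d\<close> gives \<open>r \<phi>(b d\<^sup>2) = O(r\<^sup>2)\<close> for both signs of \<open>r\<close>, hence
  \<open>\<phi>(b d\<^sup>2) = 0\<close> for all selfadjoint \<open>d\<close>, and \<open>b = 0\<close>.
\<close>

lemma weak_star_lim_selfadjoint:
  assumes lim: "weak_star_lim P G y x" "G \<noteq> bot" and y: "\<And>i. selfadjoint (y i)" "\<And>i. norm (y i) \<le> C"
  shows "selfadjoint x"
proof -
  define D where "D = max C 1"
  have D: "0 < D" "\<And>i. norm (y i) \<le> D" using y(2) by (auto simp: D_def intro: le_max_iff_disj[THEN iffD2])
  define b where "b = imag_part x"
  have b: "selfadjoint b" unfolding b_def by (rule selfadjoint_imag_part)
  have bound: "norm (1 - (r / D) *\<^sub>R b) \<le> 1 + 6 * r^2" if r: "\<bar>r\<bar> \<le> 1" for r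
  proof -
    have "norm (1 + (r / D) *\<^sub>R \<i> *\<^sub>C x) \<le> 1 + 6 * r^2"
    proof (rule norm_weak_star_lim[OF _ lim(2)])
      show "weak_star_lim P G (\<lambda>i. 1 + (r / D) *\<^sub>R \<i> *\<^sub>C y i) (1 + (r / D) *\<^sub>R \<i> *\<^sub>C x)"
        by (intro weak_star_lim_add weak_star_lim_const weak_star_lim_scaleR
            weak_star_lim_scaleC[OF predual_sub_dual] lim)
      fix i
      have "norm ((1 / D) *\<^sub>R y i) \<le> 1" using D by (simp add: field_simps)
      from norm_approx_unitary(2)[OF _ this, of r "r^2 / 2"] y(1)[of i] r
      show "norm (1 + (r / D) *\<^sub>R \<i> *\<^sub>C y i) \<le> 1 + 6 * r^2"
        by (simp add: selfadjoint_scaleR scaleC.scaleR_right abs_square_le_1)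
    qed
    then have "norm (real_part (1 + (r / D) *\<^sub>R \<i> *\<^sub>C x)) \<le> 1 + 6 * r^2"
      using norm_real_part order_trans by blast
    then show ?thesis by (simp add: real_part_one_plus b_def)
  qed
  have zero: "Re (\<phi> (b \<circ>\<^sub>J (d \<circ>\<^sub>J d))) = 0" if d: "selfadjoint d" for d
  proof -
    have le: "- r * ip (b \<circ>\<^sub>J d) d \<le> r^2 * (6 * D * ip d d)" if r: "\<bar>r\<bar> \<le> 1" for r
    proof -
      have "ip ((1 - (r / D) *\<^sub>R b) \<circ>\<^sub>J d) d \<le> norm (1 - (r / D) *\<^sub>R b) * ip d d"
        using ip_jordan_bound(2)[of "1 - (r / D) *\<^sub>R b" d] b by (simp add: selfadjoint_intros abs_le_iff)
      also have "\<dots> \<le> (1 + 6 * r^2) * ip d d" using bound[OF r] ip_nonneg by (intro mult_right_mono) auto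
      finally show ?thesis using D by (simp add: jordan.diff_left jordan.scaleR_left ip_simps field_simps)
    qed
    have pos: "\<bar>ip (b \<circ>\<^sub>J d) d\<bar> \<le> r * (6 * D * ip d d)" if "0 < r" "r \<le> 1" for r
    proof -
      have "r * (- ip (b \<circ>\<^sub>J d) d) \<le> r * (r * (6 * D * ip d d))" "r * ip (b \<circ>\<^sub>J d) d \<le> r * (r * (6 * D * ip d d))"
        using le[of r] le[of "- r"] that by (simp_all add: power2_eq_square mult.assoc)
      then have "- ip (b \<circ>\<^sub>J d) d \<le> r * (6 * D * ip d d)" "ip (b \<circ>\<^sub>J d) d \<le> r * (6 * D * ip d d)"
        using that by (simp_all only: mult_le_cancel_left_pos)
      then show ?thesis by linarith
    qed
    have "\<bar>ip (b \<circ>\<^sub>J d) d\<bar> \<le> 0"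
    proof (rule tendsto_lowerbound)
      show "((\<lambda>r. r * (6 * D * ip d d)) \<longlongrightarrow> 0) (at_right 0)"
        by (rule tendsto_eq_intros refl)+ simp
      show "\<forall>\<^sub>F r in at_right 0. \<bar>ip (b \<circ>\<^sub>J d) d\<bar> \<le> r * (6 * D * ip d d)"
        unfolding eventually_at_right_field using pos by (intro exI[of _ 1]) auto
    qed simp
    then show ?thesis using trace_module_assoc[OF d] by simp
  qed
  have "Re (\<phi> (b \<circ>\<^sub>J ((b + 1) \<circ>\<^sub>J (b + 1) - (b - 1) \<circ>\<^sub>J (b - 1)))) = 0"
    using zero[of "b + 1"] zero[of "b - 1"] b
    by (simp add: jordan.diff_right selfadjoint_intros linear_diff[OF trace_linear])
  moreover have "(b + 1) \<circ>\<^sub>J (b + 1) - (b - 1) \<circ>\<^sub>J (b - 1) = 4 *\<^sub>R b"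
    using scaleR_add_left[of 2 2 b]
    by (simp add: jordan.add_left jordan.add_right jordan.diff_left jordan.diff_right scaleR_2)
  ultimately have "Re (\<phi> (b \<circ>\<^sub>J b)) = 0" by (simp add: jordan.scaleR_right linear_cmul[OF trace_linear])
  then have "b = 0" using trace_square_eq_0[OF b] by simp
  then have "x = real_part x" using real_imag_parts[of x] by (simp add: b_def scaleC.zero_right)
  then show ?thesis using selfadjoint_real_part[of x] by simp
qed

text \<open>
  Positivity of the limit in the weak sense that is needed later: it follows from
  \<open>norm (1 - s a\<^sup>2) \<le> 1 + O(s\<^sup>2)\<close>, which passes to the limit, by letting \<open>s\<close> tend to zero.
\<close>

lemma weak_star_lim_square:
  assumes lim: "weak_star_lim P G (\<lambda>i. a i \<circ>\<^sub>J a i) u" "G \<noteq> bot"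
    and a: "\<And>i. selfadjoint (a i)" "\<And>i. norm (a i) \<le> C" and d: "selfadjoint d"
  shows "0 \<le> Re (\<phi> (u \<circ>\<^sub>J (d \<circ>\<^sub>J d)))"
proof -
  define D where "D = max C 1"
  have D: "0 < D" "\<And>i. norm (a i) \<le> D" using a(2) by (auto simp: D_def intro: le_max_iff_disj[THEN iffD2])
  have u: "selfadjoint u"
  proof (rule weak_star_lim_selfadjoint[OF lim])
    show "norm (a i \<circ>\<^sub>J a i) \<le> D * D" for i
      using norm_jordan[of "a i" "a i"] mult_mono[OF D(2)[of i] D(2)[of i]] D by simp
  qed (intro selfadjoint_intros a)
  have bound: "norm (1 - (s / D^2) *\<^sub>R u) \<le> 1 + 19 * s^2" if s: "0 \<le> s" "s \<le> 1/2" for s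
  proof (rule norm_weak_star_lim[OF _ lim(2)])
    show "weak_star_lim P G (\<lambda>i. 1 - (s / D^2) *\<^sub>R (a i \<circ>\<^sub>J a i)) (1 - (s / D^2) *\<^sub>R u)"
      by (intro weak_star_lim_diff weak_star_lim_const weak_star_lim_scaleR lim)
    fix i
    have "norm ((1 / D) *\<^sub>R a i) \<le> 1" using D by (simp add: field_simps)
    from norm_approx_unitary(1)[OF _ this, of "sqrt (2 * s)" s] a(1)[of i] s
    show "norm (1 - (s / D^2) *\<^sub>R (a i \<circ>\<^sub>J a i)) \<le> 1 + 19 * s^2"
      by (simp add: selfadjoint_scaleR jordan.scaleR_left jordan.scaleR_right power2_eq_square)
  qed
  have pos: "- (s * (19 * D^2 * ip d d)) \<le> ip (u \<circ>\<^sub>J d) d" if s: "0 < s" "s \<le> 1/2" for s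
  proof -
    have "ip ((1 - (s / D^2) *\<^sub>R u) \<circ>\<^sub>J d) d \<le> norm (1 - (s / D^2) *\<^sub>R u) * ip d d"
      using ip_jordan_bound(2)[of "1 - (s / D^2) *\<^sub>R u" d] u by (simp add: selfadjoint_intros abs_le_iff)
    also have "\<dots> \<le> (1 + 19 * s^2) * ip d d" using bound[of s] s ip_nonneg by (intro mult_right_mono) auto
    finally have "s * (- ip (u \<circ>\<^sub>J d) d) \<le> s * (s * (19 * D^2 * ip d d))"
      using D by (simp add: jordan.diff_left jordan.scaleR_left ip_simps field_simps power2_eq_square)
    then have "- ip (u \<circ>\<^sub>J d) d \<le> s * (19 * D^2 * ip d d)"
      using s by (simp only: mult_le_cancel_left_pos)
    then show ?thesis by linarith
  qed
  have "0 \<le> ip (u \<circ>\<^sub>J d) d"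
  proof (rule tendsto_upperbound)
    show "((\<lambda>s. - (s * (19 * D^2 * ip d d))) \<longlongrightarrow> 0) (at_right 0)"
      using tendsto_minus[OF tendsto_mult_left_zero[OF tendsto_ident_at[of 0 "{0<..}"]]] by simp
    show "\<forall>\<^sub>F s in at_right 0. - (s * (19 * D^2 * ip d d)) \<le> ip (u \<circ>\<^sub>J d) d"
      unfolding eventually_at_right_field using pos by (intro exI[of _ "1/2"]) auto
  qed simp
  then show ?thesis using trace_module_assoc[OF d] by simp
qed

text \<open>
  The Cauchy-Schwarz inequality for the positive form \<open>\<phi>(u (a b))\<close> bounds the square of \<open>\<phi>(u w)\<close> by
  \<open>\<phi>(u) \<phi>(u w\<^sup>2)\<close>. Iterating it along \<open>w\<close>, \<open>w\<^sup>2\<close>, \<open>w\<^sup>4\<close> and so on removes the dependence on the norm of \<open>u\<close>.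
\<close>

lemma trace_module_bound:
  assumes u: "\<And>b. selfadjoint b \<Longrightarrow> 0 \<le> Re (\<phi> (u \<circ>\<^sub>J (b \<circ>\<^sub>J b)))" and w: "selfadjoint w"
  shows "\<bar>Re (\<phi> (u \<circ>\<^sub>J w))\<bar> \<le> norm w * Re (\<phi> u)"
proof -
  define m where "m = Re (\<phi> u)"
  have m0: "0 \<le> m" using u[OF selfadjoint_one] by (simp add: m_def)
  define W where "W k = ((\<lambda>x. x \<circ>\<^sub>J x) ^^ k) w" for k
  have W0: "W 0 = w" and WS: "W (Suc k) = W k \<circ>\<^sub>J W k" for k by (simp_all add: W_def)
  have Wsa: "selfadjoint (W k)" for k by (induction k) (auto simp: W0 WS w intro: selfadjoint_intros)
  have Wn: "norm (W k) \<le> norm w ^ 2 ^ k" for k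
  proof (induction k)
    case (Suc k)
    have "norm (W (Suc k)) \<le> norm (W k) * norm (W k)" by (simp add: WS norm_jordan)
    also have "\<dots> \<le> norm w ^ 2 ^ k * norm w ^ 2 ^ k" using Suc by (intro mult_mono) auto
    finally show ?case by (simp add: power_add[symmetric] mult_2)
  qed (simp add: W0)
  define v where "v k = Re (\<phi> (u \<circ>\<^sub>J W k))" for k
  have cs: "(v k)^2 \<le> v (Suc k) * m" for k
  proof (rule discriminant_le)
    fix t
    have "0 \<le> Re (\<phi> (u \<circ>\<^sub>J ((W k - t *\<^sub>R 1) \<circ>\<^sub>J (W k - t *\<^sub>R 1))))"
      by (intro u selfadjoint_intros Wsa)
    also have "\<dots> = v (Suc k) - 2 * t * v k + t^2 * m"
      by (simp add: v_def WS m_def jordan.diff_left jordan.diff_right jordan.scaleR_left jordan.scaleR_right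
          linear_diff[OF trace_linear] linear_cmul[OF trace_linear] power2_eq_square trace_add jordan.add_right algebra_simps)
    finally show "0 \<le> v (Suc k) - 2 * t * v k + t^2 * m" .
  qed
  define K where "K = norm trace_functional * norm u"
  have vb: "\<bar>v k\<bar> \<le> K * norm w ^ 2 ^ k" for k
  proof -
    have "\<bar>v k\<bar> \<le> cmod (\<phi> (u \<circ>\<^sub>J W k))" unfolding v_def by (rule abs_Re_le_cmod)
    also have "\<dots> \<le> norm trace_functional * norm (u \<circ>\<^sub>J W k)"
      using norm_blinfun[of trace_functional] by (simp add: trace_functional)
    also have "\<dots> \<le> norm trace_functional * (norm u * norm w ^ 2 ^ k)"
      by (intro mult_left_mono order_trans[OF norm_jordan] Wn) auto
    finally show ?thesis by (simp add: K_def mult.assoc)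
  qed
  have "\<bar>v 0\<bar> \<le> m * norm w"
  proof (cases "m = 0")
    case True
    then show ?thesis using cs[of 0] by simp
  next
    case False
    with m0 have m: "0 < m" by simp
    have iter: "\<bar>v 0\<bar> ^ 2 ^ k * m \<le> m ^ 2 ^ k * \<bar>v k\<bar>" for k
    proof (induction k)
      case (Suc k)
      have "m * (\<bar>v 0\<bar> ^ 2 ^ Suc k * m) = (\<bar>v 0\<bar> ^ 2 ^ k * m)^2"
        by (simp add: power_mult_distrib power2_eq_square power_add mult_2)
      also have "\<dots> \<le> (m ^ 2 ^ k * \<bar>v k\<bar>)^2" using Suc m by (intro power_mono) auto
      also have "\<dots> = m ^ 2 ^ Suc k * (v k)^2" by (simp add: power_mult_distrib power2_eq_square power_add mult_2)
      also have "\<dots> \<le> m ^ 2 ^ Suc k * (\<bar>v (Suc k)\<bar> * m)"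
      proof (rule mult_left_mono)
        have "v (Suc k) * m \<le> \<bar>v (Suc k)\<bar> * m" using m by (intro mult_right_mono) auto
        then show "(v k)^2 \<le> \<bar>v (Suc k)\<bar> * m" using cs[of k] by linarith
      qed (use m in auto)
      finally have "m * (\<bar>v 0\<bar> ^ 2 ^ Suc k * m) \<le> m * (m ^ 2 ^ Suc k * \<bar>v (Suc k)\<bar>)" by (simp add: algebra_simps)
      then show ?case using m by (simp only: mult_le_cancel_left_pos)
    qed simp
    show ?thesis
    proof (rule power_domination[where a = m and b = K])
      fix k :: nat
      have "\<bar>v 0\<bar> ^ 2 ^ k * m \<le> K * (m * norm w) ^ 2 ^ k"
        using order_trans[OF iter mult_left_mono[OF vb]] m by (simp add: power_mult_distrib algebra_simps)
      then show "\<exists>N\<ge>k. \<bar>v 0\<bar> ^ N * m \<le> K * (m * norm w) ^ N"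
        by (intro exI[of _ "2 ^ k"]) (auto intro: less_imp_le less_exp)
    qed (use m in auto)
  qed
  then show ?thesis by (simp add: v_def W0 m_def mult.commute)
qed

lemma trace_tendsto:
  assumes "weak_star_lim P G y x"
  shows "((\<lambda>i. Re (\<phi> (y i))) \<longlongrightarrow> Re (\<phi> x)) G"
proof -
  have "((\<lambda>i. blinfun_apply trace_functional (y i)) \<longlongrightarrow> blinfun_apply trace_functional x) G"
    using assms trace_functional(1) by (simp add: weak_star_lim_def)
  from tendsto_Re[OF this] show ?thesis by (simp add: trace_functional(2))
qed

lemma Re_trace_le_ip: "\<bar>Re (\<phi> x)\<bar>^2 \<le> ip x x"
  using ip_cauchy_schwarz[of x 1] by (simp add: ip_def[of _ 1] trace_one)

text \<open>
  The element \<open>w\<close> is the difference of the squares of \<open>a = (w + e) / (2 sqrt e)\<close> and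
  \<open>b = (w - e) / (2 sqrt e)\<close>. Their traces are at most \<open>e\<close>, and this survives in weak* limits \<open>u\<close>
  and \<open>v\<close> although their norms are only bounded by a constant that depends on \<open>e\<close>. So
  \<open>x = u - v\<close>, and \<open>trace_module_bound\<close> gives \<open>\<phi>(x\<^sup>2) \<le> norm x (\<phi>(u) + \<phi>(v))\<close>.
\<close>

lemma weak_star_lim_small_selfadjoint:
  assumes lim: "weak_star_lim P G w x" "G \<noteq> bot"
    and w: "\<And>i. selfadjoint (w i)" "\<And>i. norm (w i) \<le> C"
    and small: "\<forall>\<^sub>F i in G. ip (w i) (w i) \<le> e^2" and e: "0 < e"
  shows "selfadjoint x" "Re (\<phi> (x \<circ>\<^sub>J x)) \<le> 2 * C * e"
proof -
  show x: "selfadjoint x" by (rule weak_star_lim_selfadjoint[OF lim w])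
  define h where "h = 1 / (2 * sqrt e)"
  have hh: "h * h = 1 / (4 * e)" using e by (simp add: h_def)
  define a where "a i = h *\<^sub>R (w i + e *\<^sub>R 1)" for i
  define b where "b i = h *\<^sub>R (w i - e *\<^sub>R 1)" for i
  have sa: "selfadjoint (a i)" "selfadjoint (b i)" for i
    by (auto simp: a_def b_def intro!: selfadjoint_intros w)
  define D where "D = \<bar>h\<bar> * (C + e * norm (1::'a))"
  have D: "norm (a i) \<le> D" "norm (b i) \<le> D" for i
  proof -
    have "norm (w i + e *\<^sub>R 1) \<le> C + e * norm (1::'a)" "norm (w i - e *\<^sub>R 1) \<le> C + e * norm (1::'a)"
      using norm_triangle_ineq[of "w i" "e *\<^sub>R 1"] norm_triangle_ineq4[of "w i" "e *\<^sub>R 1"] w(2)[of i] e by auto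
    then show "norm (a i) \<le> D" "norm (b i) \<le> D" by (auto simp: a_def b_def D_def intro: mult_left_mono)
  qed
  have sq: "norm (a i \<circ>\<^sub>J a i) \<le> D * D" "norm (b i \<circ>\<^sub>J b i) \<le> D * D" for i
  proof -
    have D0: "0 \<le> D" using order_trans[OF norm_ge_zero D(1)[of i]] .
    show "norm (a i \<circ>\<^sub>J a i) \<le> D * D"
      by (rule order_trans[OF norm_jordan mult_mono[OF D(1) D(1) D0 norm_ge_zero]])
    show "norm (b i \<circ>\<^sub>J b i) \<le> D * D"
      by (rule order_trans[OF norm_jordan mult_mono[OF D(2) D(2) D0 norm_ge_zero]])
  qed
  obtain G1 u where G1: "G1 \<noteq> bot" "G1 \<le> G" and u: "weak_star_lim P G1 (\<lambda>i. a i \<circ>\<^sub>J a i) u"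
    using weak_star_cluster[of G "\<lambda>i. a i \<circ>\<^sub>J a i", OF lim(2) sq(1)] by (elim exE conjE) (rule that; assumption)
  obtain G2 v where G2: "G2 \<noteq> bot" "G2 \<le> G1" and v: "weak_star_lim P G2 (\<lambda>i. b i \<circ>\<^sub>J b i) v"
    using weak_star_cluster[of G1 "\<lambda>i. b i \<circ>\<^sub>J b i", OF G1(1) sq(2)] by (elim exE conjE) (rule that; assumption)
  have u2: "weak_star_lim P G2 (\<lambda>i. a i \<circ>\<^sub>J a i) u" by (rule weak_star_lim_subfilter[OF u G2(2)])
  have lim2: "weak_star_lim P G2 w x" by (rule weak_star_lim_subfilter[OF lim(1)]) (use G1 G2 in order)
  have small2: "\<forall>\<^sub>F i in G2. ip (w i) (w i) \<le> e^2" using small G1 G2 by (meson filter_leD)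
  have aexp: "a i \<circ>\<^sub>J a i = (1 / (4 * e)) *\<^sub>R (w i \<circ>\<^sub>J w i + (2 * e) *\<^sub>R w i + e^2 *\<^sub>R 1)"
    and bexp: "b i \<circ>\<^sub>J b i = (1 / (4 * e)) *\<^sub>R (w i \<circ>\<^sub>J w i - (2 * e) *\<^sub>R w i + e^2 *\<^sub>R 1)" for i
  proof -
    have t: "(2 * e) *\<^sub>R w i = e *\<^sub>R w i + e *\<^sub>R w i" using scaleR_add_left[of e e "w i"] by (simp only: mult_2)
    show "a i \<circ>\<^sub>J a i = (1 / (4 * e)) *\<^sub>R (w i \<circ>\<^sub>J w i + (2 * e) *\<^sub>R w i + e^2 *\<^sub>R 1)"
      unfolding a_def jordan.scaleR_left jordan.scaleR_right scaleR_scaleR hh t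
      by (simp add: jordan.add_left jordan.add_right jordan.scaleR_left jordan.scaleR_right power2_eq_square algebra_simps)
    show "b i \<circ>\<^sub>J b i = (1 / (4 * e)) *\<^sub>R (w i \<circ>\<^sub>J w i - (2 * e) *\<^sub>R w i + e^2 *\<^sub>R 1)"
      unfolding b_def jordan.scaleR_left jordan.scaleR_right scaleR_scaleR hh t
      by (simp add: jordan.diff_left jordan.diff_right jordan.scaleR_left jordan.scaleR_right power2_eq_square algebra_simps)
  qed
  have "a i \<circ>\<^sub>J a i - b i \<circ>\<^sub>J b i = w i" for i
  proof -
    have "a i \<circ>\<^sub>J a i - b i \<circ>\<^sub>J b i = (1 / (4 * e)) *\<^sub>R ((2 * e) *\<^sub>R w i + (2 * e) *\<^sub>R w i)"
      unfolding aexp bexp scaleR_diff_right[symmetric] by simp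
    also have "\<dots> = (1 / (4 * e)) *\<^sub>R ((4 * e) *\<^sub>R w i)" by (simp add: scaleR_add_left[symmetric])
    finally show ?thesis using e by simp
  qed
  then have "weak_star_lim P G2 w (u - v)" using weak_star_lim_diff[OF u2 v] by simp
  then have xuv: "x = u - v" by (rule weak_star_lim_unique[OF lim2 _ G2(1)])
  have tr_bound: "Re (\<phi> (a i \<circ>\<^sub>J a i)) \<le> e" "Re (\<phi> (b i \<circ>\<^sub>J b i)) \<le> e" if le: "ip (w i) (w i) \<le> e^2" for i
  proof -
    have ww: "Re (\<phi> (w i \<circ>\<^sub>J w i)) \<le> e^2" using le by (simp add: ip_selfadjoint[OF w(1)])
    have "\<bar>Re (\<phi> (w i))\<bar> \<le> e"
      using power2_le_imp_le[of "\<bar>Re (\<phi> (w i))\<bar>" e] Re_trace_le_ip[of "w i"] le e by auto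
    then have "Re (\<phi> (w i)) \<le> e" "- Re (\<phi> (w i)) \<le> e" by auto
    then have m: "2 * e * Re (\<phi> (w i)) \<le> 2 * e * e" "2 * e * (- Re (\<phi> (w i))) \<le> 2 * e * e"
      using e mult_left_mono[of "Re (\<phi> (w i))" e "2 * e"] mult_left_mono[of "- Re (\<phi> (w i))" e "2 * e"] by auto
    have A: "Re (\<phi> (a i \<circ>\<^sub>J a i)) = (Re (\<phi> (w i \<circ>\<^sub>J w i)) + 2 * e * Re (\<phi> (w i)) + e^2) / (4 * e)"
      unfolding aexp by (simp add: linear_cmul[OF trace_linear] trace_add trace_one)
    have B: "Re (\<phi> (b i \<circ>\<^sub>J b i)) = (Re (\<phi> (w i \<circ>\<^sub>J w i)) - 2 * e * Re (\<phi> (w i)) + e^2) / (4 * e)"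
      unfolding bexp by (simp add: linear_cmul[OF trace_linear] linear_diff[OF trace_linear] trace_add trace_one)
    have "Re (\<phi> (w i \<circ>\<^sub>J w i)) + 2 * e * Re (\<phi> (w i)) + e^2 \<le> e * (4 * e)"
      "Re (\<phi> (w i \<circ>\<^sub>J w i)) - 2 * e * Re (\<phi> (w i)) + e^2 \<le> e * (4 * e)"
      using ww m unfolding power2_eq_square by linarith+
    then show "Re (\<phi> (a i \<circ>\<^sub>J a i)) \<le> e" "Re (\<phi> (b i \<circ>\<^sub>J b i)) \<le> e"
      unfolding A B using e by (simp_all add: pos_divide_le_eq)
  qed
  have ule: "Re (\<phi> u) \<le> e"
    by (rule tendsto_upperbound[OF trace_tendsto[OF u2] eventually_mono[OF small2 tr_bound(1)] G2(1)])
  have vle: "Re (\<phi> v) \<le> e"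
    by (rule tendsto_upperbound[OF trace_tendsto[OF v] eventually_mono[OF small2 tr_bound(2)] G2(1)])
  have xC: "norm x \<le> C" by (rule norm_weak_star_lim[OF lim w(2)])
  have "Re (\<phi> (x \<circ>\<^sub>J x)) = Re (\<phi> (u \<circ>\<^sub>J x)) - Re (\<phi> (v \<circ>\<^sub>J x))"
  proof -
    have "x \<circ>\<^sub>J x = u \<circ>\<^sub>J x - v \<circ>\<^sub>J x" by (simp only: xuv[symmetric] flip: jordan.diff_left)
    then show ?thesis by (simp add: linear_diff[OF trace_linear])
  qed
  also have "\<dots> \<le> norm x * Re (\<phi> u) + norm x * Re (\<phi> v)"
    using trace_module_bound[OF weak_star_lim_square[OF u2 G2(1) sa(1) D(1)] x]
      trace_module_bound[OF weak_star_lim_square[OF v G2(1) sa(2) D(2)] x] by (simp add: abs_le_iff)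
  also have "\<dots> \<le> C * e + C * e"
    using mult_left_mono[OF ule norm_ge_zero[of x]] mult_left_mono[OF vle norm_ge_zero[of x]]
      mult_right_mono[OF xC, of e] e by linarith
  finally show "Re (\<phi> (x \<circ>\<^sub>J x)) \<le> 2 * C * e" by simp
qed

lemma weak_star_lim_small:
  assumes lim: "weak_star_lim P G y x" "G \<noteq> bot" and y: "\<And>i. norm (y i) \<le> C"
    and small: "\<forall>\<^sub>F i in G. ip (y i) (y i) \<le> e^2" and e: "0 < e"
  shows "ip x x \<le> 4 * C * e"
proof -
  let ?a = "\<lambda>i. real_part (y i)" and ?b = "\<lambda>i. imag_part (y i)"
  have n: "norm (?a i) \<le> C" "norm (?b i) \<le> C" for i
    using norm_real_part[of "y i"] norm_imag_part[of "y i"] y[of i] by linarith+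
  have ab: "ip (?a i) (?a i) \<le> ip (y i) (y i)" "ip (?b i) (?b i) \<le> ip (y i) (y i)" for i
    using trace_square_nonneg[OF selfadjoint_real_part[of "y i"]] trace_square_nonneg[OF selfadjoint_imag_part[of "y i"]]
    by (auto simp: ip_parts[of "y i"] ip_selfadjoint selfadjoint_real_part selfadjoint_imag_part)
  obtain G1 a where G1: "G1 \<noteq> bot" "G1 \<le> G" and a: "weak_star_lim P G1 ?a a"
    using weak_star_cluster[of G ?a, OF lim(2) n(1)] by (elim exE conjE) (rule that; assumption)
  obtain G2 b where G2: "G2 \<noteq> bot" "G2 \<le> G1" and b: "weak_star_lim P G2 ?b b"
    using weak_star_cluster[of G1 ?b, OF G1(1) n(2)] by (elim exE conjE) (rule that; assumption)
  have a2: "weak_star_lim P G2 ?a a" by (rule weak_star_lim_subfilter[OF a G2(2)])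
  have lim2: "weak_star_lim P G2 y x" by (rule weak_star_lim_subfilter[OF lim(1)]) (use G1 G2 in order)
  have small2: "\<forall>\<^sub>F i in G2. ip (y i) (y i) \<le> e^2" using small G1 G2 by (meson filter_leD)
  have sma: "\<forall>\<^sub>F i in G2. ip (?a i) (?a i) \<le> e^2" and smb: "\<forall>\<^sub>F i in G2. ip (?b i) (?b i) \<le> e^2"
    by (rule eventually_mono[OF small2], erule order_trans[OF ab(1)])
       (rule eventually_mono[OF small2], erule order_trans[OF ab(2)])
  note sa = weak_star_lim_small_selfadjoint[OF a2 G2(1) selfadjoint_real_part n(1) sma e]
  note sb = weak_star_lim_small_selfadjoint[OF b G2(1) selfadjoint_imag_part n(2) smb e]
  have "weak_star_lim P G2 y (a + \<i> *\<^sub>C b)"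
    using weak_star_lim_add[OF a2 weak_star_lim_scaleC[OF predual_sub_dual b, of \<i>]]
    by (simp flip: real_imag_parts)
  then have x: "x = a + \<i> *\<^sub>C b" by (rule weak_star_lim_unique[OF lim2 _ G2(1)])
  have "star x = a - \<i> *\<^sub>C b" using sa sb by (simp add: x star_add star_ii selfadjoint_def)
  then have "real_part x = a" "imag_part x = b"
    by (simp_all add: real_part_def imag_part_def x scaleC.diff_right scaleC.add_right scaleC.minus_right
        scaleC_ii_ii scaleR_2[symmetric])
  then show ?thesis using sa sb by (simp add: ip_parts)
qed

text \<open>
  Every weak* cluster point of a bounded sequence that tends to zero for \<open>ip\<close> is zero.
\<close>

lemma predual_ip_continuous:
  assumes \<psi>: "\<psi> \<in> P" and y: "\<And>n. norm (y n) \<le> C" and z: "(\<lambda>n. ip (y n) (y n)) \<longlonglongrightarrow> 0"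
  shows "(\<lambda>n. blinfun_apply \<psi> (y n)) \<longlonglongrightarrow> 0"
proof (rule ccontr)
  assume "\<not> ?thesis"
  then obtain \<epsilon> where \<epsilon>: "0 < \<epsilon>" "\<not> (\<forall>\<^sub>F n in sequentially. cmod (blinfun_apply \<psi> (y n)) < \<epsilon>)"
    by (auto simp: tendsto_iff)
  define \<Gamma> where "\<Gamma> = inf sequentially (principal {n. \<epsilon> \<le> cmod (blinfun_apply \<psi> (y n))})"
  have "\<Gamma> \<noteq> bot"
  proof
    assume "\<Gamma> = bot"
    then have "eventually (\<lambda>_. False) \<Gamma>" by simp
    then show False using \<epsilon>(2) unfolding \<Gamma>_def eventually_inf_principal by (simp add: not_le)
  qed
  obtain G x where G: "G \<noteq> bot" "G \<le> \<Gamma>" and x: "weak_star_lim P G y x"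
    using weak_star_cluster[of \<Gamma> y, OF \<open>\<Gamma> \<noteq> bot\<close> y] by (elim exE conjE) (rule that; assumption)
  have Gs: "G \<le> sequentially" using G by (simp add: \<Gamma>_def)
  have le: "ip x x \<le> 4 * C * e" if "0 < e" for e
  proof (rule weak_star_lim_small[OF x G(1) y _ that])
    have "\<forall>\<^sub>F n in sequentially. ip (y n) (y n) < e^2"
      using order_tendstoD(2)[OF z, of "e^2"] that by simp
    then show "\<forall>\<^sub>F n in G. ip (y n) (y n) \<le> e^2"
      using Gs by (auto dest!: filter_leD elim: eventually_mono)
  qed
  have "ip x x \<le> 0"
  proof (rule tendsto_lowerbound)
    show "((\<lambda>e. 4 * C * e) \<longlongrightarrow> 0) (at_right 0)"
      by (intro tendsto_mult_right_zero tendsto_ident_at)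
    show "\<forall>\<^sub>F e in at_right 0. ip x x \<le> 4 * C * e"
      unfolding eventually_at_right_field using le by (intro exI[of _ 1]) auto
  qed simp
  then have "x = 0" by (rule ip_eq_0)
  then have "((\<lambda>n. blinfun_apply \<psi> (y n)) \<longlongrightarrow> 0) G"
    using x \<psi> by (auto simp: weak_star_lim_def)
  then have "\<forall>\<^sub>F n in G. cmod (blinfun_apply \<psi> (y n)) < \<epsilon>" using \<epsilon>(1) by (auto simp: tendsto_iff)
  moreover have "\<forall>\<^sub>F n in G. \<epsilon> \<le> cmod (blinfun_apply \<psi> (y n))"
    using G(2) unfolding \<Gamma>_def by (auto simp: le_principal)
  ultimately have "\<forall>\<^sub>F n in G. False" by eventually_elim auto
  then show False using G(1) by (simp add: trivial_limit_def)
qed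

text \<open>
  The limit is any weak* cluster point \<open>x\<close>: the differences \<open>y m - y n\<close> are small for \<open>ip\<close> and
  cluster at \<open>y m - x\<close>.
\<close>

lemma ip_complete:
  assumes y: "\<And>n. norm (y n) \<le> C" and cauchy: "\<And>e. 0 < e \<Longrightarrow> \<exists>N. \<forall>m\<ge>N. \<forall>n\<ge>N. ip (y n - y m) (y n - y m) \<le> e"
  shows "\<exists>x. norm x \<le> C \<and> (\<lambda>n. ip (y n - x) (y n - x)) \<longlonglongrightarrow> 0"
proof -
  obtain G x where G: "G \<noteq> bot" "G \<le> sequentially" and x: "weak_star_lim P G y x"
    using weak_star_cluster[of sequentially y, OF sequentially_bot y] by (elim exE conjE) (rule that; assumption)
  have C0: "0 \<le> C" using order_trans[OF norm_ge_zero y[of 0]] .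
  have "(\<lambda>n. ip (y n - x) (y n - x)) \<longlonglongrightarrow> 0"
  proof (rule LIMSEQ_I)
    fix r :: real assume r: "0 < r"
    define e where "e = r / (8 * C + 1)"
    have e: "0 < e" "8 * C * e < r"
    proof -
      show "0 < e" using r C0 by (simp add: e_def)
      have "8 * C + 1 \<noteq> 0" using C0 by linarith
      then have "(8 * C + 1) * e = r" by (simp add: e_def)
      then have "8 * C * e + e = r" by (simp only: distrib_right mult_1)
      then show "8 * C * e < r" using \<open>0 < e\<close> by linarith
    qed
    obtain N where N: "\<forall>m\<ge>N. \<forall>n\<ge>N. ip (y n - y m) (y n - y m) \<le> e^2"
      using cauchy[OF zero_less_power[OF e(1), of 2]] by blast
    have "norm (ip (y m - x) (y m - x) - 0) < r" if m: "m \<ge> N" for m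
    proof -
      have "ip (y m - x) (y m - x) \<le> 4 * (2 * C) * e"
      proof (rule weak_star_lim_small[OF weak_star_lim_diff[OF weak_star_lim_const x] G(1) _ _ e(1)])
        show "norm (y m - y i) \<le> 2 * C" for i
          using norm_triangle_ineq4[of "y m" "y i"] y[of m] y[of i] by simp
        have "\<forall>\<^sub>F i in sequentially. ip (y m - y i) (y m - y i) \<le> e^2"
          unfolding eventually_sequentially using N m by auto
        then show "\<forall>\<^sub>F i in G. ip (y m - y i) (y m - y i) \<le> e^2" by (rule filter_leD[OF G(2)])
      qed
      then show ?thesis using e(2) ip_nonneg[of "y m - x"] by simp
    qed
    then show "\<exists>no. \<forall>n\<ge>no. norm (ip (y n - x) (y n - x) - 0) < r" by blast
  qed
  moreover have "norm x \<le> C" by (rule norm_weak_star_lim[OF x G(1) y])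
  ultimately show ?thesis by blast
qed

section \<open>Functionals continuous for the inner product are normal\<close>

text \<open>
  The parallelogram law: nearly minimal points of a convex set are close to each other.
\<close>

lemma ip_minimal_points_close:
  assumes mid: "\<And>x y. x \<in> K \<Longrightarrow> y \<in> K \<Longrightarrow> (1/2) *\<^sub>R (x + y) \<in> K"
    and low: "\<And>z. z \<in> K \<Longrightarrow> d - a \<le> ip z z"
    and x: "x \<in> K" "ip x x \<le> d + a" and y: "y \<in> K" "ip y y \<le> d + a"
  shows "ip (x - y) (x - y) \<le> 8 * a"
proof -
  let ?m = "(1/2) *\<^sub>R (x + y)"
  have "4 * ip ?m ?m + ip (x - y) (x - y) = 2 * ip x x + 2 * ip y y"
    by (simp add: ip_simps ip_commute[of y x] field_simps)
  moreover have "d - a \<le> ip ?m ?m" by (intro low mid x y)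
  ultimately show ?thesis using x y by linarith
qed

lemma ip_triangle: "ip (x - z) (x - z) \<le> 2 * ip (x - y) (x - y) + 2 * ip (y - z) (y - z)"
proof -
  have "ip ((x - y) - (y - z)) ((x - y) - (y - z)) + ip (x - z) (x - z)
      = 2 * ip (x - y) (x - y) + 2 * ip (y - z) (y - z)"
    by (simp add: ip_simps ip_commute[of y x] ip_commute[of z x] ip_commute[of z y])
  then show ?thesis using ip_nonneg[of "(x - y) - (y - z)"] by linarith
qed

lemma ip_uminus: "ip (x - y) (x - y) = ip (y - x) (y - x)"
  by (simp add: ip_simps)

text \<open>
  The Hilbert space argument that bounded, closed, convex sets have the finite intersection
  property. The minimal norms \<open>d S\<close> increase with \<open>S\<close>; along finite sets \<open>S n\<close> with \<open>d (S n)\<close>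
  tending to the supremum, nearly minimal points converge, and the limit does not change when
  another finite set \<open>T\<close> is added to all \<open>S n\<close>.
\<close>

lemma directed_intersection:
  fixes K :: "('a \<Rightarrow>\<^sub>L complex) set \<Rightarrow> 'a set"
  assumes anti: "\<And>S T. S \<subseteq> T \<Longrightarrow> K T \<subseteq> K S"
    and mid: "\<And>S x y. x \<in> K S \<Longrightarrow> y \<in> K S \<Longrightarrow> (1/2) *\<^sub>R (x + y) \<in> K S"
    and ne: "\<And>S. finite S \<Longrightarrow> S \<subseteq> P \<Longrightarrow> K S \<noteq> {}"
    and bd: "\<And>S x. x \<in> K S \<Longrightarrow> norm x \<le> 1"
    and cl: "\<And>S x y. (\<And>n. y n \<in> K S) \<Longrightarrow> norm x \<le> 1 \<Longrightarrow> (\<lambda>n::nat. ip (y n - x) (y n - x)) \<longlonglongrightarrow> 0 \<Longrightarrow> S \<subseteq> P \<Longrightarrow> x \<in> K S"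
  shows "\<exists>x. \<forall>S. finite S \<longrightarrow> S \<subseteq> P \<longrightarrow> x \<in> K S"
proof -
  define FS where "FS = {S. finite S \<and> S \<subseteq> P}"
  define d where "d S = (INF x\<in>K S. ip x x)" for S
  have bb: "bdd_below ((\<lambda>x. ip x x) ` K S)" for S by (rule bdd_belowI2[of _ 0]) (rule ip_nonneg)
  have dle: "d S \<le> ip x x" if "x \<in> K S" for S x unfolding d_def by (rule cINF_lower[OF bb that])
  define M where "M = norm trace_functional"
  have dM: "d S \<le> M" if SF: "S \<in> FS" for S
  proof -
    obtain x where x: "x \<in> K S" using ne[of S] SF unfolding FS_def by blast
    have "ip x x \<le> M * (norm x)^2" unfolding M_def by (rule ip_le_norm)
    also have "\<dots> \<le> M * 1" unfolding M_def using bd[OF x] by (intro mult_left_mono) (auto simp: abs_square_le_1)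
    finally show ?thesis using dle[OF x] by simp
  qed
  define D where "D = (SUP S\<in>FS. d S)"
  have ba: "bdd_above (d ` FS)" by (rule bdd_aboveI2[OF dM])
  have FS0: "{} \<in> FS" by (simp add: FS_def)
  have dD: "d S \<le> D" if "S \<in> FS" for S unfolding D_def by (rule cSUP_upper[OF that ba])
  define e where "e n = 1 / real (Suc n)" for n
  have e0: "0 < e n" for n by (simp add: e_def)
  have emono: "e m \<le> e n" if "n \<le> m" for m n using that by (simp add: e_def frac_le)
  have "\<exists>S\<in>FS. D - e n < d S" for n
  proof -
    have "D - e n < (SUP S\<in>FS. d S)" using e0[of n] by (simp add: D_def)
    then show ?thesis using less_cSUP_iff[OF _ ba] FS0 by blast
  qed
  then obtain S' where S': "\<And>n. S' n \<in> FS" "\<And>n. D - e n < d (S' n)" by metis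
  define S where "S n = (\<Union>i\<le>n. S' i)" for n
  have S: "S n \<in> FS" for n using S' by (auto simp: S_def FS_def)
  have Smono: "S n \<subseteq> S m" if "n \<le> m" for m n unfolding S_def using that by (intro UN_mono) auto
  have low: "D - e n \<le> ip z z" if "z \<in> K (S n)" for z n
  proof -
    have "z \<in> K (S' n)" using anti[of "S' n" "S n"] that by (auto simp: S_def)
    then show ?thesis using S'(2)[of n] dle by fastforce
  qed
  have near: "\<exists>x\<in>K T. ip x x \<le> D + e n" if "T \<in> FS" for T n
  proof -
    have "d T < D + e n" using dD[OF that] e0[of n] by linarith
    then have "\<exists>x\<in>K T. ip x x < D + e n"
      unfolding d_def using cINF_less_iff[OF _ bb] ne that by (auto simp: FS_def)
    then show ?thesis by (auto intro: less_imp_le)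
  qed
  have "\<exists>y. \<forall>n. y n \<in> K (S n) \<and> ip (y n) (y n) \<le> D + e n"
    by (intro choice allI) (use near[OF S] in blast)
  then obtain y where y: "\<And>n. y n \<in> K (S n)" "\<And>n. ip (y n) (y n) \<le> D + e n" by blast
  have close: "ip (y m - y n) (y m - y n) \<le> 8 * e n" if "n \<le> m" for m n
  proof (rule ip_minimal_points_close[of "K (S n)", OF mid low])
    show "y m \<in> K (S n)" using anti[OF Smono[OF that]] y(1) by blast
    show "ip (y m) (y m) \<le> D + e n" using y(2)[of m] emono[OF that] by linarith
  qed (use y in auto)
  have elim: "e \<longlonglongrightarrow> 0" unfolding e_def using LIMSEQ_inverse_real_of_nat by (simp add: inverse_eq_divide)
  have "\<exists>x. norm x \<le> 1 \<and> (\<lambda>n. ip (y n - x) (y n - x)) \<longlonglongrightarrow> 0"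
  proof (rule ip_complete[OF bd[OF y(1)]])
    fix \<epsilon> :: real assume "0 < \<epsilon>"
    then have "\<forall>\<^sub>F n in sequentially. e n < \<epsilon> / 8" using order_tendstoD(2)[OF elim, of "\<epsilon> / 8"] by simp
    then obtain N where N: "\<And>n. n \<ge> N \<Longrightarrow> e n < \<epsilon> / 8" by (auto simp: eventually_sequentially)
    have "ip (y n - y m) (y n - y m) \<le> \<epsilon>" if "m \<ge> N" "n \<ge> N" for m n
    proof (cases "m \<le> n")
      case True
      then show ?thesis using close[OF True] N[OF that(1)] by linarith
    next
      case False
      then show ?thesis using close[of n m] N[OF that(2)] by (simp add: ip_uminus[of "y n"])
    qed
    then show "\<exists>N. \<forall>m\<ge>N. \<forall>n\<ge>N. ip (y n - y m) (y n - y m) \<le> \<epsilon>" by blast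
  qed
  then obtain x where x: "norm x \<le> 1" and xlim: "(\<lambda>n. ip (y n - x) (y n - x)) \<longlonglongrightarrow> 0" by blast
  have "x \<in> K T" if T: "T \<in> FS" for T
  proof -
    have ST: "S n \<union> T \<in> FS" for n using S[of n] T by (simp add: FS_def)
    have "\<exists>v. \<forall>n. v n \<in> K (S n \<union> T) \<and> ip (v n) (v n) \<le> D + e n"
      by (intro choice allI) (use near[OF ST] in blast)
    then obtain v where v: "\<And>n. v n \<in> K (S n \<union> T)" "\<And>n. ip (v n) (v n) \<le> D + e n" by blast
    have vK: "v n \<in> K (S n)" "v n \<in> K T" for n using v(1)[of n] anti[of "S n" "S n \<union> T"] anti[of T "S n \<union> T"] by auto
    have "ip (v n - y n) (v n - y n) \<le> 8 * e n" for n
      by (rule ip_minimal_points_close[of "K (S n)", OF mid low vK(1) v(2) y])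
    then have le: "ip (v n - x) (v n - x) \<le> 16 * e n + 2 * ip (y n - x) (y n - x)" for n
      using ip_triangle[of "v n" x "y n"] by (smt (verit))
    have "(\<lambda>n. 16 * e n + 2 * ip (y n - x) (y n - x)) \<longlonglongrightarrow> 0"
      using tendsto_add[OF tendsto_mult_right_zero[OF elim, of 16] tendsto_mult_right_zero[OF xlim, of 2]] by simp
    then have "(\<lambda>n. ip (v n - x) (v n - x)) \<longlonglongrightarrow> 0"
      by (rule Lim_null_comparison[rotated]) (use le ip_nonneg in auto)
    then show ?thesis using T by (intro cl[OF vK(2) x]) (auto simp: FS_def)
  qed
  then show ?thesis by (auto simp: FS_def)
qed

text \<open>
  If \<open>F\<close> were not small on the unit ball of any common kernel of finitely many elements of \<open>P\<close>, the
  sets \<open>K S\<close> below would be nonempty, and a common point would be annihilated by all of \<open>P\<close>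
  without being zero. So \<open>F\<close> is a limit of elements of \<open>P\<close>.
\<close>

lemma normality_criterion:
  fixes F :: "'a \<Rightarrow>\<^sub>L complex"
  assumes F: "F \<in> dual_space"
    and cont: "\<And>y. (\<And>n. norm (y n) \<le> 2) \<Longrightarrow> (\<lambda>n::nat. ip (y n) (y n)) \<longlonglongrightarrow> 0 \<Longrightarrow> (\<lambda>n. blinfun_apply F (y n)) \<longlonglongrightarrow> 0"
  shows "F \<in> P"
proof -
  have fin: "\<exists>S. finite S \<and> S \<subseteq> P \<and> (\<forall>x. (\<forall>\<psi>\<in>S. blinfun_apply \<psi> x = 0) \<longrightarrow> Re (blinfun_apply F x) \<le> \<epsilon> * norm x)"
    if \<epsilon>: "0 < \<epsilon>" for \<epsilon>
  proof (rule ccontr)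
    assume no: "\<not> ?thesis"
    define K :: "('a \<Rightarrow>\<^sub>L complex) set \<Rightarrow> 'a set" where "K S = {y. norm y \<le> 1 \<and> (\<forall>\<psi>\<in>S. blinfun_apply \<psi> y = 0) \<and> \<epsilon> \<le> Re (blinfun_apply F y)}" for S
    have "\<exists>x. \<forall>S. finite S \<longrightarrow> S \<subseteq> P \<longrightarrow> x \<in> K S"
    proof (rule directed_intersection)
      fix S :: "('a \<Rightarrow>\<^sub>L complex) set" assume S: "finite S" "S \<subseteq> P"
      then obtain x where x: "\<forall>\<psi>\<in>S. blinfun_apply \<psi> x = 0" "\<epsilon> * norm x < Re (blinfun_apply F x)"
        using no by (auto simp: not_le)
      have "x \<noteq> 0" using x by auto
      then have "(1 / norm x) *\<^sub>R x \<in> K S"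
        using x by (auto simp: K_def blinfun.scaleR_right field_simps)
      then show "K S \<noteq> {}" by blast
    next
      fix S x y assume "x \<in> K S" "y \<in> K S"
      then show "(1/2) *\<^sub>R (x + y) \<in> K S"
        using norm_triangle_ineq[of x y] by (auto simp: K_def blinfun.scaleR_right blinfun.add_right)
    next
      fix S x and y :: "nat \<Rightarrow> 'a"
      assume y: "\<And>n. y n \<in> K S" and x: "norm x \<le> 1" and lim: "(\<lambda>n. ip (y n - x) (y n - x)) \<longlonglongrightarrow> 0" and S: "S \<subseteq> P"
      have n2: "norm (y n - x) \<le> 2" for n
        using norm_triangle_ineq4[of "y n" x] y[of n] x by (simp add: K_def)
      have "(\<lambda>n. blinfun_apply F (y n - x)) \<longlonglongrightarrow> 0" by (rule cont[OF n2 lim])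
      then have "(\<lambda>n. Re (blinfun_apply F (y n - x)) + Re (blinfun_apply F x)) \<longlonglongrightarrow> Re 0 + Re (blinfun_apply F x)"
        by (intro tendsto_intros)
      then have "(\<lambda>n. Re (blinfun_apply F (y n))) \<longlonglongrightarrow> Re (blinfun_apply F x)"
        by (simp add: blinfun.diff_right)
      then have "\<epsilon> \<le> Re (blinfun_apply F x)"
        by (rule tendsto_lowerbound) (use y in \<open>auto simp: K_def\<close>)
      moreover have "blinfun_apply \<psi> x = 0" if "\<psi> \<in> S" for \<psi>
      proof -
        have "(\<lambda>n. blinfun_apply \<psi> (y n - x)) \<longlonglongrightarrow> 0"
          using that S by (intro predual_ip_continuous[OF _ n2 lim]) auto
        then have "(\<lambda>n::nat. - blinfun_apply \<psi> x) \<longlonglongrightarrow> 0"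
          using y that by (simp add: blinfun.diff_right K_def)
        then show ?thesis by (simp add: LIMSEQ_const_iff)
      qed
      ultimately show "x \<in> K S" using x by (auto simp: K_def)
    qed (auto simp: K_def)
    then obtain x where x: "\<And>S. finite S \<Longrightarrow> S \<subseteq> P \<Longrightarrow> x \<in> K S" by blast
    have "x = 0"
      by (rule predual_separates) (use x[of "{_}"] in \<open>auto simp: K_def\<close>)
    then show False using x[of "{}"] \<epsilon> by (simp add: K_def)
  qed
  have approx: "\<exists>\<psi>\<in>P. norm (F - \<psi>) \<le> \<epsilon>" if \<epsilon>: "0 < \<epsilon>" for \<epsilon>
  proof -
    obtain S where S: "finite S" "S \<subseteq> P" "\<And>x. (\<And>\<psi>. \<psi> \<in> S \<Longrightarrow> blinfun_apply \<psi> x = 0) \<Longrightarrow> Re (blinfun_apply F x) \<le> \<epsilon> * norm x"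
      using fin[OF \<epsilon>] by metis
    have "\<exists>\<psi>\<in>P. \<forall>x. cmod (blinfun_apply F x - blinfun_apply \<psi> x) \<le> \<epsilon> * norm x"
      using F \<epsilon> S by (intro approximable_mod_finite) (auto simp: blinfun.add_right dual_space_scaleC)
    then show ?thesis using \<epsilon> by (auto intro!: norm_blinfun_bound bexI simp: blinfun.diff_left)
  qed
  have "F \<in> closure P"
    unfolding closure_approachable
  proof (intro allI impI)
    fix e :: real assume "0 < e"
    then obtain \<psi> where "\<psi> \<in> P" "norm (F - \<psi>) \<le> e / 2" using approx[of "e / 2"] by auto
    then show "\<exists>\<psi>\<in>P. dist \<psi> F < e" using \<open>0 < e\<close> by (intro bexI[of _ \<psi>]) (auto simp: dist_norm norm_minus_commute)
  qed
  then show ?thesis using predual_closed by simp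
qed

end

section \<open>The predual as a module\<close>

text \<open>
  The module action of \<open>x\<close> on a functional \<open>\<psi>\<close>, which extends the product of the algebra along the
  embedding given by the trace (\<open>act_trace_embed\<close>).
\<close>

definition act :: "('a::jb_star_algebra \<Rightarrow>\<^sub>L complex) \<Rightarrow> 'a \<Rightarrow> ('a \<Rightarrow>\<^sub>L complex)"
  where "act \<psi> x = Blinfun (\<lambda>y. blinfun_apply \<psi> (x \<circ>\<^sub>J y))"

lemma act_apply [simp]: "blinfun_apply (act \<psi> x) y = blinfun_apply \<psi> (x \<circ>\<^sub>J y)"
  unfolding act_def
  by (subst bounded_linear_Blinfun_apply)
    (auto intro: bounded_linear_compose[OF blinfun.bounded_linear_right jordan.bounded_linear_right])

lemma norm_act: "norm (act \<psi> x) \<le> norm \<psi> * norm x"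
proof (rule norm_blinfun_bound)
  fix y
  have "norm (blinfun_apply \<psi> (x \<circ>\<^sub>J y)) \<le> norm \<psi> * norm (x \<circ>\<^sub>J y)" by (rule norm_blinfun)
  also have "\<dots> \<le> norm \<psi> * (norm x * norm y)" by (intro mult_left_mono norm_jordan) auto
  finally show "norm (blinfun_apply (act \<psi> x) y) \<le> norm \<psi> * norm x * norm y" by (simp add: mult.assoc)
qed auto

lemma
  shows act_add_left: "act (\<psi> + \<rho>) x = act \<psi> x + act \<rho> x"
    and act_diff_left: "act (\<psi> - \<rho>) x = act \<psi> x - act \<rho> x"
    and act_add_right: "act \<psi> (x + y) = act \<psi> x + act \<psi> y"
    and act_diff_right: "act \<psi> (x - y) = act \<psi> x - act \<psi> y"
    and act_scaleC_left: "act (c *\<^sub>C \<psi>) x = c *\<^sub>C act \<psi> x"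
  by (auto intro!: blinfun_eqI simp: blinfun.add_left blinfun.diff_left blinfun.add_right blinfun.diff_right
      jordan.add_left jordan.diff_left scaleC_blinfun_apply)

lemma act_scaleC_right: "\<psi> \<in> dual_space \<Longrightarrow> act \<psi> (c *\<^sub>C x) = c *\<^sub>C act \<psi> x"
  by (auto intro!: blinfun_eqI simp: scaleC_blinfun_apply jordan_scaleC dual_space_scaleC scaleC_complex_def)

context jbw_trace
begin

text \<open>
  Multiplication by a selfadjoint element is bounded for \<open>ip\<close>, so the functional remains
  continuous for \<open>ip\<close> on bounded sets.
\<close>

lemma predual_act:
  assumes \<psi>: "\<psi> \<in> P"
  shows "act \<psi> x \<in> P"
proof -
  have sa: "act \<psi> x \<in> P" if x: "selfadjoint x" for x
  proof (rule normality_criterion)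
    show "act \<psi> x \<in> dual_space"
      by (auto simp: dual_space_def jordan_scaleC_right predual_apply_scaleC[OF \<psi>])
    fix y :: "nat \<Rightarrow> 'a" assume y: "\<And>n. norm (y n) \<le> 2" and lim: "(\<lambda>n. ip (y n) (y n)) \<longlonglongrightarrow> 0"
    have "(\<lambda>n. blinfun_apply \<psi> (x \<circ>\<^sub>J y n)) \<longlonglongrightarrow> 0"
    proof (rule predual_ip_continuous[OF \<psi>])
      show "norm (x \<circ>\<^sub>J y n) \<le> norm x * 2" for n
        by (rule order_trans[OF norm_jordan mult_left_mono[OF y norm_ge_zero]])
      show "(\<lambda>n. ip (x \<circ>\<^sub>J y n) (x \<circ>\<^sub>J y n)) \<longlonglongrightarrow> 0"
      proof (rule Lim_null_comparison[OF _ tendsto_mult_right_zero[OF lim, of "(norm x)^2"]])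
        show "\<forall>\<^sub>F n in sequentially. norm (ip (x \<circ>\<^sub>J y n) (x \<circ>\<^sub>J y n)) \<le> (norm x)^2 * ip (y n) (y n)"
          using ip_jordan_bound(1)[OF x] ip_nonneg by simp
      qed
    qed
    then show "(\<lambda>n. blinfun_apply (act \<psi> x) (y n)) \<longlonglongrightarrow> 0" by simp
  qed
  have "act \<psi> x = act \<psi> (real_part x + \<i> *\<^sub>C imag_part x)" by (simp flip: real_imag_parts)
  also have "\<dots> = act \<psi> (real_part x) + \<i> *\<^sub>C act \<psi> (imag_part x)"
    using \<psi> predual_sub_dual by (auto simp: act_add_right act_scaleC_right)
  finally show ?thesis
    by (metis predual_add predual_scaleC sa selfadjoint_real_part selfadjoint_imag_part)
qed

lemma norm_trace_functional: "norm trace_functional \<le> 1"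
proof (rule norm_blinfun_bound)
  fix x
  have sa: "\<bar>Re (\<phi> a)\<bar> \<le> norm a" if "selfadjoint a" for a
    using ip_jordan_bound(2)[OF that, of 1] by (simp add: ip_def trace_one)
  define w where "w = \<phi> x"
  have "cmod w \<le> norm x"
  proof (cases "w = 0")
    case False
    define u where "u = cnj w / of_real (cmod w)"
    have u: "cmod u = 1" "u * w = of_real (cmod w)"
      using False by (auto simp: u_def norm_divide complex_norm_square[symmetric] power2_eq_square field_simps mult.commute)
    have "cmod w = Re (\<phi> (u *\<^sub>C x))" using u by (simp add: trace_scaleC w_def)
    also have "\<dots> = Re (\<phi> (real_part (u *\<^sub>C x)))"
      by (simp add: real_part_def linear_cmul[OF trace_linear] trace_add trace_star)
    also have "\<dots> \<le> norm (real_part (u *\<^sub>C x))" using sa[OF selfadjoint_real_part] by (simp add: abs_le_iff)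
    also have "\<dots> \<le> norm (u *\<^sub>C x)" by (rule norm_real_part)
    finally show ?thesis using u by (simp add: norm_scaleC)
  qed simp
  then show "norm (blinfun_apply trace_functional x) \<le> 1 * norm x" by (simp add: trace_functional w_def)
qed simp

lemma trace_embed_act: "trace_embed \<phi> x = act trace_functional x"
  by (simp add: trace_embed_def act_def trace_functional)

lemma trace_embed_apply [simp]: "blinfun_apply (trace_embed \<phi> x) y = \<phi> (x \<circ>\<^sub>J y)"
  by (simp add: trace_embed_act trace_functional)

lemma trace_embed_predual: "trace_embed \<phi> x \<in> P"
  unfolding trace_embed_act by (rule predual_act[OF trace_functional(1)])

lemma norm_trace_embed: "norm (trace_embed \<phi> x) \<le> norm x"
  unfolding trace_embed_act
  using order_trans[OF norm_act mult_right_mono[OF norm_trace_functional norm_ge_zero]] by simp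

lemma
  shows trace_embed_add: "trace_embed \<phi> (x + y) = trace_embed \<phi> x + trace_embed \<phi> y"
    and trace_embed_diff: "trace_embed \<phi> (x - y) = trace_embed \<phi> x - trace_embed \<phi> y"
    and trace_embed_scaleC: "trace_embed \<phi> (c *\<^sub>C x) = c *\<^sub>C trace_embed \<phi> x"
  using trace_functional(1) predual_sub_dual
  by (auto simp: trace_embed_act act_add_right act_diff_right act_scaleC_right)

lemma inj_trace_embed: "inj (trace_embed \<phi>)"
proof (rule injI)
  fix x y assume "trace_embed \<phi> x = trace_embed \<phi> y"
  then have "\<phi> ((x - y) \<circ>\<^sub>J star (x - y)) = 0"
    by (metis blinfun.zero_left cancel_comm_monoid_add_class.diff_cancel trace_embed_apply trace_embed_diff)
  then have "x - y = 0" by (intro ip_eq_0) (simp add: ip_def)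
  then show "x = y" by simp
qed

lemma act_trace_embed: "act (trace_embed \<phi> x) y = trace_embed \<phi> (x \<circ>\<^sub>J y)"
  by (rule blinfun_eqI) (simp add: trace_assoc)

lemma act_trace_embed_commute: "act (trace_embed \<phi> x) y = act (trace_embed \<phi> y) x"
  by (simp add: act_trace_embed jordan_commute)

end

section \<open>Holomorphic functions on the strip\<close>

definition strip :: "complex set" where "strip = {z. 0 \<le> Re z \<and> Re z \<le> 1}"
definition open_strip :: "complex set" where "open_strip = {z. 0 < Re z \<and> Re z < 1}"

lemma open_open_strip: "open open_strip"
proof -
  have "open_strip = {z. 0 < Re z} \<inter> {z. Re z < 1}" by (auto simp: open_strip_def)
  moreover have "open ({z. 0 < Re z} \<inter> {z. Re z < 1})"
    by (intro open_Int open_halfspace_Re_gt open_halfspace_Re_lt)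
  ultimately show ?thesis by (simp only:)
qed

lemma convex_strip: "convex strip"
proof -
  have "strip = Re -` {0..1}" by (auto simp: strip_def)
  then show ?thesis using convex_linear_vimage[of Re "{0..1}"] by (simp add: bounded_linear.linear bounded_linear_Re)
qed

lemma interior_strip_subset: "interior strip \<subseteq> open_strip"
proof
  fix z assume "z \<in> interior strip"
  then obtain e where e: "e > 0" "ball z e \<subseteq> strip" using mem_interior by blast
  have "z - of_real (e/2) \<in> ball z e" "z + of_real (e/2) \<in> ball z e" using e by (auto simp: dist_norm)
  then have "z - of_real (e/2) \<in> strip" "z + of_real (e/2) \<in> strip" using e by blast+
  then show "z \<in> open_strip" using e(1) by (auto simp: strip_def open_strip_def)
qed

lemma open_strip_subset: "open_strip \<subseteq> strip"
  by (auto simp: strip_def open_strip_def)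

text \<open>
  The factor \<open>exp (\<eta> z\<^sup>2)\<close> makes the function small at infinity, so that the maximum principle on large
  rectangles applies. Then \<open>\<eta>\<close> tends to zero.
\<close>

lemma strip_maximum_principle:
  fixes f :: "complex \<Rightarrow> complex"
  assumes cont: "continuous_on strip f" and hol: "f holomorphic_on open_strip"
    and bounded: "\<And>z. z \<in> strip \<Longrightarrow> cmod (f z) \<le> C"
    and left: "\<And>t. cmod (f (Complex 0 t)) \<le> A" and right: "\<And>t. cmod (f (Complex 1 t)) \<le> A"
    and z: "z \<in> strip"
  shows "cmod (f z) \<le> A"
proof -
  have A0: "0 \<le> A" using order_trans[OF norm_ge_zero left] .
  have C0: "0 \<le> C" using order_trans[OF norm_ge_zero bounded[OF z]] .
  define g where "g \<eta> w = exp (of_real \<eta> * w^2) * f w" for \<eta> w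
  have ng: "cmod (g \<eta> w) = exp (\<eta> * ((Re w)^2 - (Im w)^2)) * cmod (f w)" for \<eta> w
    by (simp add: g_def norm_mult power2_eq_square)
  have main: "exp (\<eta> * ((Re z)^2 - (Im z)^2)) * cmod (f z) \<le> exp \<eta> * (A + \<eta>)" if \<eta>: "0 < \<eta>" for \<eta>
  proof -
    have "((\<lambda>R::real. exp (\<eta> * (1 - R^2)) * C) \<longlongrightarrow> 0) at_top" using \<eta> by real_asymp
    then have "\<forall>\<^sub>F R in at_top. exp (\<eta> * (1 - R^2)) * C < exp \<eta> * (A + \<eta>)"
      using \<eta> A0 by (intro order_tendstoD(2)) auto
    then have "\<forall>\<^sub>F R in at_top. exp (\<eta> * (1 - R^2)) * C < exp \<eta> * (A + \<eta>) \<and> R \<ge> \<bar>Im z\<bar> + 1"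
      by (intro eventually_conj eventually_ge_at_top)
    then obtain R where R: "exp (\<eta> * (1 - R^2)) * C < exp \<eta> * (A + \<eta>)" "R \<ge> \<bar>Im z\<bar> + 1"
      by (auto dest: eventually_happens)
    define S where "S = cbox (Complex 0 (-R)) (Complex 1 R)"
    have S: "S \<subseteq> strip" by (auto simp: S_def strip_def in_cbox_complex_iff)
    have "cmod (g \<eta> z) \<le> exp \<eta> * (A + \<eta>)"
    proof (rule maximum_modulus_frontier[of "g \<eta>" S])
      have "interior S \<subseteq> open_strip" using interior_mono[OF S] interior_strip_subset by blast
      then have "f holomorphic_on interior S" using hol holomorphic_on_subset by blast
      then show "g \<eta> holomorphic_on interior S" unfolding g_def by (intro holomorphic_intros)
      have "continuous_on (closure S) f" using cont continuous_on_subset S by (auto simp: S_def)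
      then show "continuous_on (closure S) (g \<eta>)" unfolding g_def by (intro continuous_intros)
      show "bounded S" by (simp add: S_def bounded_cbox)
      show "z \<in> S" using z R(2) by (auto simp: S_def strip_def in_cbox_complex_iff)
      fix w assume w: "w \<in> frontier S"
      then have wS: "w \<in> S" "w \<notin> box (Complex 0 (-R)) (Complex 1 R)" by (auto simp: S_def frontier_cbox)
      then consider "Re w = 0" | "Re w = 1" | "\<bar>Im w\<bar> = R" by (auto simp: S_def in_cbox_complex_iff in_box_complex_iff)
      then show "cmod (g \<eta> w) \<le> exp \<eta> * (A + \<eta>)"
      proof cases
        case 3
        have "(Re w)^2 \<le> 1" using wS(1) by (auto simp: S_def in_cbox_complex_iff abs_square_le_1)
        moreover have "(Im w)^2 = R^2" using 3 by (metis power2_abs)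
        ultimately have "exp (\<eta> * ((Re w)^2 - (Im w)^2)) \<le> exp (\<eta> * (1 - R^2))" using \<eta> by simp
        then have "cmod (g \<eta> w) \<le> exp (\<eta> * (1 - R^2)) * C"
          unfolding ng using bounded wS(1) S by (intro mult_mono) auto
        then show ?thesis using R(1) by simp
      next
        case 1
        then have "cmod (f w) \<le> A + \<eta>" using left[of "Im w"] \<eta> by (metis add_increasing2 complex_surj less_imp_le)
        moreover have "\<eta> * ((Re w)^2 - (Im w)^2) \<le> \<eta> * 1"
          using 1 \<eta> by (intro mult_left_mono) (auto intro: order_trans[OF _ zero_le_power2])
        ultimately show ?thesis unfolding ng by (intro mult_mono) auto
      next
        case 2
        then have "cmod (f w) \<le> A + \<eta>" using right[of "Im w"] \<eta> by (metis add_increasing2 complex_surj less_imp_le)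
        moreover have "\<eta> * ((Re w)^2 - (Im w)^2) \<le> \<eta> * 1" using 2 \<eta> by (intro mult_left_mono) auto
        ultimately show ?thesis unfolding ng by (intro mult_mono) auto
      qed
    qed
    then show ?thesis by (simp add: ng)
  qed
  have "exp (0 * ((Re z)^2 - (Im z)^2)) * cmod (f z) \<le> exp 0 * (A + 0)"
  proof (rule tendsto_le)
    show "((\<lambda>\<eta>. exp \<eta> * (A + \<eta>)) \<longlongrightarrow> exp 0 * (A + 0)) (at_right 0)" by (intro tendsto_intros)
    show "((\<lambda>\<eta>. exp (\<eta> * ((Re z)^2 - (Im z)^2)) * cmod (f z)) \<longlongrightarrow> exp (0 * ((Re z)^2 - (Im z)^2)) * cmod (f z)) (at_right 0)"
      by (intro tendsto_intros)
    show "\<forall>\<^sub>F \<eta> in at_right 0. exp (\<eta> * ((Re z)^2 - (Im z)^2)) * cmod (f z) \<le> exp \<eta> * (A + \<eta>)"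
      unfolding eventually_at_right_field using main by (intro exI[of _ 1]) auto
  qed simp
  then show ?thesis by simp
qed

lemma difference_quotient:
  fixes h :: "complex \<Rightarrow> complex"
  assumes hol: "h holomorphic_on ball z r" and r: "0 < \<rho>" "\<rho> < r" and C: "\<And>w. w \<in> ball z r \<Longrightarrow> cmod (h w) \<le> C"
  defines "q \<equiv> \<lambda>w. if w = z then deriv h z else (h w - h z) / (w - z)"
  shows "q holomorphic_on ball z r" "\<And>w. w \<in> ball z \<rho> \<Longrightarrow> cmod (q w) \<le> 2 * C / \<rho>"
proof -
  have 1: "(\<lambda>w. if w = z then deriv h z else (\<lambda>w. h w / (w - z)) w - h z / (w - z)) holomorphic_on ball z r"
    by (rule pole_theorem_open[OF hol]) auto
  then show q: "q holomorphic_on ball z r"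
    by (rule holomorphic_transform) (simp add: q_def diff_divide_distrib)
  fix w assume w: "w \<in> ball z \<rho>"
  show "cmod (q w) \<le> 2 * C / \<rho>"
  proof (rule maximum_modulus_frontier[of q "ball z \<rho>"])
    show "q holomorphic_on interior (ball z \<rho>)" by (rule holomorphic_on_subset[OF q]) (use r in auto)
    have "cball z \<rho> \<subseteq> ball z r" using r by auto
    then show "continuous_on (closure (ball z \<rho>)) q"
      using holomorphic_on_imp_continuous_on[OF q] r continuous_on_subset by auto
    fix v assume "v \<in> frontier (ball z \<rho>)"
    then have v: "cmod (v - z) = \<rho>" using r by (simp add: dist_norm norm_minus_commute)
    have vb: "v \<in> ball z r" "z \<in> ball z r" using v r by (auto simp: dist_norm norm_minus_commute)
    have "cmod (h v - h z) \<le> 2 * C" using norm_triangle_ineq4[of "h v" "h z"] C[OF vb(1)] C[OF vb(2)] by linarith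
    then show "cmod (q v) \<le> 2 * C / \<rho>" using v r by (auto simp: q_def norm_divide divide_right_mono)
  qed (use w in auto)
qed

text \<open>
  The maximum principle is applied twice, to the difference quotient of \<open>h\<close> and to that of the
  difference quotient. The constants depend only on the bound of \<open>h\<close>, so
  the estimate is uniform over any family of functions with a common bound.
\<close>

lemma difference_quotient_error:
  fixes h :: "complex \<Rightarrow> complex"
  assumes hol: "h holomorphic_on ball z r" and r: "0 < r" and C: "\<And>w. w \<in> ball z r \<Longrightarrow> cmod (h w) \<le> C"
  shows "cmod (deriv h z) \<le> 4 * C / r"
    and "w \<in> ball z (r/4) \<Longrightarrow> w \<noteq> z \<Longrightarrow> cmod ((h w - h z) / (w - z) - deriv h z) \<le> (32 * C / r^2) * cmod (w - z)"
proof -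
  define q where "q = (\<lambda>w. if w = z then deriv h z else (h w - h z) / (w - z))"
  have q: "q holomorphic_on ball z r" "\<And>w. w \<in> ball z (r/2) \<Longrightarrow> cmod (q w) \<le> 4 * C / r"
    using difference_quotient[OF hol _ _ C, of "r/2"] r by (auto simp: q_def)
  have q': "q holomorphic_on ball z (r/2)" by (rule holomorphic_on_subset[OF q(1)]) (use r in auto)
  have qz: "q z = deriv h z" by (simp add: q_def)
  show "cmod (deriv h z) \<le> 4 * C / r" using q(2)[of z] r by (simp add: qz)
  assume w: "w \<in> ball z (r/4)" "w \<noteq> z"
  have "cmod ((q w - q z) / (w - z)) \<le> 2 * (4 * C / r) / (r/4)"
    using difference_quotient(2)[OF q' _ _ q(2), of "r/4" w] r w by simp
  then have "cmod (q w - q z) \<le> (2 * (4 * C / r) / (r/4)) * cmod (w - z)"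
    using w by (simp add: norm_divide divide_le_eq)
  then show "cmod ((h w - h z) / (w - z) - deriv h z) \<le> (32 * C / r^2) * cmod (w - z)"
    using w r by (simp add: q_def power2_eq_square)
qed

text \<open>
  Difference quotients of the scalar functions converge at a rate that is uniform on the unit
  ball, so those of \<open>F\<close> converge in norm.
\<close>

lemma weakly_holomorphic_imp_differentiable:
  fixes F :: "complex \<Rightarrow> ('a::complex_banach \<Rightarrow>\<^sub>L complex)"
  assumes hol: "\<And>y. (\<lambda>w. blinfun_apply (F w) y) holomorphic_on ball z r" and r: "0 < r"
    and C: "\<And>w. w \<in> ball z r \<Longrightarrow> norm (F w) \<le> C"
  shows "\<exists>D. ((\<lambda>w. norm (inverse (w - z) *\<^sub>C (F w - F z) - D)) \<longlongrightarrow> 0) (at z)"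
proof -
  define d where "d y = deriv (\<lambda>w. blinfun_apply (F w) y) z" for y
  have Cy: "cmod (blinfun_apply (F w) y) \<le> C * norm y" if "w \<in> ball z r" for w y
    using norm_blinfun[of "F w" y] mult_right_mono[OF C[OF that] norm_ge_zero[of y]] by linarith
  have der: "((\<lambda>w. blinfun_apply (F w) y) has_field_derivative d y) (at z)" for y
    unfolding d_def by (rule holomorphic_derivI[OF hol]) (use r in auto)
  have "bounded_linear d"
  proof (rule bounded_linear_intro)
    show "d (x + y) = d x + d y" for x y
      using DERIV_unique[OF der[of "x + y"]] DERIV_add[OF der[of x] der[of y]] by (simp add: blinfun.add_right)
    show "d (s *\<^sub>R x) = s *\<^sub>R d x" for s x
      using DERIV_unique[OF der[of "s *\<^sub>R x"]] DERIV_cmult[OF der[of x], of "of_real s"]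
      by (simp add: blinfun.scaleR_right scaleR_conv_of_real)
    show "cmod (d y) \<le> norm y * (4 * C / r)" for y
      using difference_quotient_error(1)[OF hol r Cy] by (simp add: d_def algebra_simps)
  qed
  then have D: "blinfun_apply (Blinfun d) = d" by (rule bounded_linear_Blinfun_apply)
  have est: "norm (inverse (w - z) *\<^sub>C (F w - F z) - Blinfun d) \<le> (32 * C / r^2) * cmod (w - z)"
    if w: "w \<in> ball z (r/4)" "w \<noteq> z" for w
  proof (rule norm_blinfun_bound)
    have "0 \<le> C" using order_trans[OF norm_ge_zero C[of z]] r by simp
    then show "0 \<le> (32 * C / r^2) * cmod (w - z)" by simp
    fix y
    have "norm (blinfun_apply (inverse (w - z) *\<^sub>C (F w - F z) - Blinfun d) y)
        = cmod ((blinfun_apply (F w) y - blinfun_apply (F z) y) / (w - z) - d y)"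
      by (simp add: D blinfun.diff_left scaleC_blinfun_apply scaleC_complex_def field_simps)
    also have "\<dots> \<le> (32 * (C * norm y) / r^2) * cmod (w - z)"
      unfolding d_def by (rule difference_quotient_error(2)[OF hol r Cy w])
    finally show "norm (blinfun_apply (inverse (w - z) *\<^sub>C (F w - F z) - Blinfun d) y) \<le> (32 * C / r^2) * cmod (w - z) * norm y"
      by (simp add: algebra_simps)
  qed
  show ?thesis
  proof (rule exI[of _ "Blinfun d"], rule tendsto_0_le)
    show "((\<lambda>w. w - z) \<longlongrightarrow> 0) (at z)" by (rule LIM_zero) (rule tendsto_ident_at)
    show "\<forall>\<^sub>F w in at z. norm (norm (inverse (w - z) *\<^sub>C (F w - F z) - Blinfun d)) \<le> norm (w - z) * (32 * C / r^2)"
      unfolding eventually_at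
    proof (intro exI[of _ "r/4"] conjI ballI impI)
      fix w assume "w \<noteq> z \<and> dist w z < r/4"
      then show "norm (norm (inverse (w - z) *\<^sub>C (F w - F z) - Blinfun d)) \<le> norm (w - z) * (32 * C / r^2)"
        using est[of w] by (simp add: dist_commute mult.commute[of "cmod (w - z)"])
    qed (use r in simp)
  qed
qed

section \<open>Gaussian averages\<close>

lemma normal_density_has_integral:
  assumes "0 < \<sigma>"
  shows "(normal_density u \<sigma> has_integral 1) UNIV"
    and "((\<lambda>t. normal_density u \<sigma> t * (t - u)^2) has_integral \<sigma>^2) UNIV"
proof -
  have hk: "(f has_integral c) UNIV" if "has_bochner_integral lborel f c" for f :: "real \<Rightarrow> real" and c
    using has_integral_integral_lborel[of f] that by (simp add: has_bochner_integral_iff)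
  show "(normal_density u \<sigma> has_integral 1) UNIV"
    using hk[OF normal_moment_even[OF assms, of u 0]] by simp
  show "((\<lambda>t. normal_density u \<sigma> t * (t - u)^2) has_integral \<sigma>^2) UNIV"
    using hk[OF normal_moment_even[OF assms, of u 1]] by (simp add: fact_2)
qed

text \<open>
  A quadratic modulus of continuity suits Gaussian averages: its average is the variance.
\<close>

lemma quadratic_modulus:
  fixes g :: "real \<Rightarrow> 'b::real_normed_vector"
  assumes cont: "continuous_on UNIV g" and lim: "(g \<longlongrightarrow> 0) at_infinity" and \<epsilon>: "0 < \<epsilon>"
  shows "\<exists>K T. 0 \<le> K \<and> (\<forall>t. T \<le> \<bar>t\<bar> \<longrightarrow> norm (g t) \<le> \<epsilon>) \<and> (\<forall>t u. norm (g t - g u) \<le> \<epsilon> + K * (t - u)^2)"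
proof -
  have "\<forall>\<^sub>F t in at_infinity. norm (g t) < \<epsilon> / 2" using tendstoD[OF lim, of "\<epsilon> / 2"] \<epsilon> by simp
  then obtain T where T: "\<And>t. T \<le> \<bar>t\<bar> \<Longrightarrow> norm (g t) < \<epsilon> / 2" by (auto simp: eventually_at_infinity)
  define I where "I = {- \<bar>T\<bar> - 1 .. \<bar>T\<bar> + 1}"
  have cI: "continuous_on I g" using cont continuous_on_subset by blast
  have "compact I" by (simp add: I_def)
  then have "uniformly_continuous_on I g" by (rule compact_uniformly_continuous[OF cI])
  then obtain d where d: "0 < d" "\<And>s t. s \<in> I \<Longrightarrow> t \<in> I \<Longrightarrow> dist t s < d \<Longrightarrow> dist (g t) (g s) < \<epsilon>"
    unfolding uniformly_continuous_on_def using \<epsilon> by metis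
  obtain C where C: "\<And>t. t \<in> I \<Longrightarrow> norm (g t) \<le> C"
    using compact_imp_bounded[OF compact_continuous_image[OF cI \<open>compact I\<close>]] by (auto simp: bounded_iff)
  define M where "M = max C \<epsilon>"
  have M: "norm (g t) \<le> M" for t
  proof (cases "t \<in> I")
    case False
    then have "T \<le> \<bar>t\<bar>" by (auto simp: I_def)
    then show ?thesis using T[of t] \<epsilon> by (simp add: M_def le_max_iff_disj)
  qed (use C[of t] in \<open>simp add: M_def le_max_iff_disj\<close>)
  define \<delta> where "\<delta> = min d 1"
  have \<delta>: "0 < \<delta>" "\<delta> \<le> d" "\<delta> \<le> 1" using d by (auto simp: \<delta>_def)
  define K where "K = 2 * M / \<delta>^2"
  have K0: "0 \<le> K" using order_trans[OF norm_ge_zero M[of 0]] by (simp add: K_def)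
  have "norm (g t - g u) \<le> \<epsilon> + K * (t - u)^2" for t u
  proof (cases "\<bar>t - u\<bar> < \<delta>")
    case True
    have "norm (g t - g u) \<le> \<epsilon>"
    proof (cases "t \<in> I \<and> u \<in> I")
      case True
      then show ?thesis using d(2)[of u t] \<open>\<bar>t - u\<bar> < \<delta>\<close> \<delta> by (auto simp: dist_norm)
    next
      case False
      then have "T \<le> \<bar>t\<bar>" "T \<le> \<bar>u\<bar>" using \<open>\<bar>t - u\<bar> < \<delta>\<close> \<delta> by (auto simp: I_def)
      then show ?thesis using T[of t] T[of u] norm_triangle_ineq4[of "g t" "g u"] by linarith
    qed
    then show ?thesis using K0 by (simp add: add_increasing2)
  next
    case False
    then have "\<delta>^2 \<le> (t - u)^2" using \<delta> by (metis abs_le_square_iff abs_of_pos not_less)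
    then have "K * \<delta>^2 \<le> K * (t - u)^2" by (rule mult_left_mono[OF _ K0])
    moreover have "K * \<delta>^2 = 2 * M" using \<delta> by (simp add: K_def)
    ultimately show ?thesis using norm_triangle_ineq4[of "g t" "g u"] M[of t] M[of u] \<epsilon> by linarith
  qed
  moreover have "norm (g t) \<le> \<epsilon>" if "T \<le> \<bar>t\<bar>" for t using T[OF that] \<epsilon> by simp
  ultimately have "0 \<le> K \<and> (\<forall>t. T \<le> \<bar>t\<bar> \<longrightarrow> norm (g t) \<le> \<epsilon>) \<and> (\<forall>t u. norm (g t - g u) \<le> \<epsilon> + K * (t - u)^2)"
    using K0 by blast
  then show ?thesis by (intro exI)
qed

text \<open>
  Only integrals over bounded intervals of functions with values in a Banach space occur. Outside
  the interval the value \<open>g u\<close> is compared with the small value \<open>g t\<close>, so both parts of the error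
  are bounded by the same scalar function \<open>q\<close>, whose integral over the line is known.
\<close>

lemma gaussian_average_approximates:
  fixes g :: "real \<Rightarrow> 'b::banach"
  assumes cont: "continuous_on UNIV g" and lim: "(g \<longlongrightarrow> 0) at_infinity" and \<epsilon>: "0 < \<epsilon>"
  shows "\<exists>\<sigma>\<^sub>0>0. \<exists>T. \<forall>\<sigma> R u. 0 < \<sigma> \<longrightarrow> \<sigma> \<le> \<sigma>\<^sub>0 \<longrightarrow> T \<le> R \<longrightarrow>
    norm (integral {-R..R} (\<lambda>t. normal_density u \<sigma> t *\<^sub>R g t) - g u) \<le> \<epsilon>"
proof -
  obtain K T where K: "0 \<le> K" and T: "\<And>t. T \<le> \<bar>t\<bar> \<Longrightarrow> norm (g t) \<le> \<epsilon> / 3"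
    and mod: "\<And>t u. norm (g t - g u) \<le> \<epsilon> / 3 + K * (t - u)^2"
    using quadratic_modulus[OF cont lim, of "\<epsilon> / 3"] \<epsilon> by auto
  \<comment> \<open>This choice gives \<open>K * \<sigma>\<^sup>2 \<le> \<epsilon> / 3\<close>.\<close>
  define \<sigma>\<^sub>0 where "\<sigma>\<^sub>0 = sqrt (\<epsilon> / (3 * (K + 1)))"
  have \<sigma>0: "0 < \<sigma>\<^sub>0" using \<epsilon> K by (simp add: \<sigma>\<^sub>0_def)
  have main: "norm (integral {-R..R} (\<lambda>t. normal_density u \<sigma> t *\<^sub>R g t) - g u) \<le> \<epsilon>"
    if \<sigma>: "0 < \<sigma>" "\<sigma> \<le> \<sigma>\<^sub>0" and R: "T \<le> R" for \<sigma> R u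
  proof -
    let ?N = "normal_density u \<sigma>" and ?I = "{-R..R}"
    have contN: "continuous_on A ?N" for A unfolding normal_density_def using \<sigma> by (intro continuous_intros) auto
    have N0: "0 \<le> ?N t" for t by (rule normal_density_nonneg)
    define q where "q t = ?N t * (2 * \<epsilon> / 3) + K * (?N t * (t - u)^2)" for t
    have q: "(q has_integral (1 * (2 * \<epsilon> / 3) + K * \<sigma>^2)) UNIV"
      unfolding q_def using normal_density_has_integral[OF \<sigma>(1), of u]
      by (intro has_integral_add has_integral_mult_left has_integral_mult_right)
    have contq: "continuous_on A q" for A unfolding q_def by (intro continuous_intros contN)
    have contg: "continuous_on A g" for A using cont continuous_on_subset by blast
    have int: "(\<lambda>t. ?N t *\<^sub>R g t) integrable_on ?I" "(\<lambda>t. ?N t *\<^sub>R g u) integrable_on ?I" "q integrable_on ?I" "?N integrable_on ?I"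
      by (intro integrable_continuous_real continuous_intros contN contg contq)+
    define m where "m = integral ?I ?N"
    have Nm: "(?N has_integral m) ?I" unfolding m_def using int by (simp add: integrable_integral)
    have b1: "norm (integral ?I (\<lambda>t. ?N t *\<^sub>R g t) - m *\<^sub>R g u) \<le> integral ?I q"
    proof -
      have "m *\<^sub>R g u = integral ?I (\<lambda>t. ?N t *\<^sub>R g u)"
        using has_integral_scaleR_left[OF Nm, of "g u"] by (simp add: integral_unique)
      then have "integral ?I (\<lambda>t. ?N t *\<^sub>R g t) - m *\<^sub>R g u = integral ?I (\<lambda>t. ?N t *\<^sub>R g t - ?N t *\<^sub>R g u)"
        using int by (simp add: integral_diff)
      also have "norm \<dots> \<le> integral ?I q"
      proof (rule integral_norm_bound_integral)
        show "(\<lambda>t. ?N t *\<^sub>R g t - ?N t *\<^sub>R g u) integrable_on ?I" using int by (intro integrable_diff)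
        fix t
        have "norm (?N t *\<^sub>R g t - ?N t *\<^sub>R g u) = ?N t * norm (g t - g u)"
          using N0[of t] by (simp flip: scaleR_diff_right)
        also have "\<dots> \<le> ?N t * (2 * \<epsilon> / 3 + K * (t - u)^2)"
          using mod[of t u] \<epsilon> by (intro mult_left_mono N0) auto
        finally show "norm (?N t *\<^sub>R g t - ?N t *\<^sub>R g u) \<le> q t" by (simp add: q_def algebra_simps)
      qed (use int in auto)
      finally show ?thesis .
    qed
    \<comment> \<open>The functions \<open>p\<close> and \<open>q\<close> agree on the interval; outside, \<open>p\<close> accounts for the truncation.\<close>
    define p where "p t = (if t \<in> ?I then q t - ?N t * norm (g u) else 0) + ?N t * norm (g u)" for t
    have p: "(p has_integral ((integral ?I q - m * norm (g u)) + 1 * norm (g u))) UNIV"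
      unfolding p_def
    proof (intro has_integral_add has_integral_mult_left normal_density_has_integral(1) \<sigma>(1))
      show "((\<lambda>t. if t \<in> ?I then q t - ?N t * norm (g u) else 0) has_integral integral ?I q - m * norm (g u)) UNIV"
        unfolding has_integral_restrict_UNIV
        using int by (intro has_integral_diff has_integral_mult_left Nm integrable_integral)
    qed
    have "p t \<le> q t" for t
    proof (cases "t \<in> ?I")
      case False
      then have "T \<le> \<bar>t\<bar>" using R by auto
      then have "norm (g t) \<le> \<epsilon> / 3" by (rule T)
      moreover have "norm (g u) \<le> norm (g t) + norm (g t - g u)"
        using norm_triangle_ineq4[of "g t" "g t - g u"] by simp
      ultimately have "norm (g u) \<le> 2 * \<epsilon> / 3 + K * (t - u)^2" using mod[of t u] by linarith
      then have "?N t * norm (g u) \<le> ?N t * (2 * \<epsilon> / 3 + K * (t - u)^2)" by (intro mult_left_mono N0)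
      then show ?thesis using False by (simp add: p_def q_def algebra_simps)
    qed (simp add: p_def)
    then have b2: "integral ?I q - m * norm (g u) + norm (g u) \<le> 2 * \<epsilon> / 3 + K * \<sigma>^2"
      using has_integral_le[OF p q] by simp
    have m1: "m \<le> 1"
      by (rule has_integral_subset_le[OF _ Nm normal_density_has_integral(1)[OF \<sigma>(1), of u]]) (use N0 in auto)
    have "K * \<sigma>^2 \<le> K * \<sigma>\<^sub>0^2" using \<sigma> K by (intro mult_left_mono power_mono) auto
    also have "\<dots> = K * \<epsilon> / (3 * (K + 1))" using \<epsilon> K by (simp add: \<sigma>\<^sub>0_def)
    also have "\<dots> \<le> \<epsilon> / 3" using \<epsilon> K by (simp add: field_simps)
    finally have b3: "K * \<sigma>^2 \<le> \<epsilon> / 3" .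
    have "norm (integral ?I (\<lambda>t. ?N t *\<^sub>R g t) - g u)
        \<le> norm (integral ?I (\<lambda>t. ?N t *\<^sub>R g t) - m *\<^sub>R g u) + norm ((1 - m) *\<^sub>R g u)"
      using norm_triangle_ineq4[of "integral ?I (\<lambda>t. ?N t *\<^sub>R g t) - m *\<^sub>R g u" "(1 - m) *\<^sub>R g u"]
      by (simp add: algebra_simps)
    also have "\<dots> \<le> integral ?I q + (1 - m) * norm (g u)" using b1 m1 by simp
    also have "\<dots> \<le> \<epsilon>" using b2 b3 by (simp add: algebra_simps)
    finally show ?thesis .
  qed
  show ?thesis
    using \<sigma>0 main by metis
qed

lemma strip_maximum_principle_dual:
  fixes f :: "complex \<Rightarrow> ('b::complex_banach \<Rightarrow>\<^sub>L complex)"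
  assumes cont: "continuous_on strip f" and hol: "\<And>y. (\<lambda>z. blinfun_apply (f z) y) holomorphic_on open_strip"
    and bounded: "\<And>z. z \<in> strip \<Longrightarrow> norm (f z) \<le> C"
    and left: "\<And>t. norm (f (Complex 0 t)) \<le> A" and right: "\<And>t. norm (f (Complex 1 t)) \<le> A"
    and z: "z \<in> strip"
  shows "norm (f z) \<le> A"
proof (rule norm_blinfun_bound)
  show "0 \<le> A" using order_trans[OF norm_ge_zero left] .
  fix y
  have le: "cmod (blinfun_apply \<psi> y) \<le> B * norm y" if "norm \<psi> \<le> B" for \<psi> :: "'b \<Rightarrow>\<^sub>L complex" and B
    using norm_blinfun[of \<psi> y] mult_right_mono[OF that norm_ge_zero[of y]] by linarith
  show "norm (blinfun_apply (f z) y) \<le> A * norm y"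
    by (rule strip_maximum_principle[OF _ hol _ _ _ z, of _ "C * norm y"])
      (intro continuous_intros cont le bounded left right, assumption?)+
qed

lemma norm_difference_quotient:
  fixes f :: "complex \<Rightarrow> 'b::complex_banach"
  assumes "w \<noteq> z"
  shows "norm (inverse (w - z) *\<^sub>C (f w - f z) - D) = norm (f w - f z - (w - z) *\<^sub>C D) / cmod (w - z)"
proof -
  have "inverse (w - z) *\<^sub>C (f w - f z) - D = inverse (w - z) *\<^sub>C (f w - f z - (w - z) *\<^sub>C D)"
    using assms by (simp add: scaleC.diff_right scaleC_scaleC)
  then show ?thesis by (simp add: norm_scaleC norm_inverse divide_inverse mult.commute)
qed

lemma complex_derivative_iff:
  fixes f :: "complex \<Rightarrow> 'b::complex_banach"
  shows "((\<lambda>w. norm (inverse (w - z) *\<^sub>C (f w - f z) - D)) \<longlongrightarrow> 0) (at z) \<longleftrightarrow> (f has_derivative (\<lambda>h. h *\<^sub>C D)) (at z)"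
proof -
  have "((\<lambda>w. norm (inverse (w - z) *\<^sub>C (f w - f z) - D)) \<longlongrightarrow> 0) (at z)
    \<longleftrightarrow> ((\<lambda>w. norm (f w - f z - (w - z) *\<^sub>C D) / norm (w - z)) \<longlongrightarrow> 0) (at z)"
    by (rule tendsto_cong) (auto simp: eventually_at_filter norm_difference_quotient)
  then show ?thesis
    by (simp add: has_derivative_iff_norm scaleC.bounded_linear_left)
qed

lemma tendsto_zero_at_infinity_bounded:
  fixes g :: "real \<Rightarrow> 'b::real_normed_vector"
  assumes cont: "continuous_on UNIV g" and lim: "(g \<longlongrightarrow> 0) at_infinity"
  shows "bdd_above (range (\<lambda>t. norm (g t)))"
proof -
  have "\<forall>\<^sub>F t in at_infinity. norm (g t) < 1" using tendstoD[OF lim, of 1] by simp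
  then obtain T where T: "\<And>t. T \<le> \<bar>t\<bar> \<Longrightarrow> norm (g t) < 1" by (auto simp: eventually_at_infinity)
  have "bounded (g ` {-\<bar>T\<bar>..\<bar>T\<bar>})"
    using cont by (intro compact_imp_bounded compact_continuous_image) (auto intro: continuous_on_subset)
  then obtain C where "\<forall>x\<in>g ` {-\<bar>T\<bar>..\<bar>T\<bar>}. norm x \<le> C" unfolding bounded_iff by blast
  then have C: "\<And>t. t \<in> {-\<bar>T\<bar>..\<bar>T\<bar>} \<Longrightarrow> norm (g t) \<le> C" by blast
  have "norm (g t) \<le> max C 1" for t
  proof (cases "t \<in> {-\<bar>T\<bar>..\<bar>T\<bar>}")
    case True
    then show ?thesis using C[OF True] by (simp add: le_max_iff_disj)
  next
    case False
    then have "T \<le> \<bar>t\<bar>" by auto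
    then show ?thesis using T[of t] by (simp add: le_max_iff_disj)
  qed
  then show ?thesis by (intro bdd_aboveI2[of _ _ "max C 1"])
qed

lemma Complex_in_strip [simp]: "Complex 0 t \<in> strip" "Complex 1 t \<in> strip"
  by (auto simp: strip_def)

context jbw_trace
begin

abbreviation E :: "'a \<Rightarrow> ('a \<Rightarrow>\<^sub>L complex)" where "E \<equiv> trace_embed \<phi>"
abbreviation Linf where "Linf \<equiv> Linfty_space \<phi>"
abbreviation L1 where "L1 \<equiv> L1_space P"

lemma inv_E [simp]: "inv E (E x) = x"
  by (rule inv_f_f[OF inj_trace_embed])

lemma elems_Linf: "elems Linf = range E" and nrm_Linf [simp]: "nrm Linf (E x) = norm x"
  by (simp_all add: Linfty_space_def)

lemma elems_L1 [simp]: "elems L1 = P" and nrm_L1 [simp]: "nrm L1 = norm"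
  by (simp_all add: L1_space_def)

lemma elems_sum [simp]: "elems (sum_space Linf L1) = P"
proof -
  have "E 0 = 0" using trace_embed_diff[of 0 0] by simp
  then have "0 \<in> range E" by (metis rangeI)
  then have "\<exists>a b. v = a + b \<and> a \<in> range E \<and> b \<in> P" if "v \<in> P" for v
    using that by (intro exI[of _ 0] exI[of _ v]) auto
  then show ?thesis using trace_embed_predual predual_add by (auto simp: sum_space_def elems_Linf)
qed

text \<open>
  The embedding of the algebra is contractive, so the decomposition with zero component in the algebra is optimal.
\<close>

lemma nrm_sum:
  assumes v: "v \<in> P"
  shows "nrm (sum_space Linf L1) v = norm v"
proof -
  let ?S = "{nrm Linf a + nrm L1 b |a b. a \<in> elems Linf \<and> b \<in> elems L1 \<and> v = a + b}"
  have E0: "E 0 = 0" using trace_embed_diff[of 0 0] by simp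
  have "Inf ?S = norm v"
  proof (rule cInf_eq_minimum)
    show "norm v \<in> ?S"
      unfolding mem_Collect_eq
    proof (rule exI[of _ "E 0"], rule exI[of _ v], intro conjI)
      show "norm v = nrm Linf (E 0) + nrm L1 v" by simp
      show "v = E 0 + v" by (simp add: E0)
    qed (use v in \<open>simp_all add: elems_Linf\<close>)
    fix s assume "s \<in> ?S"
    then obtain x b where s: "s = norm x + norm b" and v': "v = E x + b" by (auto simp: elems_Linf)
    show "norm v \<le> s" using norm_triangle_ineq[of "E x" b] norm_trace_embed[of x] by (simp add: s v')
  qed
  then show ?thesis by (simp add: sum_space_def)
qed

section \<open>Admissible functions and the interpolation norm\<close>

text \<open>
  The members \<open>f\<close> of Calderon's space for the couple \<open>(Linf, L1)\<close> with norm at most \<open>A\<close>, where \<open>g\<close> is the boundary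
  function on the left with values in the algebra. Holomorphy is required only weakly, which makes the condition
  stable under limits; it implies norm differentiability since \<open>f\<close> is bounded.
\<close>

definition admissible :: "(complex \<Rightarrow> ('a \<Rightarrow>\<^sub>L complex)) \<Rightarrow> (real \<Rightarrow> 'a) \<Rightarrow> real \<Rightarrow> bool"
  where "admissible f g A \<longleftrightarrow>
    (\<forall>z\<in>strip. f z \<in> P) \<and> continuous_on strip f \<and>
    (\<forall>y. (\<lambda>z. blinfun_apply (f z) y) holomorphic_on open_strip) \<and>
    (\<forall>z\<in>strip. norm (f z) \<le> A) \<and>
    (\<forall>t. f (Complex 0 t) = E (g t)) \<and> continuous_on UNIV g \<and> (g \<longlongrightarrow> 0) at_infinity \<and>
    (\<forall>t. norm (g t) \<le> A) \<and> ((\<lambda>t. f (Complex 1 t)) \<longlongrightarrow> 0) at_infinity"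

lemma admissibleD:
  assumes "admissible f g A"
  shows "z \<in> strip \<Longrightarrow> f z \<in> P" "continuous_on strip f" "(\<lambda>z. blinfun_apply (f z) y) holomorphic_on open_strip"
    "z \<in> strip \<Longrightarrow> norm (f z) \<le> A" "f (Complex 0 t) = E (g t)" "continuous_on UNIV g" "(g \<longlongrightarrow> 0) at_infinity"
    "norm (g t) \<le> A" "((\<lambda>t. f (Complex 1 t)) \<longlongrightarrow> 0) at_infinity"
  using assms by (auto simp: admissible_def)

lemma admissible_derivative:
  assumes f: "admissible f g A" and z: "z \<in> open_strip"
  shows "\<exists>D\<in>P. (f has_derivative (\<lambda>h. h *\<^sub>C D)) (at z)"
proof -
  obtain r where r: "0 < r" "ball z r \<subseteq> open_strip"
    using open_open_strip z open_contains_ball by blast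
  have "\<exists>D. ((\<lambda>w. norm (inverse (w - z) *\<^sub>C (f w - f z) - D)) \<longlongrightarrow> 0) (at z)"
    using r open_strip_subset
    by (intro weakly_holomorphic_imp_differentiable[of f z r A] holomorphic_on_subset[OF admissibleD(3)[OF f]] admissibleD(4)[OF f]) auto
  then obtain D where D: "((\<lambda>w. norm (inverse (w - z) *\<^sub>C (f w - f z) - D)) \<longlongrightarrow> 0) (at z)" by blast
  then have lim: "((\<lambda>w. inverse (w - z) *\<^sub>C (f w - f z)) \<longlongrightarrow> D) (at z)"
    by (simp add: tendsto_norm_zero_iff LIM_zero_iff)
  have "\<forall>\<^sub>F w in at z. w \<in> open_strip"
    using open_open_strip z by (intro eventually_at_in_open') auto
  then have "\<forall>\<^sub>F w in at z. inverse (w - z) *\<^sub>C (f w - f z) \<in> P"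
    by (rule eventually_mono) (use z open_strip_subset in \<open>auto intro!: predual_scaleC predual_diff admissibleD(1)[OF f]\<close>)
  then have "D \<in> P" by (rule Lim_in_closed_set[OF predual_closed _ _ lim]) simp
  then show ?thesis using D unfolding complex_derivative_iff by blast
qed

lemma admissible_imp_calderon:
  assumes f: "admissible f g A"
  shows "f \<in> calderon_space Linf L1" "calderon_norm Linf L1 f \<le> A"
proof -
  have cont: "((\<lambda>t. norm (f t - f s)) \<longlongrightarrow> 0) (at s within strip)" if "s \<in> strip" for s
    using admissibleD(2)[OF f] that by (simp add: continuous_on_def tendsto_norm_zero_iff LIM_zero_iff)
  have sumn: "nrm (sum_space Linf L1) (f t - f s) = norm (f t - f s)" if "s \<in> strip" "t \<in> strip" for s t
    using that by (intro nrm_sum predual_diff admissibleD(1)[OF f])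
  have g: "f (Complex 0 t) = E (g t)" for t by (rule admissibleD(5)[OF f])
  have gd: "nrm Linf (f (Complex 0 t) - f (Complex 0 s)) = norm (g t - g s)" for s t
    by (simp add: g flip: trace_embed_diff)
  show "f \<in> calderon_space Linf L1"
    unfolding calderon_space_def mem_Collect_eq
  proof (intro conjI)
    show "maps_continuously (sum_space Linf L1) {z. 0 \<le> Re z \<and> Re z \<le> 1} f"
      unfolding maps_continuously_def strip_def[symmetric]
    proof (intro conjI ballI)
      fix s assume s: "s \<in> strip"
      show "f s \<in> elems (sum_space Linf L1)" using s admissibleD(1)[OF f] by simp
      have "\<forall>\<^sub>F t in at s within strip. nrm (sum_space Linf L1) (f t - f s) = norm (f t - f s)"
        using sumn s by (auto simp: eventually_at_filter)
      then show "((\<lambda>t. nrm (sum_space Linf L1) (f t - f s)) \<longlongrightarrow> 0) (at s within strip)"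
        using cont[OF s] by (simp add: tendsto_cong)
    qed
    show "\<exists>C. \<forall>z. 0 \<le> Re z \<and> Re z \<le> 1 \<longrightarrow> nrm (sum_space Linf L1) (f z) \<le> C"
      using admissibleD(1,4)[OF f] by (auto simp: strip_def nrm_sum intro!: exI[of _ A])
    show "\<forall>z. 0 < Re z \<and> Re z < 1 \<longrightarrow> (\<exists>D\<in>elems (sum_space Linf L1).
        ((\<lambda>w. nrm (sum_space Linf L1) (inverse (w - z) *\<^sub>C (f w - f z) - D)) \<longlongrightarrow> 0) (at z))"
    proof (intro allI impI)
      fix z assume "0 < Re z \<and> Re z < 1"
      then have z: "z \<in> open_strip" by (simp add: open_strip_def)
      obtain D where D: "D \<in> P" "((\<lambda>w. norm (inverse (w - z) *\<^sub>C (f w - f z) - D)) \<longlongrightarrow> 0) (at z)"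
        using admissible_derivative[OF f z] unfolding complex_derivative_iff by blast
      have "\<forall>\<^sub>F w in at z. w \<in> open_strip"
        using open_open_strip z by (intro eventually_at_in_open') auto
      then have "\<forall>\<^sub>F w in at z. nrm (sum_space Linf L1) (inverse (w - z) *\<^sub>C (f w - f z) - D)
          = norm (inverse (w - z) *\<^sub>C (f w - f z) - D)"
        by (rule eventually_mono)
          (use z open_strip_subset D(1) in \<open>auto intro!: nrm_sum predual_scaleC predual_diff admissibleD(1)[OF f]\<close>)
      then show "\<exists>D\<in>elems (sum_space Linf L1).
        ((\<lambda>w. nrm (sum_space Linf L1) (inverse (w - z) *\<^sub>C (f w - f z) - D)) \<longlongrightarrow> 0) (at z)"
        using D by (intro bexI[of _ D]) (simp_all add: tendsto_cong)
    qed
    have gc: "(g \<longlongrightarrow> g s) (at s)" for s using admissibleD(6)[OF f] by (simp add: continuous_on_def)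
    show "maps_continuously Linf UNIV (\<lambda>t. f (Complex 0 t))"
      unfolding maps_continuously_def gd using gc
      by (simp add: elems_Linf g tendsto_norm_zero_iff LIM_zero_iff)
    show "((\<lambda>t. nrm Linf (f (Complex 0 t))) \<longlongrightarrow> 0) at_infinity"
      using admissibleD(7)[OF f] by (simp add: g tendsto_norm_zero_iff)
    show "maps_continuously L1 UNIV (\<lambda>t. f (Complex 1 t))"
      unfolding maps_continuously_def
    proof (intro conjI ballI)
      fix s :: real
      show "f (Complex 1 s) \<in> elems L1" using admissibleD(1)[OF f] by simp
      have "continuous_on UNIV (\<lambda>t. f (Complex 1 t))"
        by (rule continuous_on_compose2[OF admissibleD(2)[OF f]])
          (auto simp: complex_of_real_def[symmetric] Complex_eq intro!: continuous_intros simp flip: Complex_eq)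
      then show "((\<lambda>t. nrm L1 (f (Complex 1 t) - f (Complex 1 s))) \<longlongrightarrow> 0) (at s)"
        by (simp add: continuous_on_def tendsto_norm_zero_iff LIM_zero_iff)
    qed
    show "((\<lambda>t. nrm L1 (f (Complex 1 t))) \<longlongrightarrow> 0) at_infinity"
      using admissibleD(9)[OF f] by (simp add: tendsto_norm_zero_iff)
  qed
  show "calderon_norm Linf L1 f \<le> A"
    unfolding calderon_norm_def
    by (intro max.boundedI cSUP_least) (auto simp: g admissibleD(8)[OF f] admissibleD(4)[OF f])
qed

text \<open>
  By the maximum principle the bounds on the two boundary lines hold on the strip.
\<close>

lemma calderon_imp_admissible:
  assumes f: "f \<in> calderon_space Linf L1"
  shows "\<exists>g. admissible f g (calderon_norm Linf L1 f)"
proof -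
  let ?N = "nrm (sum_space Linf L1)"
  have P: "f z \<in> P" if "z \<in> strip" for z
    using f that by (auto simp: calderon_space_def maps_continuously_def strip_def)
  have cont: "continuous_on strip f"
    unfolding continuous_on_def
  proof
    fix s assume s: "s \<in> strip"
    have "((\<lambda>t. ?N (f t - f s)) \<longlongrightarrow> 0) (at s within strip)"
      using f s by (auto simp: calderon_space_def maps_continuously_def strip_def)
    moreover have "\<forall>\<^sub>F t in at s within strip. ?N (f t - f s) = norm (f t - f s)"
      unfolding eventually_at_filter
      by (rule always_eventually) (use s P in \<open>auto intro!: nrm_sum predual_diff\<close>)
    ultimately have "((\<lambda>t. norm (f t - f s)) \<longlongrightarrow> 0) (at s within strip)" by (simp add: tendsto_cong)
    then show "(f \<longlongrightarrow> f s) (at s within strip)" by (simp add: tendsto_norm_zero_iff LIM_zero_iff)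
  qed
  obtain C where C: "\<And>z. z \<in> strip \<Longrightarrow> ?N (f z) \<le> C"
    using f by (auto simp: calderon_space_def strip_def)
  have hol: "(\<lambda>z. blinfun_apply (f z) y) holomorphic_on open_strip" for y
  proof (rule holomorphic_onI)
    fix z assume z: "z \<in> open_strip"
    then obtain D where D: "D \<in> P" "((\<lambda>w. ?N (inverse (w - z) *\<^sub>C (f w - f z) - D)) \<longlongrightarrow> 0) (at z)"
      using f by (auto simp: calderon_space_def open_strip_def)
    have "\<forall>\<^sub>F w in at z. w \<in> open_strip"
      using open_open_strip z by (intro eventually_at_in_open') auto
    then have "\<forall>\<^sub>F w in at z. ?N (inverse (w - z) *\<^sub>C (f w - f z) - D) = norm (inverse (w - z) *\<^sub>C (f w - f z) - D)"
      by (rule eventually_mono)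
        (use z open_strip_subset D(1) P in \<open>auto intro!: nrm_sum predual_scaleC predual_diff\<close>)
    then have "((\<lambda>w. norm (inverse (w - z) *\<^sub>C (f w - f z) - D)) \<longlongrightarrow> 0) (at z)"
      using D(2) by (simp add: tendsto_cong)
    then have lim: "((\<lambda>w. inverse (w - z) *\<^sub>C (f w - f z)) \<longlongrightarrow> D) (at z)"
      by (simp add: tendsto_norm_zero_iff LIM_zero_iff)
    have "((\<lambda>w. blinfun_apply (inverse (w - z) *\<^sub>C (f w - f z)) y) \<longlongrightarrow> blinfun_apply D y) (at z)"
      by (intro tendsto_intros lim)
    then have "((\<lambda>w. blinfun_apply (f w) y) has_field_derivative blinfun_apply D y) (at z)"
      by (simp add: has_field_derivative_iff scaleC_blinfun_apply scaleC_complex_def blinfun.diff_left divide_inverse mult.commute)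
    then show "(\<lambda>z. blinfun_apply (f z) y) field_differentiable at z within open_strip"
      by (auto simp: field_differentiable_def intro: has_field_derivative_at_within)
  qed
  define g where "g t = inv E (f (Complex 0 t))" for t
  have "f (Complex 0 t) \<in> range E" for t
    using f by (auto simp: calderon_space_def maps_continuously_def elems_Linf)
  then have g: "f (Complex 0 t) = E (g t)" for t by (simp add: g_def f_inv_into_f)
  have gd: "nrm Linf (f (Complex 0 t) - f (Complex 0 s)) = norm (g t - g s)" for s t
    by (simp add: g flip: trace_embed_diff)
  have "((\<lambda>t. norm (g t - g s)) \<longlongrightarrow> 0) (at s)" for s
    using f by (auto simp: calderon_space_def maps_continuously_def gd)
  then have gcont: "continuous_on UNIV g"
    by (simp add: continuous_on_def tendsto_norm_zero_iff LIM_zero_iff)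
  have "((\<lambda>t. norm (g t)) \<longlongrightarrow> 0) at_infinity"
    using f by (auto simp: calderon_space_def g)
  then have glim: "(g \<longlongrightarrow> 0) at_infinity" by (simp add: tendsto_norm_zero_iff)
  have "((\<lambda>t. norm (f (Complex 1 t))) \<longlongrightarrow> 0) at_infinity"
    using f by (auto simp: calderon_space_def)
  then have f1lim: "((\<lambda>t. f (Complex 1 t)) \<longlongrightarrow> 0) at_infinity" by (simp add: tendsto_norm_zero_iff)
  have f1cont: "continuous_on UNIV (\<lambda>t. f (Complex 1 t))"
    by (rule continuous_on_compose2[OF cont])
      (auto simp: complex_of_real_def[symmetric] Complex_eq intro!: continuous_intros simp flip: Complex_eq)
  define A where "A = calderon_norm Linf L1 f"
  have gA: "norm (g t) \<le> A" for t
  proof -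
    have "norm (g t) \<le> (SUP t. norm (g t))"
      by (rule cSUP_upper[OF _ tendsto_zero_at_infinity_bounded[OF gcont glim]]) simp
    then show ?thesis by (simp add: A_def calderon_norm_def g le_max_iff_disj)
  qed
  have f1A: "norm (f (Complex 1 t)) \<le> A" for t
  proof -
    have "norm (f (Complex 1 t)) \<le> (SUP t. norm (f (Complex 1 t)))"
      by (rule cSUP_upper[OF _ tendsto_zero_at_infinity_bounded[OF f1cont f1lim]]) simp
    then show ?thesis by (simp add: A_def calderon_norm_def le_max_iff_disj)
  qed
  have "norm (f z) \<le> A" if z: "z \<in> strip" for z
  proof (rule strip_maximum_principle_dual[OF cont hol _ _ f1A z])
    show "norm (f z) \<le> C" if "z \<in> strip" for z using C[OF that] nrm_sum[OF P[OF that]] by simp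
    show "norm (f (Complex 0 t)) \<le> A" for t using norm_trace_embed[of "g t"] gA[of t] by (simp add: g)
  qed
  then have "admissible f g A" using P cont hol g gcont glim gA f1lim by (auto simp: admissible_def)
  then show ?thesis by (auto simp: A_def)
qed

lemma admissible_add:
  assumes "admissible f g A" "admissible f' g' A'"
  shows "admissible (\<lambda>z. f z + f' z) (\<lambda>t. g t + g' t) (A + A')"
  unfolding admissible_def
proof (intro conjI ballI allI)
  show "((\<lambda>t. g t + g' t) \<longlongrightarrow> 0) at_infinity"
    using tendsto_add[OF admissibleD(7)[OF assms(1)] admissibleD(7)[OF assms(2)]] by simp
  show "((\<lambda>t. f (Complex 1 t) + f' (Complex 1 t)) \<longlongrightarrow> 0) at_infinity"
    using tendsto_add[OF admissibleD(9)[OF assms(1)] admissibleD(9)[OF assms(2)]] by simp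
  show "norm (f z + f' z) \<le> A + A'" if "z \<in> strip" for z
    using norm_triangle_ineq[of "f z" "f' z"] admissibleD(4)[OF assms(1) that] admissibleD(4)[OF assms(2) that] by linarith
  show "norm (g t + g' t) \<le> A + A'" for t
    using norm_triangle_ineq[of "g t" "g' t"] admissibleD(8)[OF assms(1), of t] admissibleD(8)[OF assms(2), of t] by linarith
  show "(\<lambda>z. blinfun_apply (f z + f' z) y) holomorphic_on open_strip" for y
    unfolding blinfun.add_left by (intro holomorphic_intros admissibleD(3)[OF assms(1)] admissibleD(3)[OF assms(2)])
  show "continuous_on strip (\<lambda>z. f z + f' z)" "continuous_on UNIV (\<lambda>t. g t + g' t)"
    by (intro continuous_intros admissibleD(2)[OF assms(1)] admissibleD(2)[OF assms(2)] admissibleD(6)[OF assms(1)] admissibleD(6)[OF assms(2)])+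
qed (auto simp: admissibleD(5)[OF assms(1)] admissibleD(5)[OF assms(2)] trace_embed_add intro!: predual_add admissibleD(1)[OF assms(1)] admissibleD(1)[OF assms(2)])

lemma admissible_scaleC:
  assumes f: "admissible f g A"
  shows "admissible (\<lambda>z. c *\<^sub>C f z) (\<lambda>t. c *\<^sub>C g t) (cmod c * A)"
  unfolding admissible_def
proof (intro conjI ballI allI)
  show "((\<lambda>t. c *\<^sub>C g t) \<longlongrightarrow> 0) at_infinity"
    by (rule scaleC.tendsto_right_zero[OF admissibleD(7)[OF f]])
  show "((\<lambda>t. c *\<^sub>C f (Complex 1 t)) \<longlongrightarrow> 0) at_infinity"
    by (rule scaleC.tendsto_right_zero[OF admissibleD(9)[OF f]])
  show "(\<lambda>z. blinfun_apply (c *\<^sub>C f z) y) holomorphic_on open_strip" for y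
    unfolding scaleC_blinfun_apply scaleC_complex_def by (intro holomorphic_intros admissibleD(3)[OF f])
  show "continuous_on strip (\<lambda>z. c *\<^sub>C f z)" "continuous_on UNIV (\<lambda>t. c *\<^sub>C g t)"
    by (intro scaleC.continuous_on continuous_intros admissibleD(2)[OF f] admissibleD(6)[OF f])+
qed (auto simp: admissibleD(5)[OF f] trace_embed_scaleC norm_scaleC intro!: predual_scaleC admissibleD(1)[OF f] mult_left_mono admissibleD(4)[OF f] admissibleD(8)[OF f])

lemma admissible_diff:
  assumes "admissible f g A" "admissible f' g' A'"
  shows "admissible (\<lambda>z. f z - f' z) (\<lambda>t. g t - g' t) (A + A')"
  using admissible_add[OF assms(1) admissible_scaleC[OF assms(2), of "-1"]] by (simp add: scaleC.minus_left)

lemma admissible_act: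
  assumes f: "admissible f g A"
  shows "admissible (\<lambda>z. act (f z) x) (\<lambda>t. g t \<circ>\<^sub>J x) (A * norm x)"
proof -
  have bl: "bounded_linear (\<lambda>\<psi>::'a \<Rightarrow>\<^sub>L complex. act \<psi> x)"
  proof (rule bounded_linear_intro[where K = "norm x"])
    show "act (r *\<^sub>R \<psi>) x = r *\<^sub>R act \<psi> x" for r and \<psi> :: "'a \<Rightarrow>\<^sub>L complex"
      by (rule blinfun_eqI) (simp add: blinfun.scaleR_left)
  qed (auto simp: act_add_left norm_act)
  have A0: "0 \<le> A" using order_trans[OF norm_ge_zero admissibleD(8)[OF f]] .
  show ?thesis
    unfolding admissible_def
  proof (intro conjI ballI allI)
    show "((\<lambda>t. g t \<circ>\<^sub>J x) \<longlongrightarrow> 0) at_infinity"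
      by (rule jordan.tendsto_left_zero[OF admissibleD(7)[OF f]])
    show "((\<lambda>t. act (f (Complex 1 t)) x) \<longlongrightarrow> 0) at_infinity"
      using bounded_linear.tendsto[OF bl admissibleD(9)[OF f]] linear_0[OF bounded_linear.linear[OF bl]] by simp
    show "(\<lambda>z. blinfun_apply (act (f z) x) y) holomorphic_on open_strip" for y
      unfolding act_apply by (rule admissibleD(3)[OF f])
    show "continuous_on strip (\<lambda>z. act (f z) x)" by (rule bounded_linear.continuous_on[OF bl admissibleD(2)[OF f]])
    show "continuous_on UNIV (\<lambda>t. g t \<circ>\<^sub>J x)" by (intro jordan.continuous_on continuous_intros admissibleD(6)[OF f])
    show "norm (act (f z) x) \<le> A * norm x" if "z \<in> strip" for z
      by (rule order_trans[OF norm_act mult_right_mono[OF admissibleD(4)[OF f that] norm_ge_zero]])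
    show "norm (g t \<circ>\<^sub>J x) \<le> A * norm x" for t
      by (rule order_trans[OF norm_jordan mult_right_mono[OF admissibleD(8)[OF f] norm_ge_zero]])
    show "act (f (Complex 0 t)) x = E (g t \<circ>\<^sub>J x)" for t by (simp add: admissibleD(5)[OF f] act_trace_embed)
  qed (auto intro!: predual_act admissibleD(1)[OF f])
qed

text \<open>
  A witness that the interpolation norm of \<open>h\<close> is at most \<open>A\<close>. Carrying the bound explicitly
  avoids infima until the end.
\<close>

definition interp_le :: "real \<Rightarrow> ('a \<Rightarrow>\<^sub>L complex) \<Rightarrow> real \<Rightarrow> bool"
  where "interp_le \<theta> h A \<longleftrightarrow> (\<exists>f g. admissible f g A \<and> f (of_real \<theta>) = h)"

lemma admissible_mono: "admissible f g A \<Longrightarrow> A \<le> A' \<Longrightarrow> admissible f g A'"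
  by (force simp: admissible_def intro: order_trans)

lemma interp_elems: "h \<in> elems (complex_interpolation \<theta> Linf L1) \<longleftrightarrow> (\<exists>A. interp_le \<theta> h A)"
  using calderon_imp_admissible admissible_imp_calderon(1) unfolding complex_interpolation_def interp_le_def by fastforce

lemma interp_bdd_below: "bdd_below {calderon_norm Linf L1 F | F. F \<in> calderon_space Linf L1 \<and> F (of_real \<theta>) = v}"
proof (rule bdd_belowI[of _ 0])
  fix s assume "s \<in> {calderon_norm Linf L1 F | F. F \<in> calderon_space Linf L1 \<and> F (of_real \<theta>) = v}"
  then obtain F where F: "s = calderon_norm Linf L1 F" "F \<in> calderon_space Linf L1" by blast
  then obtain g where "admissible F g s" using calderon_imp_admissible by blast
  from order_trans[OF norm_ge_zero admissibleD(8)[OF this]] show "0 \<le> s" .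
qed

lemma nrm_interp_le: "interp_le \<theta> h A \<Longrightarrow> nrm (complex_interpolation \<theta> Linf L1) h \<le> A"
  unfolding interp_le_def complex_interpolation_def
  using admissible_imp_calderon by (auto intro!: cInf_lower2[OF _ _ interp_bdd_below])

lemma interp_approx:
  assumes h: "h \<in> elems (complex_interpolation \<theta> Linf L1)" and \<epsilon>: "0 < \<epsilon>"
  shows "interp_le \<theta> h (nrm (complex_interpolation \<theta> Linf L1) h + \<epsilon>)"
proof -
  let ?S = "{calderon_norm Linf L1 F | F. F \<in> calderon_space Linf L1 \<and> F (of_real \<theta>) = h}"
  have "?S \<noteq> {}" using h by (auto simp: complex_interpolation_def)
  moreover have "Inf ?S < nrm (complex_interpolation \<theta> Linf L1) h + \<epsilon>"
    using \<epsilon> by (simp add: complex_interpolation_def)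
  ultimately obtain s where "s \<in> ?S" "s < nrm (complex_interpolation \<theta> Linf L1) h + \<epsilon>"
    using cInf_less_iff[OF _ interp_bdd_below] by blast
  then obtain F where F: "F \<in> calderon_space Linf L1" "F (of_real \<theta>) = h"
    "calderon_norm Linf L1 F \<le> nrm (complex_interpolation \<theta> Linf L1) h + \<epsilon>" by auto
  then obtain g where "admissible F g (calderon_norm Linf L1 F)" using calderon_imp_admissible by blast
  then show ?thesis using F admissible_mono unfolding interp_le_def by blast
qed

end

section \<open>Approximation by entire functions with values in the algebra\<close>

text \<open>
  The integrand has a primitive on the closed strip, so the integrals over the vertical sides of a
  rectangle differ by those over the horizontal sides, each of length \<open>1\<close>.
\<close>

lemma contour_shift_strip:
  fixes G :: "complex \<Rightarrow> complex"
  assumes cont: "continuous_on strip G" and hol: "G holomorphic_on open_strip" and R: "0 \<le> R"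
    and B: "\<And>z. z \<in> strip \<Longrightarrow> \<bar>Im z\<bar> = R \<Longrightarrow> cmod (G z) \<le> B"
  shows "cmod (integral {-R..R} (\<lambda>t. G (Complex 0 t)) - integral {-R..R} (\<lambda>t. G (Complex 1 t))) \<le> 2 * B"
proof -
  have fd: "G field_differentiable at x" if "x \<in> interior strip - {}" for x
    using that interior_strip_subset hol open_open_strip holomorphic_on_imp_differentiable_at by blast
  obtain \<Phi> where \<Phi>: "\<And>z. z \<in> strip \<Longrightarrow> (\<Phi> has_field_derivative G z) (at z within strip)"
    by (rule holomorphic_convex_primitive[OF convex_strip finite.emptyI cont fd]) (assumption, rule that)
  have vert: "((\<lambda>t. \<i> * G (Complex s t)) has_integral (\<Phi> (Complex s R) - \<Phi> (Complex s (-R)))) {-R..R}"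
    if s: "\<And>t. Complex s t \<in> strip" for s
  proof -
    have vd: "((\<Phi> \<circ> Complex s) has_vector_derivative \<i> * G (Complex s t)) (at t within {-R..R})" for t
    proof (rule field_vector_diff_chain_within)
      have "((\<lambda>t. of_real s + \<i> * of_real t) has_vector_derivative \<i>) (at t within {-R..R})"
        by (auto intro!: derivative_eq_intros)
      moreover have "(\<lambda>t. of_real s + \<i> * of_real t) = Complex s" by (auto simp: Complex_eq)
      ultimately show "(Complex s has_vector_derivative \<i>) (at t within {-R..R})" by simp
      show "(\<Phi> has_field_derivative G (Complex s t)) (at (Complex s t) within Complex s ` {-R..R})"
        by (rule DERIV_subset[OF \<Phi>[OF s]]) (use s in auto)
    qed
    have "((\<lambda>t. \<i> * G (Complex s t)) has_integral ((\<Phi> \<circ> Complex s) R - (\<Phi> \<circ> Complex s) (-R))) {-R..R}"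
      by (rule fundamental_theorem_of_calculus) (use R in simp, rule vd)
    then show ?thesis by simp
  qed
  have int: "\<i> * integral {-R..R} (\<lambda>t. G (Complex s t)) = \<Phi> (Complex s R) - \<Phi> (Complex s (-R))"
    if "\<And>t. Complex s t \<in> strip" for s
    using integral_unique[OF vert[OF that]] by simp
  have hor: "cmod (\<Phi> (Complex 0 r) - \<Phi> (Complex 1 r)) \<le> B" if r: "\<bar>r\<bar> = R" for r
  proof -
    let ?S = "{z \<in> strip. Im z = r}"
    have "cmod (\<Phi> (Complex 0 r) - \<Phi> (Complex 1 r)) \<le> B * cmod (Complex 0 r - Complex 1 r)"
    proof (rule field_differentiable_bound[of ?S \<Phi> G])
      have "?S = strip \<inter> Im -` {r}" by auto
      then show "convex ?S"
        using convex_Int[OF convex_strip convex_linear_vimage[of Im "{r}"]]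
        by (simp add: bounded_linear.linear bounded_linear_Im)
      show "(\<Phi> has_field_derivative G z) (at z within ?S)" if "z \<in> ?S" for z
        by (rule DERIV_subset[OF \<Phi>]) (use that in auto)
    qed (use B r in \<open>auto simp: strip_def\<close>)
    then show ?thesis by (simp add: complex_diff norm_complex_def)
  qed
  let ?I0 = "integral {-R..R} (\<lambda>t. G (Complex 0 t))" and ?I1 = "integral {-R..R} (\<lambda>t. G (Complex 1 t))"
  have "cmod (?I0 - ?I1) = cmod (\<i> * ?I0 - \<i> * ?I1)" by (simp add: norm_mult flip: right_diff_distrib)
  also have "\<dots> = cmod ((\<Phi> (Complex 0 R) - \<Phi> (Complex 1 R)) - (\<Phi> (Complex 0 (-R)) - \<Phi> (Complex 1 (-R))))"
    by (subst int int, simp add: strip_def)+ (simp add: algebra_simps)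
  also have "\<dots> \<le> B + B"
    by (rule order_trans[OF norm_triangle_ineq4 add_mono[OF hor hor]]) (use R in auto)
  finally show ?thesis by simp
qed

text \<open>
  The entire extension of the normal density from the imaginary axis, where the square of the
  argument is negative (\<open>gauss_kernel_imaginary\<close>).
\<close>

definition gauss_kernel :: "real \<Rightarrow> complex \<Rightarrow> complex"
  where "gauss_kernel \<sigma> w = exp (w^2 / of_real (2 * \<sigma>^2)) / of_real (sqrt (2 * pi * \<sigma>^2))"

lemma gauss_kernel_imaginary:
  "gauss_kernel \<sigma> (Complex x u - Complex x t) = of_real (normal_density u \<sigma> t)"
proof -
  have "(Complex x u - Complex x t)^2 = of_real (- ((t - u)^2))"
    by (simp add: complex_eq_iff power2_eq_square algebra_simps)
  then have "exp ((Complex x u - Complex x t)^2 / of_real (2 * \<sigma>^2)) = exp (of_real (- ((t - u)^2) / (2 * \<sigma>^2)))"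
    by simp
  then show ?thesis by (simp add: gauss_kernel_def normal_density_def flip: exp_of_real)
qed

lemma cmod_gauss_kernel:
  "cmod (gauss_kernel \<sigma> w) = exp (((Re w)^2 - (Im w)^2) / (2 * \<sigma>^2)) / sqrt (2 * pi * \<sigma>^2)"
proof -
  have "Re (w^2 / of_real (2 * \<sigma>^2)) = ((Re w)^2 - (Im w)^2) / (2 * \<sigma>^2)"
    by (simp add: power2_eq_square Re_divide_of_real del: of_real_mult of_real_power)
  then show ?thesis by (simp add: gauss_kernel_def norm_divide del: of_real_mult of_real_power)
qed

text \<open>
  Complex differentiability of \<open>f\<close> with derivative \<open>D\<close> means that \<open>left_scaleC D\<close> is the Frechet derivative.
\<close>

definition left_scaleC :: "'b::complex_banach \<Rightarrow> (complex \<Rightarrow>\<^sub>L 'b)"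
  where "left_scaleC x = Blinfun (\<lambda>h. h *\<^sub>C x)"

lemma left_scaleC_apply [simp]: "blinfun_apply (left_scaleC x) h = h *\<^sub>C x"
  by (simp add: left_scaleC_def bounded_linear_Blinfun_apply scaleC.bounded_linear_left)

lemma bounded_linear_left_scaleC: "bounded_linear left_scaleC"
proof (rule bounded_linear_intro[where K = 1])
  show "norm (left_scaleC x) \<le> norm x * 1" for x :: "'b::complex_banach"
    by (rule norm_blinfun_bound) (auto simp: norm_scaleC mult.commute)
qed (auto intro!: blinfun_eqI simp: blinfun.add_left blinfun.scaleR_left scaleC.add_right scaleC.scaleR_right)

lemma gauss_convolution_derivative:
  fixes g :: "real \<Rightarrow> 'b::complex_banach"
  assumes cont: "continuous_on UNIV g" and \<sigma>: "0 < \<sigma>"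
  shows "\<exists>D. ((\<lambda>z. integral {-R..R} (\<lambda>t. gauss_kernel \<sigma> (z - Complex 0 t) *\<^sub>C g t)) has_derivative (\<lambda>h. h *\<^sub>C D)) (at z)"
proof -
  define k' where "k' w = gauss_kernel \<sigma> w * (w / of_real (\<sigma>^2))" for w
  have k': "(gauss_kernel \<sigma> has_field_derivative k' w) (at w)" for w
    unfolding gauss_kernel_def k'_def using \<sigma>
    by (auto intro!: derivative_eq_intros simp: field_simps power2_eq_square)
  have contk: "continuous_on A (gauss_kernel \<sigma>)" for A
    using k' by (meson DERIV_isCont continuous_at_imp_continuous_on)
  have contk': "continuous_on A k'" for A
    unfolding k'_def using \<sigma> by (intro continuous_intros contk) auto
  have contC: "continuous_on A (Complex 0)" for A
    by (simp add: Complex_eq continuous_intros)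
  define V where "V z t = k' (z - Complex 0 t) *\<^sub>C g t" for z t
  have contV: "continuous_on (UNIV \<times> cbox (-R) R) (\<lambda>(z, t). V z t)"
    unfolding V_def split_beta
    by (intro scaleC.continuous_on continuous_on_compose2[OF contk'[of UNIV]] continuous_on_compose2[OF cont]
        continuous_on_diff continuous_on_compose2[OF contC[of UNIV]] continuous_on_fst continuous_on_snd continuous_on_id) auto
  have contV1: "continuous_on {-R..R} (V z)"
    unfolding V_def
    by (intro scaleC.continuous_on continuous_on_compose2[OF contk'[of UNIV]] continuous_on_subset[OF cont]
        continuous_on_diff contC continuous_on_const) auto
  have "((\<lambda>z. integral (cbox (-R) R) (\<lambda>t. gauss_kernel \<sigma> (z - Complex 0 t) *\<^sub>C g t)) has_derivative
      integral (cbox (-R) R) (\<lambda>t. left_scaleC (V z t))) (at z within UNIV)"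
  proof (rule leibniz_rule)
    fix w :: complex and t :: real
    have "((\<lambda>w. gauss_kernel \<sigma> (w - Complex 0 t)) has_field_derivative k' (w - Complex 0 t)) (at w)"
    proof -
      have "((\<lambda>w. w - Complex 0 t) has_field_derivative 1) (at w)" by (auto intro!: derivative_eq_intros)
      from DERIV_chain[OF k' this] show ?thesis by (simp add: o_def)
    qed
    then have "((\<lambda>w. gauss_kernel \<sigma> (w - Complex 0 t)) has_derivative (\<lambda>h. k' (w - Complex 0 t) * h)) (at w)"
      by (simp add: has_field_derivative_def mult_commute_abs)
    from bounded_linear.has_derivative[OF scaleC.bounded_linear_left[of "g t"] this]
    have "((\<lambda>w. gauss_kernel \<sigma> (w - Complex 0 t) *\<^sub>C g t) has_derivative (\<lambda>h. (k' (w - Complex 0 t) * h) *\<^sub>C g t)) (at w)" .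
    moreover have "blinfun_apply (left_scaleC (V w t)) = (\<lambda>h. (k' (w - Complex 0 t) * h) *\<^sub>C g t)"
      by (simp add: fun_eq_iff V_def scaleC_scaleC mult.commute)
    ultimately show "((\<lambda>w. gauss_kernel \<sigma> (w - Complex 0 t) *\<^sub>C g t) has_derivative blinfun_apply (left_scaleC (V w t))) (at w within UNIV)"
      by simp
  next
    fix w :: complex
    show "(\<lambda>t. gauss_kernel \<sigma> (w - Complex 0 t) *\<^sub>C g t) integrable_on cbox (-R) R"
      by (intro integrable_continuous scaleC.continuous_on continuous_on_compose2[OF contk[of UNIV]] continuous_on_subset[OF cont]
        continuous_on_diff contC continuous_on_const) auto
  next
    have "continuous_on (UNIV \<times> cbox (-R) R) (\<lambda>p. left_scaleC ((\<lambda>(z, t). V z t) p))"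
      by (rule bounded_linear.continuous_on[OF bounded_linear_left_scaleC contV])
    then show "continuous_on (UNIV \<times> cbox (-R) R) (\<lambda>(z, t). left_scaleC (V z t))"
      by (simp add: split_beta)
  qed auto
  moreover have "integral (cbox (-R) R) (\<lambda>t. left_scaleC (V z t)) = left_scaleC (integral (cbox (-R) R) (V z))"
    using integral_linear[OF integrable_continuous_real[OF contV1] bounded_linear_left_scaleC] by (simp add: o_def)
  moreover have "blinfun_apply (left_scaleC x) = (\<lambda>h. h *\<^sub>C x)" for x :: 'b by (simp add: fun_eq_iff)
  ultimately show ?thesis by (intro exI[of _ "integral (cbox (-R) R) (V z)"]) simp
qed

lemma compact_rectangle: "compact {z \<in> strip. \<bar>Im z\<bar> \<le> R}"
proof -
  have "{z \<in> strip. \<bar>Im z\<bar> \<le> R} = cbox (Complex 0 (-R)) (Complex 1 R)"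
    by (auto simp: strip_def in_cbox_complex_iff)
  then show ?thesis by simp
qed

lemma complex_linear_derivative:
  fixes g :: "complex \<Rightarrow> 'b::complex_banach"
  assumes "bounded_linear T" "\<And>c x. T (c *\<^sub>C x) = c * T x" "(g has_derivative (\<lambda>h. h *\<^sub>C D)) F"
  shows "((\<lambda>z. T (g z)) has_derivative (\<lambda>h. h * T D)) F"
  using bounded_linear.has_derivative[OF assms(1,3)] by (simp add: assms(2))

lemma of_real_Complex: "of_real a = Complex a 0"
  by (simp add: complex_of_real_def)

lemma null_sequence: "(\<lambda>k. 1 / real (Suc k)) \<longlonglongrightarrow> 0"
  using LIMSEQ_inverse_real_of_nat by (simp add: inverse_eq_divide)

lemma le_mult_epsilon:
  fixes x y z :: real
  assumes "\<And>e. 0 < e \<Longrightarrow> z \<le> (x + e) * (y + e)"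
  shows "z \<le> x * y"
proof -
  have "z \<le> (x + 0) * (y + 0)"
  proof (rule tendsto_lowerbound)
    show "((\<lambda>e. (x + e) * (y + e)) \<longlongrightarrow> (x + 0) * (y + 0)) (at_right 0)" by (intro tendsto_intros)
    show "\<forall>\<^sub>F e in at_right 0. z \<le> (x + e) * (y + e)"
      unfolding eventually_at_right_field using assms by (intro exI[of _ 1]) auto
  qed simp
  then show ?thesis by simp
qed

context jbw_trace
begin

text \<open>
  Functions with values in the algebra, differentiable there in the complex sense, that vanish at infinity uniformly in the strip.
  Pointwise products of such functions are of the same kind (\<open>entire_decaying_product\<close>).
\<close>

definition entire_decaying :: "(complex \<Rightarrow> 'a) \<Rightarrow> bool"
  where "entire_decaying g \<longleftrightarrow> (\<forall>z. \<exists>D. (g has_derivative (\<lambda>h. h *\<^sub>C D)) (at z)) \<and>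
    (\<forall>\<epsilon>>0. \<exists>R. \<forall>z\<in>strip. R \<le> \<bar>Im z\<bar> \<longrightarrow> norm (g z) \<le> \<epsilon>)"

lemma entire_decaying_continuous: "entire_decaying g \<Longrightarrow> continuous_on A g"
  unfolding entire_decaying_def by (meson has_derivative_continuous continuous_at_imp_continuous_on)

lemma entire_decaying_decay: "entire_decaying g \<Longrightarrow> 0 < \<epsilon> \<Longrightarrow> \<exists>R. \<forall>z\<in>strip. R \<le> \<bar>Im z\<bar> \<longrightarrow> norm (g z) \<le> \<epsilon>"
  by (simp add: entire_decaying_def)

lemma entire_decaying_bounded:
  assumes g: "entire_decaying g"
  shows "\<exists>C. \<forall>z\<in>strip. norm (g z) \<le> C"
proof -
  obtain R where R: "\<And>z. z \<in> strip \<Longrightarrow> R \<le> \<bar>Im z\<bar> \<Longrightarrow> norm (g z) \<le> 1"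
    using entire_decaying_decay[OF g, of 1] by auto
  have "bounded (g ` {z \<in> strip. \<bar>Im z\<bar> \<le> R})"
    by (intro compact_imp_bounded compact_continuous_image entire_decaying_continuous[OF g] compact_rectangle)
  then obtain C where "\<forall>x\<in>g ` {z \<in> strip. \<bar>Im z\<bar> \<le> R}. norm x \<le> C" unfolding bounded_iff by blast
  then have C: "\<And>z. z \<in> strip \<Longrightarrow> \<bar>Im z\<bar> \<le> R \<Longrightarrow> norm (g z) \<le> C" by blast
  have "norm (g z) \<le> max C 1" if "z \<in> strip" for z
    using C[OF that] R[OF that] by (cases "\<bar>Im z\<bar> \<le> R") (auto simp: le_max_iff_disj)
  then show ?thesis by blast
qed

lemma entire_decaying_admissible:
  assumes g: "entire_decaying g" and left: "\<And>t. norm (g (Complex 0 t)) \<le> A" and right: "\<And>t. norm (E (g (Complex 1 t))) \<le> A"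
  shows "admissible (\<lambda>z. E (g z)) (\<lambda>t. g (Complex 0 t)) A"
proof -
  have blE: "bounded_linear E"
  proof (rule bounded_linear_intro[where K = 1])
    show "E (r *\<^sub>R x) = r *\<^sub>R E x" for r x
      using trace_embed_scaleC[of "of_real r" x] by (simp add: scaleC_of_real)
  qed (auto simp: trace_embed_add norm_trace_embed)
  have contE: "continuous_on S (\<lambda>z. E (g z))" for S
    by (rule bounded_linear.continuous_on[OF blE entire_decaying_continuous[OF g]])
  have hol: "(\<lambda>z. blinfun_apply (E (g z)) y) holomorphic_on S" for y S
  proof (rule holomorphic_onI)
    fix z
    obtain D where D: "(g has_derivative (\<lambda>h. h *\<^sub>C D)) (at z)" using g unfolding entire_decaying_def by blast
    have "((\<lambda>z. \<phi> (g z \<circ>\<^sub>J y)) has_derivative (\<lambda>h. h * \<phi> (D \<circ>\<^sub>J y))) (at z)"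
      by (rule complex_linear_derivative[OF _ _ D, of "\<lambda>x. \<phi> (x \<circ>\<^sub>J y)"])
        (auto simp: jordan_scaleC trace_scaleC intro!: bounded_linear_compose[OF bounded_linear_trace] jordan.bounded_linear_left)
    then have "((\<lambda>z. blinfun_apply (E (g z)) y) has_field_derivative \<phi> (D \<circ>\<^sub>J y)) (at z)"
      by (simp add: has_field_derivative_def mult_commute_abs)
    then show "(\<lambda>z. blinfun_apply (E (g z)) y) field_differentiable at z within S"
      by (auto simp: field_differentiable_def intro: has_field_derivative_at_within)
  qed
  obtain C where C: "\<And>z. z \<in> strip \<Longrightarrow> norm (g z) \<le> C" using entire_decaying_bounded[OF g] by blast
  have lim: "((\<lambda>t. g (Complex s t)) \<longlongrightarrow> 0) at_infinity" if s: "\<And>t. Complex s t \<in> strip" for s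
    unfolding tendsto_iff dist_norm
  proof (intro allI impI)
    fix e :: real assume e: "0 < e"
    obtain R where R: "\<And>z. z \<in> strip \<Longrightarrow> R \<le> \<bar>Im z\<bar> \<Longrightarrow> norm (g z) \<le> e / 2"
      using entire_decaying_decay[OF g, of "e / 2"] e by auto
    have "norm (g (Complex s t) - 0) < e" if "R \<le> norm t" for t
      using R[OF s, of t] that e by simp
    then show "\<forall>\<^sub>F t in at_infinity. norm (g (Complex s t) - 0) < e"
      unfolding eventually_at_infinity by blast
  qed
  have left': "norm (E (g (Complex 0 t))) \<le> A" for t
    using norm_trace_embed left order_trans by blast
  have "norm (E (g z)) \<le> A" if "z \<in> strip" for z
    by (rule strip_maximum_principle_dual[OF contE hol order_trans[OF norm_trace_embed C] left' right that])
  moreover have "((\<lambda>t. g (Complex 0 t)) \<longlongrightarrow> 0) at_infinity" by (rule lim) simp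
  moreover have "((\<lambda>t. E (g (Complex 1 t))) \<longlongrightarrow> 0) at_infinity"
    using bounded_linear.tendsto[OF blE lim[of 1]] linear_0[OF bounded_linear.linear[OF blE]] by simp
  moreover have "continuous_on UNIV (\<lambda>t. g (Complex 0 t))"
    by (rule continuous_on_compose2[OF entire_decaying_continuous[OF g, of UNIV]]) (auto simp: Complex_eq intro!: continuous_intros)
  ultimately show ?thesis
    unfolding admissible_def using left contE hol trace_embed_predual by blast
qed

text \<open>
  The maximum principle for \<open>exp ((w - i Im z)\<^sup>2) f w\<close>: the boundary values near the height of \<open>z\<close> are
  small by assumption, the others because of the exponential factor.
\<close>

lemma admissible_decay:
  assumes f: "admissible f g A" and \<epsilon>: "0 < \<epsilon>"
  shows "\<exists>R. \<forall>z\<in>strip. R \<le> \<bar>Im z\<bar> \<longrightarrow> norm (f z) \<le> \<epsilon>"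
proof -
  have A0: "0 \<le> A" using order_trans[OF norm_ge_zero admissibleD(8)[OF f]] .
  \<comment> \<open>On the strip the exponential factor is at most \<open>exp 1\<close>.\<close>
  define \<delta> where "\<delta> = \<epsilon> / exp 1"
  have \<delta>: "0 < \<delta>" "exp 1 * \<delta> = \<epsilon>" using \<epsilon> by (auto simp: \<delta>_def)
  have "\<forall>\<^sub>F t in at_infinity. norm (g t) < \<delta> \<and> norm (f (Complex 1 t)) < \<delta>"
    using tendstoD[OF admissibleD(7)[OF f] \<delta>(1)] tendstoD[OF admissibleD(9)[OF f] \<delta>(1)] by eventually_elim simp
  then obtain R0 where R0: "\<And>t. R0 \<le> \<bar>t\<bar> \<Longrightarrow> norm (g t) < \<delta> \<and> norm (f (Complex 1 t)) < \<delta>"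
    by (auto simp: eventually_at_infinity)
  have "((\<lambda>T::real. exp (1 - T^2) * A) \<longlongrightarrow> 0) at_top" by real_asymp
  then have "\<forall>\<^sub>F T in at_top. exp (1 - T^2) * A < \<epsilon>" using \<epsilon> by (rule order_tendstoD(2))
  then have "\<forall>\<^sub>F T in at_top. exp (1 - T^2) * A < \<epsilon> \<and> 0 \<le> T" by (intro eventually_conj eventually_ge_at_top)
  then obtain T where T: "exp (1 - T^2) * A < \<epsilon>" "0 \<le> T" by (auto dest: eventually_happens)
  have bnd: "norm (f z) \<le> \<epsilon>" if z: "z \<in> strip" and Rz: "R0 + T \<le> \<bar>Im z\<bar>" for z
  proof -
    define e where "e w = exp ((w - Complex 0 (Im z))^2)" for w
    have ne: "cmod (e w) = exp ((Re w)^2 - (Im w - Im z)^2)" for w by (simp add: e_def power2_eq_square)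
    define F where "F w = e w *\<^sub>C f w" for w
    have edge: "norm (e w *\<^sub>C f w) \<le> \<epsilon>" if w: "w \<in> strip" and small: "R0 \<le> \<bar>Im w\<bar> \<Longrightarrow> norm (f w) \<le> \<delta>" for w
    proof -
      have Re2: "(Re w)^2 \<le> 1" using w by (auto simp: strip_def abs_square_le_1)
      show ?thesis
      proof (cases "\<bar>Im w - Im z\<bar> \<le> T")
        case True
        then have "R0 \<le> \<bar>Im w\<bar>" using Rz by linarith
        moreover have "cmod (e w) \<le> exp 1"
          unfolding ne using Re2 order_trans[OF Re2, of "1 + (Im w - Im z)^2"] by (simp add: algebra_simps)
        ultimately have "cmod (e w) * norm (f w) \<le> exp 1 * \<delta>" using small by (intro mult_mono) auto
        then show ?thesis by (simp add: norm_scaleC \<delta>)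
      next
        case False
        then have "T^2 \<le> (Im w - Im z)^2" using T(2) by (metis abs_le_square_iff abs_of_nonneg linorder_le_cases)
        then have "cmod (e w) \<le> exp (1 - T^2)" unfolding ne using Re2 by simp
        then have "cmod (e w) * norm (f w) \<le> exp (1 - T^2) * A" using admissibleD(4)[OF f w] by (intro mult_mono) auto
        then show ?thesis using T by (simp add: norm_scaleC)
      qed
    qed
    have "norm (F z) \<le> \<epsilon>"
    proof (rule strip_maximum_principle_dual[OF _ _ _ _ _ z])
      show "continuous_on strip F"
        unfolding F_def e_def by (intro scaleC.continuous_on continuous_intros admissibleD(2)[OF f])
      show "(\<lambda>w. blinfun_apply (F w) y) holomorphic_on open_strip" for y
        unfolding F_def e_def scaleC_blinfun_apply scaleC_complex_def by (intro holomorphic_intros admissibleD(3)[OF f])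
      show "norm (F w) \<le> exp 1 * A" if w: "w \<in> strip" for w
      proof -
        have Re2: "(Re w)^2 \<le> 1" using w by (auto simp: strip_def abs_square_le_1)
        have "cmod (e w) \<le> exp 1"
          unfolding ne using order_trans[OF Re2, of "1 + (Im w - Im z)^2"] by (simp add: algebra_simps)
        then show ?thesis unfolding F_def norm_scaleC using admissibleD(4)[OF f w] by (intro mult_mono) auto
      qed
      show "norm (F (Complex 0 t)) \<le> \<epsilon>" for t
        unfolding F_def
      proof (rule edge)
        assume "R0 \<le> \<bar>Im (Complex 0 t)\<bar>"
        then have "norm (g t) < \<delta>" using R0 by simp
        then show "norm (f (Complex 0 t)) \<le> \<delta>"
          unfolding admissibleD(5)[OF f] using norm_trace_embed[of "g t"] by simp
      qed simp
      show "norm (F (Complex 1 t)) \<le> \<epsilon>" for t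
        unfolding F_def by (rule edge) (use R0[of t] in auto)
    qed
    moreover have "norm (f z) \<le> norm (F z)"
      unfolding F_def norm_scaleC ne by (simp add: mult_le_cancel_right1)
    ultimately show ?thesis by simp
  qed
  show ?thesis by (rule exI[of _ "R0 + T"]) (use bnd in blast)
qed

text \<open>
  Averaging the left boundary values \<open>g\<close> with the entire Gaussian kernel gives an entire function with values in
  the algebra. On the left it is the Gaussian average of \<open>g\<close>. On the right, shifting the contour turns it into the Gaussian average
  of the right boundary values, up to horizontal integrals, which are small because \<open>f\<close> decays.
  The average is truncated to a bounded interval, which keeps all integrals elementary.
\<close>

lemma entire_decaying_approximation:
  assumes f: "admissible f g A" and \<epsilon>: "0 < \<epsilon>"
  shows "\<exists>n. entire_decaying n \<and> (\<forall>t. norm (g t - n (Complex 0 t)) \<le> \<epsilon>) \<and>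
    (\<forall>t. norm (f (Complex 1 t) - E (n (Complex 1 t))) \<le> \<epsilon>)"
proof -
  define f1 where "f1 t = f (Complex 1 t)" for t
  have contf1: "continuous_on UNIV f1"
    unfolding f1_def by (rule continuous_on_compose2[OF admissibleD(2)[OF f]]) (auto simp: strip_def Complex_eq intro!: continuous_intros)
  have limf1: "(f1 \<longlongrightarrow> 0) at_infinity" unfolding f1_def by (rule admissibleD(9)[OF f])
  note contg = admissibleD(6)[OF f] and limg = admissibleD(7)[OF f]
  obtain \<sigma>1 T1 where \<sigma>1: "0 < \<sigma>1" "\<And>\<sigma> R u. 0 < \<sigma> \<Longrightarrow> \<sigma> \<le> \<sigma>1 \<Longrightarrow> T1 \<le> R \<Longrightarrow>
    norm (integral {-R..R} (\<lambda>t. normal_density u \<sigma> t *\<^sub>R g t) - g u) \<le> \<epsilon>"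
    using gaussian_average_approximates[OF contg limg \<epsilon>] by metis
  obtain \<sigma>2 T2 where \<sigma>2: "0 < \<sigma>2" "\<And>\<sigma> R u. 0 < \<sigma> \<Longrightarrow> \<sigma> \<le> \<sigma>2 \<Longrightarrow> T2 \<le> R \<Longrightarrow>
    norm (integral {-R..R} (\<lambda>t. normal_density u \<sigma> t *\<^sub>R f1 t) - f1 u) \<le> \<epsilon> / 2"
    using gaussian_average_approximates[OF contf1 limf1 half_gt_zero[OF \<epsilon>]] by metis
  define \<sigma> where "\<sigma> = min \<sigma>1 \<sigma>2"
  have \<sigma>: "0 < \<sigma>" "\<sigma> \<le> \<sigma>1" "\<sigma> \<le> \<sigma>2" using \<sigma>1 \<sigma>2 by (auto simp: \<sigma>_def)
  define c where "c = sqrt (2 * pi * \<sigma>^2)"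
  have c: "0 < c" using \<sigma> by (simp add: c_def)
  define K where "K = exp (1 / (2 * \<sigma>^2)) / c"
  have K: "0 < K" using c by (simp add: K_def)
  obtain R3 where R3: "\<And>z. z \<in> strip \<Longrightarrow> R3 \<le> \<bar>Im z\<bar> \<Longrightarrow> norm (f z) \<le> \<epsilon> / (4 * K)"
    using admissible_decay[OF f, of "\<epsilon> / (4 * K)"] \<epsilon> K by auto
  define R where "R = max (max T1 T2) (max R3 0)"
  have R: "T1 \<le> R" "T2 \<le> R" "R3 \<le> R" "0 \<le> R" by (auto simp: R_def)
  define k where "k = gauss_kernel \<sigma>"
  have contC: "continuous_on S (Complex s)" for s S
    by (simp add: Complex_eq continuous_intros)
  have contk: "continuous_on S k" for S
    unfolding k_def gauss_kernel_def using \<sigma> by (intro continuous_intros) auto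
  define n where "n z = integral {-R..R} (\<lambda>t. k (z - Complex 0 t) *\<^sub>C g t)" for z
  have contI: "continuous_on {-R..R} (\<lambda>t. k (z - Complex 0 t) *\<^sub>C g t)" for z
    by (intro scaleC.continuous_on continuous_on_compose2[OF contk[of UNIV]] continuous_on_subset[OF contg]
        continuous_on_diff contC continuous_on_const) auto
  have "entire_decaying n"
    unfolding entire_decaying_def
  proof (intro conjI allI impI)
    show "\<exists>D. (n has_derivative (\<lambda>h. h *\<^sub>C D)) (at z)" for z
      using gauss_convolution_derivative[OF contg \<sigma>(1)] unfolding n_def k_def .
    fix e :: real assume e: "0 < e"
    have A0: "0 \<le> A" using order_trans[OF norm_ge_zero admissibleD(8)[OF f]] .
    have "((\<lambda>x. exp ((1 - (x - R)^2) / (2 * \<sigma>^2)) / c * A * (R - - R)) \<longlongrightarrow> 0) at_top"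
      using \<sigma>(1) c by real_asymp
    then have "\<forall>\<^sub>F x in at_top. exp ((1 - (x - R)^2) / (2 * \<sigma>^2)) / c * A * (R - - R) < e"
      using e by (rule order_tendstoD(2))
    then obtain X where X: "\<And>x. X \<le> x \<Longrightarrow> exp ((1 - (x - R)^2) / (2 * \<sigma>^2)) / c * A * (R - - R) < e"
      by (auto simp: eventually_at_top_linorder)
    have "norm (n z) \<le> e" if z: "z \<in> strip" "max X R \<le> \<bar>Im z\<bar>" for z
    proof -
      have "norm (n z) \<le> exp ((1 - (\<bar>Im z\<bar> - R)^2) / (2 * \<sigma>^2)) / c * A * (R - - R)"
        unfolding n_def
      proof (rule integral_bound[OF _ contI])
        fix t assume t: "t \<in> {-R..R}"
        have Re2: "(Re z)^2 \<le> 1" using z by (auto simp: strip_def abs_square_le_1)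
        have "(\<bar>Im z\<bar> - R)^2 \<le> (Im z - t)^2"
        proof -
          have "\<bar>\<bar>Im z\<bar> - R\<bar> \<le> \<bar>Im z - t\<bar>" using t z(2) by (simp add: abs_if split: if_splits)
          then show ?thesis by (rule abs_le_square_iff[THEN iffD1])
        qed
        then have "((Re z)^2 - (Im z - t)^2) / (2 * \<sigma>^2) \<le> (1 - (\<bar>Im z\<bar> - R)^2) / (2 * \<sigma>^2)"
          using Re2 by (intro divide_right_mono) auto
        then have "cmod (k (z - Complex 0 t)) \<le> exp ((1 - (\<bar>Im z\<bar> - R)^2) / (2 * \<sigma>^2)) / c"
          unfolding k_def cmod_gauss_kernel c_def[symmetric] using c by (intro divide_right_mono) auto
        then show "norm (k (z - Complex 0 t) *\<^sub>C g t) \<le> exp ((1 - (\<bar>Im z\<bar> - R)^2) / (2 * \<sigma>^2)) / c * A"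
          unfolding norm_scaleC using admissibleD(8)[OF f, of t] c by (intro mult_mono) auto
      qed (use R in simp)
      then show ?thesis using X[of "\<bar>Im z\<bar>"] z by simp
    qed
    then show "\<exists>R. \<forall>z\<in>strip. R \<le> \<bar>Im z\<bar> \<longrightarrow> norm (n z) \<le> e" by blast
  qed
  moreover have "norm (g u - n (Complex 0 u)) \<le> \<epsilon>" for u
  proof -
    have "n (Complex 0 u) = integral {-R..R} (\<lambda>t. normal_density u \<sigma> t *\<^sub>R g t)"
      unfolding n_def k_def gauss_kernel_imaginary scaleC_of_real ..
    then show ?thesis using \<sigma>1(2)[OF \<sigma>(1,2) R(1), of u] by (simp add: norm_minus_commute)
  qed
  moreover have "norm (f (Complex 1 u) - E (n (Complex 1 u))) \<le> \<epsilon>" for u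
  proof -
    define J where "J = integral {-R..R} (\<lambda>t. normal_density u \<sigma> t *\<^sub>R f1 t)"
    have intJ: "(\<lambda>t. normal_density u \<sigma> t *\<^sub>R f1 t) integrable_on {-R..R}"
      unfolding normal_density_def using \<sigma>
      by (intro integrable_continuous_real continuous_intros continuous_on_subset[OF contf1]) auto
    have "norm (E (n (Complex 1 u)) - J) \<le> \<epsilon> / 2"
    proof (rule norm_blinfun_bound)
      fix y
      define G where "G \<zeta> = k (Complex 1 u - \<zeta>) * blinfun_apply (f \<zeta>) y" for \<zeta>
      have G0: "blinfun_apply (E (n (Complex 1 u))) y = integral {-R..R} (\<lambda>t. G (Complex 0 t))"
      proof -
        have "bounded_linear (\<lambda>x. \<phi> (x \<circ>\<^sub>J y))"
          by (intro bounded_linear_compose[OF bounded_linear_trace] jordan.bounded_linear_left)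
        from integral_linear[OF integrable_continuous_real[OF contI] this, symmetric]
        have "\<phi> (n (Complex 1 u) \<circ>\<^sub>J y) = integral {-R..R} (\<lambda>t. \<phi> ((k (Complex 1 u - Complex 0 t) *\<^sub>C g t) \<circ>\<^sub>J y))"
          by (simp add: n_def o_def)
        then show ?thesis by (simp add: G_def admissibleD(5)[OF f] jordan_scaleC trace_scaleC)
      qed
      have G1: "blinfun_apply J y = integral {-R..R} (\<lambda>t. G (Complex 1 t))"
      proof -
        have "G (Complex 1 t) = blinfun_apply (normal_density u \<sigma> t *\<^sub>R f1 t) y" for t
          unfolding G_def k_def gauss_kernel_imaginary f1_def by (simp add: blinfun.scaleR_left scaleR_conv_of_real)
        then show ?thesis
          using integral_linear[OF intJ blinfun.bounded_linear_left[of y]] by (simp add: J_def o_def)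
      qed
      have "cmod (integral {-R..R} (\<lambda>t. G (Complex 0 t)) - integral {-R..R} (\<lambda>t. G (Complex 1 t)))
          \<le> 2 * (K * (\<epsilon> / (4 * K) * norm y))"
      proof (rule contour_shift_strip[OF _ _ R(4)])
        show "continuous_on strip G"
          unfolding G_def by (intro continuous_intros continuous_on_compose2[OF contk[of UNIV]] admissibleD(2)[OF f]) auto
        show "G holomorphic_on open_strip"
          unfolding G_def k_def gauss_kernel_def using \<sigma> by (intro holomorphic_intros admissibleD(3)[OF f]) auto
        fix z assume z: "z \<in> strip" "\<bar>Im z\<bar> = R"
        have "(1 - Re z)^2 \<le> 1" using z by (auto simp: strip_def abs_square_le_1)
        then have "(1 - Re z)^2 - (u - Im z)^2 \<le> 1" by (smt (verit) zero_le_power2)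
        then have "cmod (k (Complex 1 u - z)) \<le> K"
          unfolding k_def cmod_gauss_kernel K_def c_def[symmetric] using c \<sigma> by (auto intro!: divide_right_mono)
        moreover have "cmod (blinfun_apply (f z) y) \<le> \<epsilon> / (4 * K) * norm y"
          using norm_blinfun[of "f z" y] mult_right_mono[OF R3[OF z(1)] norm_ge_zero[of y]] z R by linarith
        ultimately show "cmod (G z) \<le> K * (\<epsilon> / (4 * K) * norm y)"
          unfolding G_def norm_mult using K by (intro mult_mono) auto
      qed
      then show "norm (blinfun_apply (E (n (Complex 1 u)) - J) y) \<le> \<epsilon> / 2 * norm y"
        using K unfolding blinfun.diff_left G0 G1 by (simp add: field_simps)
    qed (use \<epsilon> in simp)
    moreover have "norm (J - f1 u) \<le> \<epsilon> / 2" unfolding J_def by (rule \<sigma>2(2)[OF \<sigma>(1,3) R(2)])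
    ultimately have "norm ((E (n (Complex 1 u)) - J) + (J - f1 u)) \<le> \<epsilon>"
      using norm_triangle_ineq[of "E (n (Complex 1 u)) - J" "J - f1 u"] by linarith
    then show ?thesis by (simp add: f1_def norm_minus_commute)
  qed
  ultimately show ?thesis by blast
qed

section \<open>Products of admissible functions\<close>

lemma entire_decaying_compose_affine_derivative:
  assumes n: "entire_decaying n"
  shows "\<exists>D. ((\<lambda>z. n (a * z + b)) has_derivative (\<lambda>h. (a * h) *\<^sub>C D)) (at z)"
proof -
  obtain D where D: "(n has_derivative (\<lambda>h. h *\<^sub>C D)) (at (a * z + b))" using n unfolding entire_decaying_def by blast
  have "((\<lambda>z. a * z + b) has_derivative (\<lambda>h. a * h)) (at z)" by (auto intro!: derivative_eq_intros)
  from has_derivative_compose[OF this D] show ?thesis by blast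
qed

text \<open>
  Moving along \<open>z \<mapsto> f (z + i \<sigma>)\<close> and \<open>z \<mapsto> n (\<beta> (1 - z) + i \<tau>)\<close> with \<open>\<beta> = b / (1 - a)\<close>, the arguments at \<open>z = a\<close>
  are the given ones. On the left boundary \<open>f\<close> takes values in the algebra, on the right \<open>n\<close> has its
  argument on the imaginary axis. In both cases the product is bounded by \<open>A * B\<close>.
\<close>

lemma pairing_bound:
  assumes f: "admissible f g A" and n: "entire_decaying n" "admissible (\<lambda>z. E (n z)) (\<lambda>t. n (Complex 0 t)) B"
    and ab: "0 < a" "0 < b" "a + b \<le> 1"
  shows "norm (act (f (Complex a \<sigma>)) (n (Complex b \<tau>))) \<le> A * B"
proof (rule norm_blinfun_bound)
  have A0: "0 \<le> A" using order_trans[OF norm_ge_zero admissibleD(8)[OF f]] .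
  have B0: "0 \<le> B" using order_trans[OF norm_ge_zero admissibleD(8)[OF n(2)]] .
  show "0 \<le> A * B" using A0 B0 by simp
  fix y
  define \<beta> where "\<beta> = b / (1 - a)"
  have \<beta>: "0 < \<beta>" "\<beta> \<le> 1" "\<beta> * (1 - a) = b" using ab by (auto simp: \<beta>_def)
  define v where "v z = z + \<i> * of_real \<sigma>" for z
  define w where "w z = - of_real \<beta> * z + (of_real \<beta> + \<i> * of_real \<tau>)" for z :: complex
  define h where "h z = blinfun_apply (f (v z)) (n (w z) \<circ>\<^sub>J y)" for z
  have Re_w: "Re (w z) = \<beta> * (1 - Re z)" and Im_w: "Im (w z) = \<tau> - \<beta> * Im z" for z
    by (simp_all add: w_def algebra_simps)
  have vs: "v z \<in> strip" and ws: "w z \<in> strip" if "z \<in> strip" for z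
  proof -
    show "v z \<in> strip" using that by (simp add: strip_def v_def)
    have "0 \<le> 1 - Re z" "1 - Re z \<le> 1" using that by (auto simp: strip_def)
    then show "w z \<in> strip" using \<beta> mult_mono[of \<beta> 1 "1 - Re z" 1] unfolding strip_def by (simp add: Re_w)
  qed
  have vo: "v z \<in> open_strip" if "z \<in> open_strip" for z using that by (simp add: open_strip_def v_def)
  obtain C where C: "\<And>z. z \<in> strip \<Longrightarrow> norm (n z) \<le> C" using entire_decaying_bounded[OF n(1)] by blast
  have bnd: "cmod (blinfun_apply F (x \<circ>\<^sub>J y)) \<le> K * L * norm y" if "norm F \<le> K" "norm x \<le> L" "0 \<le> K" for F :: "'a \<Rightarrow>\<^sub>L complex" and x K L
  proof -
    have "cmod (blinfun_apply F (x \<circ>\<^sub>J y)) \<le> norm F * norm (x \<circ>\<^sub>J y)" by (rule norm_blinfun)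
    also have "\<dots> \<le> K * (L * norm y)"
      using that order_trans[OF norm_jordan mult_right_mono[OF that(2) norm_ge_zero]] by (intro mult_mono) auto
    finally show ?thesis by (simp add: mult.assoc)
  qed
  have "cmod (h (of_real a)) \<le> A * B * norm y"
  proof (rule strip_maximum_principle[where f = h and z = "of_real a"])
    have "continuous_on strip v" unfolding v_def by (intro continuous_intros)
    then have cf: "continuous_on strip (\<lambda>z. f (v z))"
      by (rule continuous_on_compose2[OF admissibleD(2)[OF f]]) (use vs in blast)
    have "continuous_on strip w" unfolding w_def by (intro continuous_intros)
    then have cn: "continuous_on strip (\<lambda>z. n (w z))"
      by (rule continuous_on_compose2[OF entire_decaying_continuous[OF n(1), of UNIV]]) simp
    show "continuous_on strip h"
      unfolding h_def by (rule blinfun.continuous_on[OF cf jordan.continuous_on[OF cn continuous_on_const]])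
    show "h holomorphic_on open_strip"
    proof (rule holomorphic_onI)
      fix z assume z: "z \<in> open_strip"
      obtain D1 where D1: "D1 \<in> P" "(f has_derivative (\<lambda>h. h *\<^sub>C D1)) (at (v z))"
        using admissible_derivative[OF f vo[OF z]] by blast
      obtain D2 where D2: "((\<lambda>z. n (w z)) has_derivative (\<lambda>h. (- of_real \<beta> * h) *\<^sub>C D2)) (at z)"
        using entire_decaying_compose_affine_derivative[OF n(1)] unfolding w_def by blast
      have "(v has_derivative (\<lambda>h. h)) (at z)" unfolding v_def by (auto intro!: derivative_eq_intros)
      from has_derivative_compose[OF this D1(2)]
      have fd: "((\<lambda>z. f (v z)) has_derivative (\<lambda>h. h *\<^sub>C D1)) (at z)" .
      have nd: "((\<lambda>z. n (w z) \<circ>\<^sub>J y) has_derivative (\<lambda>h. ((- of_real \<beta> * h) *\<^sub>C D2) \<circ>\<^sub>J y)) (at z)"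
        by (rule bounded_linear.has_derivative[OF jordan.bounded_linear_left D2])
      have fP: "f (v z) \<in> P" using admissibleD(1)[OF f] vs z open_strip_subset by blast
      have "(h has_derivative (\<lambda>k. k * (- of_real \<beta> * blinfun_apply (f (v z)) (D2 \<circ>\<^sub>J y) + blinfun_apply D1 (n (w z) \<circ>\<^sub>J y)))) (at z)"
        unfolding h_def
        by (rule has_derivative_eq_rhs[OF blinfun.FDERIV[OF fd nd]])
          (simp add: fun_eq_iff jordan_scaleC predual_apply_scaleC[OF fP] scaleC_blinfun_apply scaleC_complex_def algebra_simps)
      then have "(h has_field_derivative (- of_real \<beta> * blinfun_apply (f (v z)) (D2 \<circ>\<^sub>J y) + blinfun_apply D1 (n (w z) \<circ>\<^sub>J y))) (at z)"
        by (simp add: has_field_derivative_def mult_commute_abs)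
      then show "h field_differentiable at z within open_strip"
        by (auto simp: field_differentiable_def intro: has_field_derivative_at_within)
    qed
    show "cmod (h z) \<le> A * C * norm y" if z: "z \<in> strip" for z
      unfolding h_def by (rule bnd[OF admissibleD(4)[OF f vs[OF z]] C[OF ws[OF z]] A0])
    show "cmod (h (Complex 0 t)) \<le> A * B * norm y" for t
    proof -
      let ?m = "n (w (Complex 0 t))" and ?x = "g (t + \<sigma>)"
      have "v (Complex 0 t) = Complex 0 (t + \<sigma>)" by (simp add: v_def complex_eq_iff)
      then have "h (Complex 0 t) = \<phi> (?x \<circ>\<^sub>J (?m \<circ>\<^sub>J y))" by (simp add: h_def admissibleD(5)[OF f])
      also have "\<dots> = \<phi> ((?x \<circ>\<^sub>J y) \<circ>\<^sub>J ?m)" by (simp add: jordan_commute[of ?m] trace_assoc)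
      also have "\<dots> = blinfun_apply (E ?m) (?x \<circ>\<^sub>J y)" by (simp add: jordan_commute[of ?m])
      also have "cmod \<dots> \<le> B * A * norm y"
        using ws[of "Complex 0 t"] by (intro bnd admissibleD(4)[OF n(2)] admissibleD(8)[OF f] B0) simp
      finally show ?thesis by (simp add: mult.commute)
    qed
    show "cmod (h (Complex 1 t)) \<le> A * B * norm y" for t
    proof -
      have "w (Complex 1 t) = Complex 0 (\<tau> - \<beta> * t)" by (simp add: complex_eq_iff Re_w Im_w)
      then have "norm (n (w (Complex 1 t))) \<le> B" using admissibleD(8)[OF n(2)] by simp
      then show ?thesis unfolding h_def using vs[of "Complex 1 t"] by (intro bnd admissibleD(4)[OF f] A0) simp_all
    qed
    show "of_real a \<in> strip" using ab by (simp add: strip_def)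
  qed
  moreover have "v (of_real a) = Complex a \<sigma>" "w (of_real a) = Complex b \<tau>"
    using \<beta>(3) by (simp_all add: complex_eq_iff v_def Re_w Im_w)
  ultimately show "norm (blinfun_apply (act (f (Complex a \<sigma>)) (n (Complex b \<tau>))) y) \<le> A * B * norm y"
    by (simp add: h_def)
qed

lemma entire_decaying_diff:
  assumes "entire_decaying m" "entire_decaying n"
  shows "entire_decaying (\<lambda>z. m z - n z)"
  unfolding entire_decaying_def
proof (intro conjI allI impI)
  fix z
  obtain D where D: "(m has_derivative (\<lambda>h. h *\<^sub>C D)) (at z)" using assms(1) unfolding entire_decaying_def by blast
  obtain D' where D': "(n has_derivative (\<lambda>h. h *\<^sub>C D')) (at z)" using assms(2) unfolding entire_decaying_def by blast
  have "((\<lambda>z. m z - n z) has_derivative (\<lambda>h. h *\<^sub>C (D - D'))) (at z)"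
    using has_derivative_diff[OF D D'] by (simp add: scaleC.diff_right)
  then show "\<exists>D. ((\<lambda>z. m z - n z) has_derivative (\<lambda>h. h *\<^sub>C D)) (at z)" by blast
next
  fix \<epsilon> :: real assume \<epsilon>: "0 < \<epsilon>"
  obtain R where R: "\<forall>z\<in>strip. R \<le> \<bar>Im z\<bar> \<longrightarrow> norm (m z) \<le> \<epsilon> / 2" using entire_decaying_decay[OF assms(1) half_gt_zero[OF \<epsilon>]] by blast
  obtain R' where R': "\<forall>z\<in>strip. R' \<le> \<bar>Im z\<bar> \<longrightarrow> norm (n z) \<le> \<epsilon> / 2" using entire_decaying_decay[OF assms(2) half_gt_zero[OF \<epsilon>]] by blast
  have "norm (m z - n z) \<le> \<epsilon>" if "z \<in> strip" "max R R' \<le> \<bar>Im z\<bar>" for z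
  proof -
    have "norm (m z) \<le> \<epsilon> / 2" "norm (n z) \<le> \<epsilon> / 2" using R R' that by auto
    then show ?thesis using norm_triangle_ineq4[of "m z" "n z"] by linarith
  qed
  then show "\<exists>R. \<forall>z\<in>strip. R \<le> \<bar>Im z\<bar> \<longrightarrow> norm (m z - n z) \<le> \<epsilon>" by blast
qed

lemma entire_decaying_product:
  assumes m: "entire_decaying m" and n: "entire_decaying n" and \<alpha>: "0 < \<alpha>" "\<alpha> \<le> 1" and \<beta>: "0 \<le> \<beta>" "\<beta> \<le> 1"
  shows "entire_decaying (\<lambda>z. m (of_real \<alpha> * z) \<circ>\<^sub>J n (of_real \<beta> * z))"
  unfolding entire_decaying_def
proof (intro conjI allI impI)
  fix z
  obtain D where D: "((\<lambda>z. m (of_real \<alpha> * z + 0)) has_derivative (\<lambda>h. (of_real \<alpha> * h) *\<^sub>C D)) (at z)"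
    using entire_decaying_compose_affine_derivative[OF m] by blast
  obtain D' where D': "((\<lambda>z. n (of_real \<beta> * z + 0)) has_derivative (\<lambda>h. (of_real \<beta> * h) *\<^sub>C D')) (at z)"
    using entire_decaying_compose_affine_derivative[OF n] by blast
  have "((\<lambda>z. m (of_real \<alpha> * z + 0) \<circ>\<^sub>J n (of_real \<beta> * z + 0)) has_derivative
    (\<lambda>h. h *\<^sub>C (of_real \<beta> *\<^sub>C (m (of_real \<alpha> * z) \<circ>\<^sub>J D') + of_real \<alpha> *\<^sub>C (D \<circ>\<^sub>J n (of_real \<beta> * z))))) (at z)"
    by (rule has_derivative_eq_rhs[OF jordan.FDERIV[OF D D']])
      (simp add: fun_eq_iff jordan_scaleC jordan_scaleC_right scaleC.add_right scaleC_scaleC mult.commute del: scaleC_of_real)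
  then show "\<exists>D. ((\<lambda>z. m (of_real \<alpha> * z) \<circ>\<^sub>J n (of_real \<beta> * z)) has_derivative (\<lambda>h. h *\<^sub>C D)) (at z)"
    by auto
next
  fix \<epsilon> :: real assume \<epsilon>: "0 < \<epsilon>"
  obtain C where C: "\<And>z. z \<in> strip \<Longrightarrow> norm (n z) \<le> C" using entire_decaying_bounded[OF n] by blast
  have C0: "0 \<le> C" using order_trans[OF norm_ge_zero C[of 0]] by (simp add: strip_def)
  have "0 < \<epsilon> / (C + 1)" using \<epsilon> C0 by simp
  then obtain R where R: "\<forall>z\<in>strip. R \<le> \<bar>Im z\<bar> \<longrightarrow> norm (m z) \<le> \<epsilon> / (C + 1)" using entire_decaying_decay[OF m] by blast
  have sc: "of_real s * z \<in> strip" if "0 \<le> s" "s \<le> 1" "z \<in> strip" for s z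
    using that mult_mono[of s 1 "Re z" 1] by (auto simp: strip_def)
  have "norm (m (of_real \<alpha> * z) \<circ>\<^sub>J n (of_real \<beta> * z)) \<le> \<epsilon>" if z: "z \<in> strip" "R / \<alpha> \<le> \<bar>Im z\<bar>" for z
  proof -
    have "R \<le> \<bar>Im (of_real \<alpha> * z)\<bar>" using z \<alpha> by (simp add: abs_mult divide_le_eq mult.commute)
    then have "norm (m (of_real \<alpha> * z)) \<le> \<epsilon> / (C + 1)" using R sc[OF _ \<alpha>(2) z(1)] \<alpha> by auto
    moreover have "norm (n (of_real \<beta> * z)) \<le> C" by (rule C[OF sc[OF \<beta> z(1)]])
    ultimately have "norm (m (of_real \<alpha> * z)) * norm (n (of_real \<beta> * z)) \<le> \<epsilon> / (C + 1) * C"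
      using \<epsilon> C0 by (intro mult_mono) auto
    also have "\<dots> \<le> \<epsilon>" using \<epsilon> C0 by (simp add: field_simps)
    finally show ?thesis using norm_jordan order_trans by blast
  qed
  then show "\<exists>R. \<forall>z\<in>strip. R \<le> \<bar>Im z\<bar> \<longrightarrow> norm (m (of_real \<alpha> * z) \<circ>\<^sub>J n (of_real \<beta> * z)) \<le> \<epsilon>" by blast
qed

text \<open>
  On the right boundary the arguments of the factors have real parts \<open>\<alpha>\<close> and \<open>\<beta>\<close> with sum \<open>1\<close>, so that
  \<open>pairing_bound\<close> applies there.
\<close>

lemma product_admissible:
  assumes m: "entire_decaying m" "admissible (\<lambda>z. E (m z)) (\<lambda>t. m (Complex 0 t)) A"
    and n: "entire_decaying n" "admissible (\<lambda>z. E (n z)) (\<lambda>t. n (Complex 0 t)) B"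
    and \<alpha>: "0 < \<alpha>" "0 < \<beta>" "\<alpha> + \<beta> = 1"
  shows "admissible (\<lambda>z. E (m (of_real \<alpha> * z) \<circ>\<^sub>J n (of_real \<beta> * z)))
    (\<lambda>t. m (of_real \<alpha> * Complex 0 t) \<circ>\<^sub>J n (of_real \<beta> * Complex 0 t)) (A * B)"
proof (rule entire_decaying_admissible)
  have A0: "0 \<le> A" using order_trans[OF norm_ge_zero admissibleD(8)[OF m(2)]] .
  show "entire_decaying (\<lambda>z. m (of_real \<alpha> * z) \<circ>\<^sub>J n (of_real \<beta> * z))"
    using \<alpha> by (intro entire_decaying_product m n) auto
  fix t
  have 0: "of_real s * Complex 0 t = Complex 0 (s * t)" "of_real s * Complex 1 t = Complex s (s * t)" for s
    by (simp_all add: complex_eq_iff)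
  show "norm (m (of_real \<alpha> * Complex 0 t) \<circ>\<^sub>J n (of_real \<beta> * Complex 0 t)) \<le> A * B"
    unfolding 0 by (rule order_trans[OF norm_jordan mult_mono[OF admissibleD(8)[OF m(2)] admissibleD(8)[OF n(2)] A0 norm_ge_zero]])
  show "norm (E (m (of_real \<alpha> * Complex 1 t) \<circ>\<^sub>J n (of_real \<beta> * Complex 1 t))) \<le> A * B"
    unfolding 0 using pairing_bound[OF m(2) n, of \<alpha> \<beta> "\<alpha> * t" "\<beta> * t"] \<alpha> by (simp add: act_trace_embed)
qed

text \<open>
  The best bound is read off from the boundary values.
\<close>

lemma admissible_improve:
  assumes f: "admissible f g A" and left: "\<And>t. norm (g t) \<le> A'" and right: "\<And>t. norm (f (Complex 1 t)) \<le> A'"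
  shows "admissible f g A'"
proof -
  have left': "norm (f (Complex 0 t)) \<le> A'" for t
    using norm_trace_embed[of "g t"] left[of t] by (simp add: admissibleD(5)[OF f])
  have "norm (f z) \<le> A'" if "z \<in> strip" for z
    by (rule strip_maximum_principle_dual[OF admissibleD(2,3)[OF f] admissibleD(4)[OF f] left' right that])
  then show ?thesis using f left by (simp add: admissible_def)
qed

lemma entire_decaying_approximation_sequence:
  assumes f: "admissible f g A"
  shows "\<exists>m. \<forall>k::nat. entire_decaying (m k) \<and> admissible (\<lambda>z. E (m k z)) (\<lambda>t. m k (Complex 0 t)) (A + 1 / real (Suc k)) \<and>
    admissible (\<lambda>z. f z - E (m k z)) (\<lambda>t. g t - m k (Complex 0 t)) (1 / real (Suc k))"
proof (rule choice, rule allI)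
  fix k
  define \<epsilon> where "\<epsilon> = 1 / real (Suc k)"
  have "0 < \<epsilon>" by (simp add: \<epsilon>_def)
  then obtain n where n: "entire_decaying n" "\<And>t. norm (g t - n (Complex 0 t)) \<le> \<epsilon>"
    "\<And>t. norm (f (Complex 1 t) - E (n (Complex 1 t))) \<le> \<epsilon>"
    using entire_decaying_approximation[OF f] by blast
  have nA: "admissible (\<lambda>z. E (n z)) (\<lambda>t. n (Complex 0 t)) (A + \<epsilon>)"
  proof (rule entire_decaying_admissible[OF n(1)])
    show "norm (n (Complex 0 t)) \<le> A + \<epsilon>" for t
      using n(2)[of t] admissibleD(8)[OF f, of t] norm_triangle_ineq4[of "g t" "g t - n (Complex 0 t)"] by simp
    show "norm (E (n (Complex 1 t))) \<le> A + \<epsilon>" for t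
      using n(3)[of t] admissibleD(4)[OF f, of "Complex 1 t"]
        norm_triangle_ineq4[of "f (Complex 1 t)" "f (Complex 1 t) - E (n (Complex 1 t))"] by simp
  qed
  have "admissible (\<lambda>z. f z - E (n z)) (\<lambda>t. g t - n (Complex 0 t)) \<epsilon>"
    by (rule admissible_improve[OF admissible_diff[OF f nA] n(2,3)])
  with n(1) nA show "\<exists>m. entire_decaying m \<and> admissible (\<lambda>z. E (m z)) (\<lambda>t. m (Complex 0 t)) (A + 1 / real (Suc k)) \<and>
    admissible (\<lambda>z. f z - E (m z)) (\<lambda>t. g t - m (Complex 0 t)) (1 / real (Suc k))"
    unfolding \<epsilon>_def by blast
qed

text \<open>
  Only one of the two functions in \<open>pairing_bound\<close> has to take values in the algebra, and the roles can be
  exchanged: \<open>h\<close> is approximated, while \<open>y\<close> is represented by an arbitrary admissible function. So the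
  bound involves the interpolation norm of \<open>y\<close>.
\<close>

lemma interp_pairing_bound:
  assumes h: "interp_le a h A" and y: "interp_le b (E y) B" and ab: "0 < a" "0 < b" "a + b \<le> 1"
  shows "norm (act h y) \<le> A * B"
proof -
  obtain f g where f: "admissible f g A" "f (of_real a) = h" using h unfolding interp_le_def by blast
  obtain f2 g2 where f2: "admissible f2 g2 B" "f2 (of_real b) = E y" using y unfolding interp_le_def by blast
  obtain m where m: "\<And>k::nat. entire_decaying (m k)" "\<And>k. admissible (\<lambda>z. E (m k z)) (\<lambda>t. m k (Complex 0 t)) (A + 1 / real (Suc k))"
    "\<And>k. admissible (\<lambda>z. f z - E (m k z)) (\<lambda>t. g t - m k (Complex 0 t)) (1 / real (Suc k))"
    using entire_decaying_approximation_sequence[OF f(1)] by blast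
  have as: "of_real a \<in> strip" using ab by (simp add: strip_def)
  have "norm (act h y) \<le> 1 / real (Suc k) * norm y + B * (A + 1 / real (Suc k))" for k
  proof -
    let ?x = "m k (of_real a)"
    have "norm (h - E ?x) \<le> 1 / real (Suc k)" using admissibleD(4)[OF m(3) as] by (simp add: f(2))
    then have 1: "norm (act (h - E ?x) y) \<le> 1 / real (Suc k) * norm y"
      using order_trans[OF norm_act mult_right_mono[OF _ norm_ge_zero]] by blast
    have "norm (act (f2 (Complex b 0)) (m k (Complex a 0))) \<le> B * (A + 1 / real (Suc k))"
      by (rule pairing_bound[OF f2(1) m(1,2)]) (use ab in auto)
    then have 2: "norm (act (E ?x) y) \<le> B * (A + 1 / real (Suc k))"
      using f2(2) by (simp add: of_real_Complex act_trace_embed_commute[of _ y])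
    have "act h y = act (h - E ?x) y + act (E ?x) y" by (simp add: act_diff_left)
    then show ?thesis using norm_triangle_mono[OF 1 2] by (simp only:)
  qed
  moreover have "(\<lambda>k. 1 / real (Suc k) * norm y + B * (A + 1 / real (Suc k))) \<longlonglongrightarrow> 0 * norm y + B * (A + 0)"
    by (intro tendsto_intros null_sequence)
  ultimately have "norm (act h y) \<le> 0 * norm y + B * (A + 0)"
    by (intro LIMSEQ_le_const) blast+
  then show ?thesis by (simp add: mult.commute)
qed

lemma interp_add: "interp_le \<theta> h A \<Longrightarrow> interp_le \<theta> h' A' \<Longrightarrow> interp_le \<theta> (h + h') (A + A')"
  unfolding interp_le_def using admissible_add by fastforce

lemma interp_diff: "interp_le \<theta> h A \<Longrightarrow> interp_le \<theta> h' A' \<Longrightarrow> interp_le \<theta> (h - h') (A + A')"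
  unfolding interp_le_def using admissible_diff by fastforce

lemma interp_scaleC: "interp_le \<theta> h A \<Longrightarrow> interp_le \<theta> (c *\<^sub>C h) (cmod c * A)"
  unfolding interp_le_def using admissible_scaleC by fastforce

lemma interp_act: "interp_le \<theta> h A \<Longrightarrow> interp_le \<theta> (act h x) (A * norm x)"
  unfolding interp_le_def using admissible_act by fastforce

lemma interp_zero: "interp_le \<theta> 0 0"
proof -
  have "admissible (\<lambda>_. 0) (\<lambda>_. 0) 0"
    using trace_embed_diff[of 0 0] by (simp add: admissible_def predual_zero)
  then show ?thesis unfolding interp_le_def by blast
qed

lemma interp_nonneg: "interp_le \<theta> h A \<Longrightarrow> 0 \<le> A"
  unfolding interp_le_def using order_trans[OF norm_ge_zero admissibleD(8)] by blast

lemma interp_predual: "interp_le \<theta> h A \<Longrightarrow> 0 \<le> \<theta> \<Longrightarrow> \<theta> \<le> 1 \<Longrightarrow> h \<in> P"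
  unfolding interp_le_def using admissibleD(1)[of _ _ _ "of_real \<theta>"] by (force simp: strip_def)

section \<open>The product of two interpolation spaces\<close>

text \<open>
  Convergence of elements of the algebra to \<open>k\<close> in the interpolation space with parameter \<open>b\<close>.
\<close>

definition approx_seq :: "real \<Rightarrow> ('a \<Rightarrow>\<^sub>L complex) \<Rightarrow> (nat \<Rightarrow> 'a) \<Rightarrow> bool"
  where "approx_seq b k y \<longleftrightarrow> (\<exists>A. A \<longlonglongrightarrow> 0 \<and> (\<forall>n. interp_le b (k - E (y n)) (A n)))"

lemma approx_seq_exists: "interp_le b k B \<Longrightarrow> \<exists>y. approx_seq b k y"
proof -
  assume "interp_le b k B"
  then obtain f g where f: "admissible f g B" "f (of_real b) = k" unfolding interp_le_def by blast
  obtain m where m: "\<And>n::nat. admissible (\<lambda>z. f z - E (m n z)) (\<lambda>t. g t - m n (Complex 0 t)) (1 / real (Suc n))"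
    using entire_decaying_approximation_sequence[OF f(1)] by blast
  have "interp_le b (k - E (m n (of_real b))) (1 / real (Suc n))" for n
    unfolding interp_le_def using m[of n] f(2) by blast
  then have "approx_seq b k (\<lambda>n. m n (of_real b))"
    unfolding approx_seq_def using null_sequence by blast
  then show ?thesis by blast
qed

lemma approx_seq_add:
  assumes "approx_seq b k y" "approx_seq b k' y'"
  shows "approx_seq b (k + k') (\<lambda>n. y n + y' n)"
proof -
  obtain A where A: "A \<longlonglongrightarrow> 0" "\<And>n. interp_le b (k - E (y n)) (A n)" using assms(1) unfolding approx_seq_def by blast
  obtain A' where A': "A' \<longlonglongrightarrow> 0" "\<And>n. interp_le b (k' - E (y' n)) (A' n)" using assms(2) unfolding approx_seq_def by blast
  have "interp_le b (k + k' - E (y n + y' n)) (A n + A' n)" for n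
    using interp_add[OF A(2)[of n] A'(2)[of n]] by (simp add: trace_embed_add algebra_simps)
  moreover have "(\<lambda>n. A n + A' n) \<longlonglongrightarrow> 0" using tendsto_add[OF A(1) A'(1)] by simp
  ultimately show ?thesis unfolding approx_seq_def by blast
qed

lemma approx_seq_scaleC:
  assumes "approx_seq b k y"
  shows "approx_seq b (c *\<^sub>C k) (\<lambda>n. c *\<^sub>C y n)"
proof -
  obtain A where A: "A \<longlonglongrightarrow> 0" "\<And>n. interp_le b (k - E (y n)) (A n)" using assms(1) unfolding approx_seq_def by blast
  have "interp_le b (c *\<^sub>C k - E (c *\<^sub>C y n)) (cmod c * A n)" for n
    using interp_scaleC[OF A(2)[of n], of c] by (simp add: trace_embed_scaleC scaleC.diff_right)
  moreover have "(\<lambda>n. cmod c * A n) \<longlonglongrightarrow> 0" by (rule tendsto_mult_right_zero[OF A(1)])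
  ultimately show ?thesis unfolding approx_seq_def by blast
qed

text \<open>
  The limit does not depend on the approximating sequence (\<open>lp_product_lim\<close>).
\<close>

definition lp_product :: "real \<Rightarrow> ('a \<Rightarrow>\<^sub>L complex) \<Rightarrow> ('a \<Rightarrow>\<^sub>L complex) \<Rightarrow> ('a \<Rightarrow>\<^sub>L complex)"
  where "lp_product b h k = lim (\<lambda>n. act h ((SOME y. approx_seq b k y) n))"

text \<open>
  By \<open>interp_pairing_bound\<close> the distance of \<open>act h (u i)\<close> and \<open>act h (v j)\<close> is controlled by the distances of
  \<open>u i\<close> and \<open>v j\<close> to \<open>k\<close>.
\<close>

lemma lp_product_lim:
  assumes h: "interp_le a h A" and y: "approx_seq b k y" and ab: "0 < a" "0 < b" "a + b \<le> 1"
  shows "(\<lambda>n. act h (y n)) \<longlonglongrightarrow> lp_product b h k"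
proof -
  have diff: "\<exists>e. e \<longlonglongrightarrow> 0 \<and> (\<forall>i j. norm (act h (u i) - act h (v j)) \<le> A * (fst (e i) + snd (e j)))"
    if u: "approx_seq b k u" and v: "approx_seq b k v" for u v
  proof -
    obtain U where U: "U \<longlonglongrightarrow> 0" "\<And>n. interp_le b (k - E (u n)) (U n)" using u unfolding approx_seq_def by blast
    obtain V where V: "V \<longlonglongrightarrow> 0" "\<And>n. interp_le b (k - E (v n)) (V n)" using v unfolding approx_seq_def by blast
    have "norm (act h (u i) - act h (v j)) \<le> A * (U i + V j)" for i j
    proof -
      have "interp_le b (E (u i - v j)) (V j + U i)"
        using interp_diff[OF V(2)[of j] U(2)[of i]] by (simp add: trace_embed_diff)
      from interp_pairing_bound[OF h this ab] show ?thesis by (simp add: act_diff_right add.commute)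
    qed
    moreover have "(\<lambda>i. (U i, V i)) \<longlonglongrightarrow> 0" using tendsto_Pair[OF U(1) V(1)] by (simp add: zero_prod_def)
    ultimately show ?thesis by (intro exI[of _ "\<lambda>i. (U i, V i)"]) simp
  qed
  define u where "u = (SOME y. approx_seq b k y)"
  have u: "approx_seq b k u" unfolding u_def by (rule someI[of _ y]) (rule y)
  obtain e where e: "e \<longlonglongrightarrow> 0" "\<And>i j. norm (act h (u i) - act h (u j)) \<le> A * (fst (e i) + snd (e j))"
    using diff[OF u u] by blast
  have e1: "(\<lambda>n. A * fst (e n)) \<longlonglongrightarrow> 0" and e2: "(\<lambda>n. A * snd (e n)) \<longlonglongrightarrow> 0"
    using tendsto_mult_right_zero[OF tendsto_fst[OF e(1), unfolded fst_zero]] tendsto_mult_right_zero[OF tendsto_snd[OF e(1), unfolded snd_zero]] by auto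
  have "Cauchy (\<lambda>n. act h (u n))"
    unfolding Cauchy_iff
  proof (intro allI impI)
    fix r :: real assume r: "0 < r"
    have "\<forall>\<^sub>F n in sequentially. A * fst (e n) < r / 2 \<and> A * snd (e n) < r / 2"
      using order_tendstoD(2)[OF e1 half_gt_zero[OF r]] order_tendstoD(2)[OF e2 half_gt_zero[OF r]] by (rule eventually_conj)
    then obtain N where N: "\<And>n. n \<ge> N \<Longrightarrow> A * fst (e n) < r / 2 \<and> A * snd (e n) < r / 2" by (auto simp: eventually_sequentially)
    have "norm (act h (u i) - act h (u j)) < r" if "i \<ge> N" "j \<ge> N" for i j
      using e(2)[of i j] N[OF that(1)] N[OF that(2)] unfolding distrib_left by linarith
    then show "\<exists>M. \<forall>m\<ge>M. \<forall>n\<ge>M. norm (act h (u m) - act h (u n)) < r" by blast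
  qed
  then have lim: "(\<lambda>n. act h (u n)) \<longlonglongrightarrow> lp_product b h k"
    unfolding lp_product_def u_def[symmetric] by (simp add: Cauchy_convergent convergent_LIMSEQ_iff[symmetric])
  obtain d where d: "d \<longlonglongrightarrow> 0" "\<And>i j. norm (act h (y i) - act h (u j)) \<le> A * (fst (d i) + snd (d j))"
    using diff[OF y u] by blast
  have "(\<lambda>n. A * (fst (d n) + snd (d n))) \<longlonglongrightarrow> A * (fst (0::real \<times> real) + snd (0::real \<times> real))"
    by (intro tendsto_intros d(1))
  then have "(\<lambda>n. act h (y n) - act h (u n)) \<longlonglongrightarrow> 0"
    by (intro Lim_null_comparison[OF always_eventually[OF allI[OF d(2)]]]) simp
  from tendsto_add[OF this lim] show ?thesis by simp
qed

lemma lp_product_add_left: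
  assumes "interp_le a h A" "interp_le a h' A'" "interp_le b k B" and ab: "0 < a" "0 < b" "a + b \<le> 1"
  shows "lp_product b (h + h') k = lp_product b h k + lp_product b h' k"
proof -
  obtain y where y: "approx_seq b k y" using approx_seq_exists assms(3) by blast
  show ?thesis
    using tendsto_add[OF lp_product_lim[OF assms(1) y ab] lp_product_lim[OF assms(2) y ab]]
      lp_product_lim[OF interp_add[OF assms(1,2)] y ab]
    by (intro LIMSEQ_unique) (simp_all add: act_add_left)
qed

lemma lp_product_scaleC_left:
  assumes "interp_le a h A" "interp_le b k B" and ab: "0 < a" "0 < b" "a + b \<le> 1"
  shows "lp_product b (c *\<^sub>C h) k = c *\<^sub>C lp_product b h k"
proof -
  obtain y where y: "approx_seq b k y" using approx_seq_exists assms(2) by blast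
  show ?thesis
    using scaleC.tendsto[OF tendsto_const lp_product_lim[OF assms(1) y ab]]
      lp_product_lim[OF interp_scaleC[OF assms(1)] y ab]
    by (intro LIMSEQ_unique) (simp_all add: act_scaleC_left)
qed

lemma lp_product_add_right:
  assumes "interp_le a h A" "interp_le b k B" "interp_le b k' B'" and ab: "0 < a" "0 < b" "a + b \<le> 1"
  shows "lp_product b h (k + k') = lp_product b h k + lp_product b h k'"
proof -
  obtain y y' where y: "approx_seq b k y" "approx_seq b k' y'" using approx_seq_exists assms(2,3) by blast
  show ?thesis
    using tendsto_add[OF lp_product_lim[OF assms(1) y(1) ab] lp_product_lim[OF assms(1) y(2) ab]]
      lp_product_lim[OF assms(1) approx_seq_add[OF y] ab]
    by (intro LIMSEQ_unique) (simp_all add: act_add_right)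
qed

lemma lp_product_scaleC_right:
  assumes "interp_le a h A" "interp_le b k B" and ab: "0 < a" "0 < b" "a + b \<le> 1"
  shows "lp_product b h (c *\<^sub>C k) = c *\<^sub>C lp_product b h k"
proof -
  obtain y where y: "approx_seq b k y" using approx_seq_exists assms(2) by blast
  have h: "h \<in> dual_space" using interp_predual[OF assms(1)] ab predual_sub_dual by auto
  show ?thesis
    using scaleC.tendsto[OF tendsto_const lp_product_lim[OF assms(1) y ab]]
      lp_product_lim[OF assms(1) approx_seq_scaleC[OF y] ab]
    by (intro LIMSEQ_unique) (simp_all add: act_scaleC_right[OF h])
qed

text \<open>
  The constant function \<open>x\<close> does not decay; the factor \<open>exp (z\<^sup>2 - a\<^sup>2)\<close>, which is \<open>1\<close> at \<open>a\<close>, repairs this.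
\<close>

lemma interp_embed: "\<exists>A. interp_le a (E x) A"
proof -
  define n where "n z = exp (z^2 - (of_real a)^2) *\<^sub>C x" for z :: complex
  have entire_decaying: "entire_decaying n"
    unfolding entire_decaying_def
  proof (intro conjI allI impI)
    fix z
    have "((\<lambda>z::complex. exp (z^2 - (of_real a)^2)) has_field_derivative exp (z^2 - (of_real a)^2) * (2 * z)) (at z)"
      by (auto intro!: derivative_eq_intros)
    then have "((\<lambda>z::complex. exp (z^2 - (of_real a)^2)) has_derivative (\<lambda>h. (exp (z^2 - (of_real a)^2) * (2 * z)) * h)) (at z)"
      by (simp add: has_field_derivative_def mult_commute_abs)
    from bounded_linear.has_derivative[OF scaleC.bounded_linear_left[of x] this]
    show "\<exists>D. (n has_derivative (\<lambda>h. h *\<^sub>C D)) (at z)"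
      unfolding n_def
      by (intro exI[of _ "(exp (z^2 - (of_real a)^2) * (2 * z)) *\<^sub>C x"]) (simp add: scaleC_scaleC mult.commute mult.left_commute)
  next
    fix e :: real assume e: "0 < e"
    have "((\<lambda>r::real. exp (1 - r^2) * norm x) \<longlongrightarrow> 0) at_top" by real_asymp
    then have "\<forall>\<^sub>F r in at_top. exp (1 - r^2) * norm x < e" using e by (rule order_tendstoD(2))
    then obtain R where R: "\<And>r. R \<le> r \<Longrightarrow> exp (1 - r^2) * norm x < e" by (auto simp: eventually_at_top_linorder)
    have "norm (n z) \<le> e" if z: "z \<in> strip" "R \<le> \<bar>Im z\<bar>" for z
    proof -
      have "(Re z)^2 \<le> 1" using z by (auto simp: strip_def abs_square_le_1)
      moreover have "0 \<le> a^2" by simp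
      ultimately have "(Re z)^2 - (Im z)^2 - a^2 \<le> 1 - (Im z)^2" by linarith
      then have "cmod (exp (z^2 - (of_real a)^2)) \<le> exp (1 - (Im z)^2)"
        by (simp add: power2_eq_square)
      then have "norm (n z) \<le> exp (1 - (Im z)^2) * norm x"
        unfolding n_def norm_scaleC by (rule mult_right_mono) simp
      then show ?thesis using R[OF z(2)] by simp
    qed
    then show "\<exists>R. \<forall>z\<in>strip. R \<le> \<bar>Im z\<bar> \<longrightarrow> norm (n z) \<le> e" by blast
  qed
  obtain C where C: "\<And>z. z \<in> strip \<Longrightarrow> norm (n z) \<le> C" using entire_decaying_bounded[OF entire_decaying] by blast
  have "admissible (\<lambda>z. E (n z)) (\<lambda>t. n (Complex 0 t)) C"
    by (rule entire_decaying_admissible[OF entire_decaying]) (auto intro!: C order_trans[OF norm_trace_embed])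
  moreover have "E (n (of_real a)) = E x" by (simp add: n_def)
  ultimately show ?thesis unfolding interp_le_def by blast
qed

lemma lp_product_embed:
  assumes ab: "0 < a" "0 < b" "a + b \<le> 1"
  shows "lp_product b (E x) (E y) = E (x \<circ>\<^sub>J y)"
proof -
  obtain A where A: "interp_le a (E x) A" using interp_embed by blast
  have "approx_seq b (E y) (\<lambda>_. y)"
    unfolding approx_seq_def using interp_zero by (intro exI[of _ "\<lambda>_. 0"]) simp
  from lp_product_lim[OF A this ab] show ?thesis by (simp add: LIMSEQ_const_iff act_trace_embed)
qed

lemma lp_product_norm:
  assumes h: "interp_le a h A" and k: "interp_le b k B" and ab: "0 < a" "0 < b" "a + b \<le> 1"
  shows "lp_product b h k \<in> P" "norm (lp_product b h k) \<le> A * B"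
proof -
  obtain y where y: "approx_seq b k y" using approx_seq_exists k by blast
  then obtain e where e: "e \<longlonglongrightarrow> 0" "\<And>n. interp_le b (k - E (y n)) (e n)" unfolding approx_seq_def by blast
  note lim = lp_product_lim[OF h y ab]
  have "h \<in> P" using interp_predual[OF h] ab by simp
  then show "lp_product b h k \<in> P"
    by (intro Lim_in_closed_set[OF predual_closed _ _ lim]) (auto intro!: always_eventually predual_act)
  have le: "norm (act h (y n)) \<le> A * (B + e n)" for n
  proof -
    have "interp_le b (E (y n)) (B + e n)" using interp_diff[OF k e(2)[of n]] by simp
    from interp_pairing_bound[OF h this ab] show ?thesis .
  qed
  have "(\<lambda>n. A * (B + e n)) \<longlonglongrightarrow> A * (B + 0)" by (intro tendsto_intros e(1))
  then have "norm (lp_product b h k) \<le> A * (B + 0)"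
    by (rule LIMSEQ_le[OF tendsto_norm[OF lim]]) (use le in blast)
  then show "norm (lp_product b h k) \<le> A * B" by simp
qed

text \<open>
  Completeness of Calderon's space. Weak holomorphy passes to uniform limits.
\<close>

lemma admissible_complete:
  assumes admissible: "\<And>n::nat. admissible (F n) (G n) (A n)" and A: "A \<longlonglongrightarrow> B"
    and cauchy: "\<And>i j. admissible (\<lambda>z. F i z - F j z) (\<lambda>t. G i t - G j t) (d i j)"
    and d: "\<And>\<epsilon>. 0 < \<epsilon> \<Longrightarrow> \<exists>N. \<forall>i\<ge>N. \<forall>j\<ge>N. d i j < \<epsilon>"
  shows "\<exists>f g. admissible f g B \<and> (\<forall>z\<in>strip. (\<lambda>n. F n z) \<longlonglongrightarrow> f z)"
proof -
  have "uniformly_Cauchy_on strip F"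
    unfolding uniformly_Cauchy_on_def dist_norm
  proof (intro allI impI)
    fix e :: real assume "0 < e"
    then obtain N where N: "\<forall>i\<ge>N. \<forall>j\<ge>N. d i j < e" using d by blast
    show "\<exists>M. \<forall>x\<in>strip. \<forall>m\<ge>M. \<forall>n\<ge>M. norm (F m x - F n x) < e"
      by (intro exI[of _ N] ballI allI impI) (use N admissibleD(4)[OF cauchy] le_less_trans in blast)
  qed
  then obtain f where f: "uniform_limit strip F f sequentially"
    using Cauchy_uniformly_convergent by (auto simp: uniformly_convergent_on_def)
  have "uniformly_Cauchy_on UNIV G"
    unfolding uniformly_Cauchy_on_def dist_norm
  proof (intro allI impI)
    fix e :: real assume "0 < e"
    then obtain N where N: "\<forall>i\<ge>N. \<forall>j\<ge>N. d i j < e" using d by blast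
    show "\<exists>M. \<forall>x\<in>UNIV. \<forall>m\<ge>M. \<forall>n\<ge>M. norm (G m x - G n x) < e"
      by (intro exI[of _ N] ballI allI impI) (use N admissibleD(8)[OF cauchy] le_less_trans in blast)
  qed
  then obtain g where g: "uniform_limit UNIV G g sequentially"
    using Cauchy_uniformly_convergent by (auto simp: uniformly_convergent_on_def)
  have flim: "(\<lambda>n. F n z) \<longlonglongrightarrow> f z" if "z \<in> strip" for z using tendsto_uniform_limitI[OF f that] .
  have glim: "(\<lambda>n. G n t) \<longlonglongrightarrow> g t" for t using tendsto_uniform_limitI[OF g] by simp
  have vanish: "(h \<longlongrightarrow> 0) at_infinity"
    if lim: "uniform_limit UNIV H h sequentially" and zero: "\<And>n. (H n \<longlongrightarrow> 0) at_infinity"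
    for H :: "nat \<Rightarrow> real \<Rightarrow> 'c::real_normed_vector" and h
  proof (rule tendstoI)
    fix e :: real assume e: "0 < e"
    obtain n where n: "\<And>t. dist (H n t) (h t) < e / 2"
      using uniform_limitD[OF lim half_gt_zero[OF e]] by (auto simp: eventually_sequentially)
    show "\<forall>\<^sub>F t in at_infinity. dist (h t) 0 < e"
    proof (rule eventually_mono[OF tendstoD[OF zero[of n] half_gt_zero[OF e]]])
      fix t assume "dist (H n t) 0 < e / 2"
      then show "dist (h t) 0 < e" using n[of t] dist_triangle[of "h t" 0 "H n t"] by (simp add: dist_commute)
    qed
  qed
  have "admissible f g B"
    unfolding admissible_def
  proof (intro conjI ballI allI)
    show "f z \<in> P" if "z \<in> strip" for z
      by (rule Lim_in_closed_set[OF predual_closed _ _ flim[OF that]]) (use that admissibleD(1)[OF admissible] in auto)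
    show "continuous_on strip f"
      by (rule uniform_limit_theorem[OF _ f]) (use admissibleD(2)[OF admissible] in auto)
    show "norm (f z) \<le> B" if "z \<in> strip" for z
      by (rule LIMSEQ_le[OF tendsto_norm[OF flim[OF that]] A]) (use that admissibleD(4)[OF admissible] in auto)
    show "norm (g t) \<le> B" for t
      by (rule LIMSEQ_le[OF tendsto_norm[OF glim] A]) (use admissibleD(8)[OF admissible] in auto)
    show "continuous_on UNIV g"
      by (rule uniform_limit_theorem[OF _ g]) (use admissibleD(6)[OF admissible] in auto)
    show "(g \<longlongrightarrow> 0) at_infinity" by (rule vanish[OF g admissibleD(7)[OF admissible]])
    have "uniform_limit UNIV (\<lambda>n t. F n (Complex 1 t)) (\<lambda>t. f (Complex 1 t)) sequentially"
      by (rule uniform_limit_compose'[OF f]) auto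
    then show "((\<lambda>t. f (Complex 1 t)) \<longlongrightarrow> 0) at_infinity" by (rule vanish[OF _ admissibleD(9)[OF admissible]])
    show "f (Complex 0 t) = E (g t)" for t
    proof (rule LIMSEQ_unique[OF flim])
      have "(\<lambda>n. E (G n t - g t)) \<longlonglongrightarrow> 0"
        by (rule Lim_null_comparison[OF always_eventually[OF allI[OF norm_trace_embed]]])
          (rule tendsto_norm_zero[OF LIM_zero[OF glim]])
      then show "(\<lambda>n. F n (Complex 0 t)) \<longlonglongrightarrow> E (g t)"
        by (simp add: admissibleD(5)[OF admissible] trace_embed_diff LIM_zero_iff)
    qed simp
    show "(\<lambda>z. blinfun_apply (f z) y) holomorphic_on open_strip" for y
    proof (rule holomorphic_uniform_sequence[OF open_open_strip admissibleD(3)[OF admissible]])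
      fix z assume "z \<in> open_strip"
      then obtain r where r: "0 < r" "cball z r \<subseteq> open_strip" using open_open_strip open_contains_cball by blast
      have "uniform_limit strip (\<lambda>n z. blinfun_apply (F n z) y) (\<lambda>z. blinfun_apply (f z) y) sequentially"
        by (rule bounded_linear.uniform_limit[OF blinfun.bounded_linear_left f])
      then have "uniform_limit (cball z r) (\<lambda>n z. blinfun_apply (F n z) y) (\<lambda>z. blinfun_apply (f z) y) sequentially"
        by (rule uniform_limit_on_subset) (use r open_strip_subset in blast)
      with r show "\<exists>d>0. cball z d \<subseteq> open_strip \<and> uniform_limit (cball z d) (\<lambda>n z. blinfun_apply (F n z) y) (\<lambda>z. blinfun_apply (f z) y) sequentially"
        by blast
    qed
  qed
  then show ?thesis using flim by blast
qed

text \<open>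
  With \<open>\<alpha> = a / (a + b)\<close> and \<open>\<beta> = b / (a + b)\<close>, the functions \<open>H n z = m n (\<alpha> z) \<circ> l n (\<beta> z)\<close>, built from approximations \<open>m n\<close>
  of \<open>f\<close> and \<open>l n\<close> of \<open>f2\<close>, form a Cauchy sequence in Calderon's space whose limit
  has the value \<open>lp_product b h k\<close> at \<open>a + b\<close>.
\<close>

lemma lp_product_interp:
  assumes h: "interp_le a h A" and k: "interp_le b k B" and ab: "0 < a" "0 < b" "a + b \<le> 1"
  shows "interp_le (a + b) (lp_product b h k) (A * B)"
proof -
  obtain f g where f: "admissible f g A" "f (of_real a) = h" using h unfolding interp_le_def by blast
  obtain f2 g2 where f2: "admissible f2 g2 B" "f2 (of_real b) = k" using k unfolding interp_le_def by blast
  define e where "e n = 1 / real (Suc n)" for n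
  have e0: "0 < e n" "e n \<le> 1" for n by (auto simp: e_def)
  have elim: "e \<longlonglongrightarrow> 0" unfolding e_def by (rule null_sequence)
  obtain m where m: "\<And>n. entire_decaying (m n)" "\<And>n. admissible (\<lambda>z. E (m n z)) (\<lambda>t. m n (Complex 0 t)) (A + e n)"
    "\<And>n. admissible (\<lambda>z. f z - E (m n z)) (\<lambda>t. g t - m n (Complex 0 t)) (e n)"
    using entire_decaying_approximation_sequence[OF f(1)] unfolding e_def by blast
  obtain l where l: "\<And>n. entire_decaying (l n)" "\<And>n. admissible (\<lambda>z. E (l n z)) (\<lambda>t. l n (Complex 0 t)) (B + e n)"
    "\<And>n. admissible (\<lambda>z. f2 z - E (l n z)) (\<lambda>t. g2 t - l n (Complex 0 t)) (e n)"
    using entire_decaying_approximation_sequence[OF f2(1)] unfolding e_def by blast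
  have A0: "0 \<le> A" and B0: "0 \<le> B" using interp_nonneg h k by auto
  define \<alpha> where "\<alpha> = a / (a + b)"
  define \<beta> where "\<beta> = b / (a + b)"
  have \<alpha>: "0 < \<alpha>" "0 < \<beta>" "\<alpha> + \<beta> = 1" "\<alpha> * (a + b) = a" "\<beta> * (a + b) = b"
    using ab by (auto simp: \<alpha>_def \<beta>_def add_divide_distrib[symmetric])
  define H where "H n z = m n (of_real \<alpha> * z) \<circ>\<^sub>J l n (of_real \<beta> * z)" for n z
  have admissible_diff': "admissible (\<lambda>z. E (u i z - u j z)) (\<lambda>t. u i (Complex 0 t) - u j (Complex 0 t)) (e i + e j)"
    if "\<And>n. admissible (\<lambda>z. f z - E (u n z)) (\<lambda>t. g t - u n (Complex 0 t)) (e n)" for u f g i j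
    using admissible_diff[OF that[of j] that[of i]] by (simp add: trace_embed_diff add.commute)
  define d where "d i j = (e i + e j) * (B + e i) + (A + e j) * (e i + e j)" for i j
  have "\<exists>f g. admissible f g ((A + 0) * (B + 0)) \<and> (\<forall>z\<in>strip. (\<lambda>n. E (H n z)) \<longlonglongrightarrow> f z)"
  proof (rule admissible_complete)
    show "admissible (\<lambda>z. E (H n z)) (\<lambda>t. H n (Complex 0 t)) ((A + e n) * (B + e n))" for n
      unfolding H_def by (rule product_admissible[OF m(1,2) l(1,2) \<alpha>(1-3)])
    show "(\<lambda>n. (A + e n) * (B + e n)) \<longlonglongrightarrow> (A + 0) * (B + 0)" by (intro tendsto_intros elim)
    fix i j
    have 1: "admissible (\<lambda>z. E ((m i (of_real \<alpha> * z) - m j (of_real \<alpha> * z)) \<circ>\<^sub>J l i (of_real \<beta> * z)))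
      (\<lambda>t. (m i (of_real \<alpha> * Complex 0 t) - m j (of_real \<alpha> * Complex 0 t)) \<circ>\<^sub>J l i (of_real \<beta> * Complex 0 t)) ((e i + e j) * (B + e i))"
      by (rule product_admissible[OF entire_decaying_diff[OF m(1) m(1)] admissible_diff'[OF m(3)] l(1,2) \<alpha>(1-3)])
    have 2: "admissible (\<lambda>z. E (m j (of_real \<alpha> * z) \<circ>\<^sub>J (l i (of_real \<beta> * z) - l j (of_real \<beta> * z))))
      (\<lambda>t. m j (of_real \<alpha> * Complex 0 t) \<circ>\<^sub>J (l i (of_real \<beta> * Complex 0 t) - l j (of_real \<beta> * Complex 0 t))) ((A + e j) * (e i + e j))"
      by (rule product_admissible[OF m(1,2) entire_decaying_diff[OF l(1) l(1)] admissible_diff'[OF l(3)] \<alpha>(1-3)])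
    have split: "(x - x') \<circ>\<^sub>J v + x' \<circ>\<^sub>J (v - v') = x \<circ>\<^sub>J v - x' \<circ>\<^sub>J v'" for x x' v v' :: 'a
      by (simp add: jordan.diff_left jordan.diff_right)
    show "admissible (\<lambda>z. E (H i z) - E (H j z)) (\<lambda>t. H i (Complex 0 t) - H j (Complex 0 t)) (d i j)"
      using admissible_add[OF 1 2] unfolding trace_embed_add[symmetric] trace_embed_diff[symmetric] split H_def d_def .
  next
    fix \<epsilon> :: real assume \<epsilon>: "0 < \<epsilon>"
    \<comment> \<open>Both \<open>e i\<close> and \<open>e j\<close> are at most \<open>1\<close>.\<close>
    define M where "M = A + B + 2"
    have M: "0 < M" using A0 B0 by (simp add: M_def)
    have "\<forall>\<^sub>F n in sequentially. e n < \<epsilon> / (2 * M)" using \<epsilon> M by (intro order_tendstoD(2)[OF elim]) simp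
    then obtain N where N: "\<And>n. n \<ge> N \<Longrightarrow> e n < \<epsilon> / (2 * M)" by (auto simp: eventually_sequentially)
    have "d i j < \<epsilon>" if "i \<ge> N" "j \<ge> N" for i j
    proof -
      have "d i j = (e i + e j) * (A + B + e i + e j)" by (simp add: d_def algebra_simps)
      also have "\<dots> \<le> (e i + e j) * M"
        using e0(2)[of i] e0(2)[of j] less_imp_le[OF e0(1)] by (intro mult_left_mono) (auto simp: M_def)
      also have "\<dots> < (\<epsilon> / (2 * M) + \<epsilon> / (2 * M)) * M"
        using N[OF that(1)] N[OF that(2)] M by (intro mult_strict_right_mono) auto
      also have "\<dots> = \<epsilon>" using M by (simp add: field_simps)
      finally show ?thesis .
    qed
    then show "\<exists>N. \<forall>i\<ge>N. \<forall>j\<ge>N. d i j < \<epsilon>" by blast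
  qed
  then obtain v u where v: "admissible v u (A * B)" and lim: "\<And>z. z \<in> strip \<Longrightarrow> (\<lambda>n. E (H n z)) \<longlonglongrightarrow> v z" by auto
  have s: "of_real (a + b) \<in> strip" "of_real a \<in> strip" using ab by (auto simp: strip_def)
  have Hc: "E (H n (of_real (a + b))) = act (E (m n (of_real a))) (l n (of_real b))" for n
  proof -
    have "of_real \<alpha> * of_real (a + b) = (of_real a :: complex)" "of_real \<beta> * of_real (a + b) = (of_real b :: complex)"
      using \<alpha>(4,5) by (simp_all only: of_real_mult[symmetric])
    then show ?thesis by (simp add: H_def act_trace_embed)
  qed
  have "interp_le b (k - E (l n (of_real b))) (e n)" for n
    unfolding interp_le_def using l(3)[of n] f2(2) by blast
  then have "approx_seq b k (\<lambda>n. l n (of_real b))" unfolding approx_seq_def using elim by blast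
  from lp_product_lim[OF h this ab]
  have L: "(\<lambda>n. act h (l n (of_real b))) \<longlonglongrightarrow> lp_product b h k" .
  have le: "norm (act h (l n (of_real b)) - E (H n (of_real (a + b)))) \<le> e n * (B + e n)" for n
  proof -
    have "norm (act (f (Complex a 0) - E (m n (Complex a 0))) (l n (Complex b 0))) \<le> e n * (B + e n)"
      by (rule pairing_bound[OF m(3) l(1,2) ab])
    then show ?thesis using f(2) unfolding Hc by (simp add: of_real_Complex act_diff_left)
  qed
  have "(\<lambda>n. e n * (B + e n)) \<longlonglongrightarrow> 0 * (B + 0)" by (intro tendsto_intros elim)
  then have "(\<lambda>n. act h (l n (of_real b)) - E (H n (of_real (a + b)))) \<longlonglongrightarrow> 0"
    by (intro Lim_null_comparison[OF always_eventually[OF allI[OF le]]]) simp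
  from tendsto_diff[OF L this] have "(\<lambda>n. E (H n (of_real (a + b)))) \<longlonglongrightarrow> lp_product b h k" by simp
  then have "v (of_real (a + b)) = lp_product b h k" by (rule LIMSEQ_unique[OF lim[OF s(1)]])
  with v show ?thesis unfolding interp_le_def by blast
qed

abbreviation Li where "Li \<theta> \<equiv> complex_interpolation \<theta> Linf L1"

lemma holder_interpolation:
  assumes ab: "0 < a" "0 < b" "a + b \<le> 1"
    and Z: "Z = (if a + b = 1 then L1 else Li (a + b))"
  shows "\<exists>B. complex_bilinear_on (elems (Li a)) (elems (Li b)) B \<and>
    (\<forall>x y. B (E x) (E y) = E (x \<circ>\<^sub>J y)) \<and>
    (\<forall>h\<in>elems (Li a). \<forall>k\<in>elems (Li b). B h k \<in> elems Z \<and> nrm Z (B h k) \<le> nrm (Li a) h * nrm (Li b) k)"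
proof (intro exI[of _ "lp_product b"] conjI ballI allI)
  show "complex_bilinear_on (elems (Li a)) (elems (Li b)) (lp_product b)"
    unfolding complex_bilinear_on_def Ball_def interp_elems
    by (intro conjI allI impI; elim exE;
        rule lp_product_add_left[OF _ _ _ ab] lp_product_add_right[OF _ _ _ ab]
          lp_product_scaleC_left[OF _ _ ab] lp_product_scaleC_right[OF _ _ ab]; assumption)
  show "lp_product b (E x) (E y) = E (x \<circ>\<^sub>J y)" for x y by (rule lp_product_embed[OF ab])
  fix h k assume h: "h \<in> elems (Li a)" and k: "k \<in> elems (Li b)"
  have hk: "interp_le a h (nrm (Li a) h + e)" "interp_le b k (nrm (Li b) k + e)" if "0 < e" for e
    by (rule interp_approx[OF h that], rule interp_approx[OF k that])
  have mem: "lp_product b h k \<in> elems Z"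
    using lp_product_norm(1)[OF hk[OF zero_less_one] ab] lp_product_interp[OF hk[OF zero_less_one] ab]
    unfolding Z by (auto simp: interp_elems)
  have "nrm Z (lp_product b h k) \<le> (nrm (Li a) h + e) * (nrm (Li b) k + e)" if "0 < e" for e
    using lp_product_norm(2)[OF hk[OF that] ab] nrm_interp_le[OF lp_product_interp[OF hk[OF that] ab]] unfolding Z by simp
  then show "nrm Z (lp_product b h k) \<le> nrm (Li a) h * nrm (Li b) k" by (rule le_mult_epsilon)
  show "lp_product b h k \<in> elems Z" by (rule mem)
qed

section \<open>Lp-spaces\<close>

lemma Lp_space_interpolation:
  "p \<noteq> \<infinity> \<Longrightarrow> p \<noteq> 1 \<Longrightarrow> Lp_space P \<phi> p = Li (1 / enn2real p)"
  by (simp add: Lp_space_def)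

lemma act_Lp:
  assumes k: "k \<in> elems (Lp_space P \<phi> p)"
  shows "act k x \<in> elems (Lp_space P \<phi> p)"
    and "nrm (Lp_space P \<phi> p) (act k x) \<le> nrm (Lp_space P \<phi> p) k * norm x"
proof -
  have "act k x \<in> elems (Lp_space P \<phi> p) \<and> nrm (Lp_space P \<phi> p) (act k x) \<le> nrm (Lp_space P \<phi> p) k * norm x"
  proof -
    consider "p = \<infinity>" | "p = 1" | "p \<noteq> \<infinity>" "p \<noteq> 1" by blast
    then show ?thesis
    proof cases
      case 1
      then obtain y where y: "k = E y" using k by (auto simp: Lp_space_def elems_Linf)
      have "act k x = E (y \<circ>\<^sub>J x)" by (simp add: y act_trace_embed)
      then show ?thesis using 1 norm_jordan[of y x] by (simp add: Lp_space_def elems_Linf y)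
    next
      case 2
      then show ?thesis using k predual_act norm_act by (simp add: Lp_space_def)
    next
      case 3
      let ?t = "1 / enn2real p"
      have Lp: "Lp_space P \<phi> p = Li ?t" by (rule Lp_space_interpolation[OF 3])
      have i: "interp_le ?t (act k x) ((nrm (Li ?t) k + e) * norm x)" if "0 < e" for e
        by (rule interp_act[OF interp_approx[OF k[unfolded Lp] that]])
      have "nrm (Li ?t) (act k x) \<le> nrm (Li ?t) k * norm x"
      proof (rule tendsto_lowerbound)
        show "((\<lambda>e. (nrm (Li ?t) k + e) * norm x) \<longlongrightarrow> nrm (Li ?t) k * norm x) (at_right 0)"
          by (rule tendsto_eq_intros refl | simp)+
        show "\<forall>\<^sub>F e in at_right 0. nrm (Li ?t) (act k x) \<le> (nrm (Li ?t) k + e) * norm x"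
          unfolding eventually_at_right_field
          by (intro exI[of _ 1] conjI allI impI zero_less_one nrm_interp_le[OF i])
      qed simp
      moreover have "act k x \<in> elems (Li ?t)" unfolding interp_elems using i[OF zero_less_one] by blast
      ultimately show ?thesis unfolding Lp by blast
    qed
  qed
  then show "act k x \<in> elems (Lp_space P \<phi> p)"
    and "nrm (Lp_space P \<phi> p) (act k x) \<le> nrm (Lp_space P \<phi> p) k * norm x" by blast+
qed

lemma Lp_space_sub_dual: "1 \<le> p \<Longrightarrow> elems (Lp_space P \<phi> p) \<subseteq> dual_space"
proof -
  assume p: "1 \<le> p"
  have "h \<in> P" if "h \<in> elems (Li (1 / enn2real p))" "p \<noteq> \<infinity>" for h
  proof -
    have "1 \<le> enn2real p" using p that(2) by (cases p) (auto simp: ennreal_1[symmetric] simp del: ennreal_1)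
    then show ?thesis using that(1) interp_predual unfolding interp_elems by fastforce
  qed
  then show ?thesis
    using predual_sub_dual trace_embed_predual by (auto simp: Lp_space_def elems_Linf)
qed

lemma enn2real_exponent:
  assumes "1 \<le> p" "p \<noteq> \<infinity>"
  shows "1 / p = ennreal (1 / enn2real p)" "1 \<le> enn2real p"
proof -
  obtain x where x: "p = ennreal x" "0 \<le> x" using assms(2) by (cases p) auto
  then have "1 \<le> x" using assms(1) by (auto simp: ennreal_1[symmetric] simp del: ennreal_1)
  then show "1 / p = ennreal (1 / enn2real p)" "1 \<le> enn2real p"
    using x divide_ennreal[of 1 x] by auto
qed

end

theorem proposition3p13:
  fixes P :: "('a::jb_star_algebra \<Rightarrow>\<^sub>L complex) set"
    and \<phi> :: "'a \<Rightarrow> complex"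
    and p q r :: ennreal
  assumes "jbw_star_algebra P"
    and "normal_faithful_tracial_state P \<phi>"
    and "1 \<le> p" and "1 \<le> q" and "1 \<le> r"
    and "1 / r = 1 / p + 1 / q"
  shows "\<exists>B :: ('a \<Rightarrow>\<^sub>L complex) \<Rightarrow> ('a \<Rightarrow>\<^sub>L complex) \<Rightarrow> ('a \<Rightarrow>\<^sub>L complex).
    complex_bilinear_on (elems (Lp_space P \<phi> p)) (elems (Lp_space P \<phi> q)) B \<and>
    (\<forall>x y. B (trace_embed \<phi> x) (trace_embed \<phi> y) = trace_embed \<phi> (x \<circ>\<^sub>J y)) \<and>
    (\<forall>h\<in>elems (Lp_space P \<phi> p). \<forall>k\<in>elems (Lp_space P \<phi> q).
       B h k \<in> elems (Lp_space P \<phi> r) \<and>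
       nrm (Lp_space P \<phi> r) (B h k) \<le> nrm (Lp_space P \<phi> p) h * nrm (Lp_space P \<phi> q) k)"
proof -
  interpret jbw_trace P \<phi> using assms(1,2) by unfold_locales
  have inv_eq: "s = t" if "1 / s = 1 / t" for s t :: ennreal
  proof -
    have inv_inv: "inverse (inverse u) = u" for u :: ennreal
    proof (cases u)
      case (real x)
      then show ?thesis by (cases "x = 0") (simp_all add: inverse_ennreal)
    qed simp
    have "inverse s = inverse t" using that by (simp add: divide_ennreal_def)
    then show ?thesis by (metis inv_inv)
  qed
  have Linf: "Lp_space P \<phi> \<infinity> = Linf" by (simp add: Lp_space_def)
  consider "p = \<infinity>" | "q = \<infinity>" | "p \<noteq> \<infinity>" "q \<noteq> \<infinity>" by blast
  then show ?thesis
  proof cases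
    case 1
    have r: "r = q" by (rule inv_eq) (use assms(6) 1 in simp)
    have dual: "k \<in> dual_space" if "k \<in> elems (Lp_space P \<phi> q)" for k
      using Lp_space_sub_dual[OF assms(4)] that by blast
    show ?thesis
      unfolding 1 r Linf elems_Linf
    proof (intro exI[of _ "\<lambda>h k. act k (inv E h)"] conjI allI ballI)
      show "complex_bilinear_on (range E) (elems (Lp_space P \<phi> q)) (\<lambda>h k. act k (inv E h))"
        unfolding complex_bilinear_on_def
        by (auto simp: trace_embed_add[symmetric] trace_embed_scaleC[symmetric] act_add_left act_add_right
            act_scaleC_left act_scaleC_right[OF dual])
      show "act (E y) (inv E (E x)) = E (x \<circ>\<^sub>J y)" for x y
        by (simp add: act_trace_embed jordan_commute)
      fix h k assume h: "h \<in> range E" and k: "k \<in> elems (Lp_space P \<phi> q)"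
      from h obtain x where x: "h = E x" by blast
      show "act k (inv E h) \<in> elems (Lp_space P \<phi> q)" by (rule act_Lp(1)[OF k])
      show "nrm (Lp_space P \<phi> q) (act k (inv E h)) \<le> nrm Linf h * nrm (Lp_space P \<phi> q) k"
        using act_Lp(2)[OF k, of x] by (simp add: x mult.commute)
    qed
  next
    case 2
    have r: "r = p" by (rule inv_eq) (use assms(6) 2 in simp)
    have dual: "k \<in> dual_space" if "k \<in> elems (Lp_space P \<phi> p)" for k
      using Lp_space_sub_dual[OF assms(3)] that by blast
    show ?thesis
      unfolding 2 r Linf elems_Linf
    proof (intro exI[of _ "\<lambda>h k. act h (inv E k)"] conjI allI ballI)
      show "complex_bilinear_on (elems (Lp_space P \<phi> p)) (range E) (\<lambda>h k. act h (inv E k))"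
        unfolding complex_bilinear_on_def
        by (auto simp: trace_embed_add[symmetric] trace_embed_scaleC[symmetric] act_add_left act_add_right
            act_scaleC_left act_scaleC_right[OF dual])
      show "act (E x) (inv E (E y)) = E (x \<circ>\<^sub>J y)" for x y
        by (simp add: act_trace_embed)
      fix h k assume h: "h \<in> elems (Lp_space P \<phi> p)" and k: "k \<in> range E"
      from k obtain y where y: "k = E y" by blast
      show "act h (inv E k) \<in> elems (Lp_space P \<phi> p)" by (rule act_Lp(1)[OF h])
      show "nrm (Lp_space P \<phi> p) (act h (inv E k)) \<le> nrm (Lp_space P \<phi> p) h * nrm Linf k"
        using act_Lp(2)[OF h, of y] by (simp add: y)
    qed
  next
    case 3
    define a b where "a = 1 / enn2real p" and "b = 1 / enn2real q"
    have ab: "0 < a" "0 < b" "1 / p = ennreal a" "1 / q = ennreal b"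
      using enn2real_exponent[OF assms(3) 3(1)] enn2real_exponent[OF assms(4) 3(2)] by (auto simp: a_def b_def)
    have sum: "1 / r = ennreal (a + b)" using assms(6) ab by simp
    have r_inf: "r \<noteq> \<infinity>"
    proof
      assume "r = \<infinity>"
      then have "ennreal (a + b) = 0" using sum by simp
      then show False using ab by (simp add: ennreal_eq_0_iff)
    qed
    have "ennreal (a + b) = ennreal (1 / enn2real r)"
      using sum enn2real_exponent(1)[OF assms(5) r_inf] by simp
    then have c: "a + b = 1 / enn2real r" using ab by (subst (asm) ennreal_inj) auto
    then have c1: "a + b \<le> 1" using enn2real_exponent(2)[OF assms(5) r_inf] by simp
    have "p \<noteq> 1" "q \<noteq> 1" using ab c1 by (auto simp: a_def b_def)
    then have Lpq: "Lp_space P \<phi> p = Li a" "Lp_space P \<phi> q = Li b"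
      using 3 by (simp_all add: Lp_space_interpolation a_def b_def)
    have "r = 1 \<longleftrightarrow> a + b = 1"
    proof
      assume ab1: "a + b = 1"
      show "r = 1" by (rule inv_eq) (use sum ab1 in simp)
    qed (simp add: c)
    then have Lr: "Lp_space P \<phi> r = (if a + b = 1 then L1 else Li (a + b))"
      using r_inf by (simp add: Lp_space_def c)
    show ?thesis unfolding Lpq by (rule holder_interpolation[OF ab(1,2) c1 Lr])
  qed
qed

end
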